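(* Let $(\mathfrak g,[\cdot,\cdot],\alpha,B)$ be a nonzero finite-dimensional irreducible IQH-Lie algebra over $\mathbb K$ with $\mathcal Z(\mathfrak g)=\{0\}$. Then either $(\mathfrak g,[\cdot,\cdot],\alpha)$ is an involutive simple Hom-Lie algebra, or $(\mathfrak g,[\cdot,\cdot],\alpha,B)$ is obtained as an involutive double extension of an IQH-Lie algebra $(V,[\cdot,\cdot]_V,\alpha_V,B_V)$ by an involutive simple Hom-Lie algebra.
   Context: $\mathbb K$ is an algebraically closed field of characteristic $0$. A Hom-Lie algebra is a triple $(\mathfrak g,[\cdot,\cdot],\alpha)$ with $[\cdot,\cdot]$ a skew-symmetric bilinear bracket and $\alpha$ a linear map such that $[\alpha(x),[y,z]]+[\alpha(y),[z,x]]+[\alpha(z),[x,y]]=0$ for all $x,y,z$. It is called involutive here if $\alpha^2=\mathrm{id}$ and $\alpha([x,y])=[\alpha(x),\alpha(y)]$. An IQH-Lie algebra $(\mathfrak g,[\cdot,\cdot],\alpha,B)$ is an involutive Hom-Lie algebra with a symmetric nondegenerate bilinear form $B$ satisfying $B([x,y],z)=B(x,[y,z])$ and $B(\alpha(x),y)=B(x,\alpha(y))$. The center is $\mathcal Z(\mathfrak g)=\{x:[x,y]=0\ \forall y\}$. An ideal is a subspace $I$ with $[I,\mathfrak g]\subseteq I$ and $\alpha(I)\subseteq I$; it is nondegenerate if $B|_{I\times I}$ is nondegenerate. A quadratic Hom-Lie algebra is irreducible if it has no nondegenerate ideal other than $\{0\}$ and itself. A Hom-Lie algebra is simple if its bracket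 is not identically zero and it has no ideals other than $\{0\}$ and itself. Involutive double extension of an IQH-Lie algebra $(V,[\cdot,\cdot]_V,\alpha_V,B_V)$ by an involutive Hom-Lie algebra $(A,[\cdot,\cdot]_A,\alpha_A)$: let $\phi:A\to\mathrm{End}(V)$ be linear with, for all $a,b\in A$, $x,y\in V$, (i) $\phi([a,b]_A)\circ\alpha_V=\phi(\alpha_A(a))\phi(b)-\phi(\alpha_A(b))\phi(a)$; (ii) $\alpha_V\phi(a)([x,y]_V)=[\phi(a)\alpha_V(x),y]_V+[x,\phi(a)\alpha_V(y)]_V$; (iii) $\phi(\alpha_A(a))=\alpha_V\phi(a)\alpha_V$; (iv) $B_V(\phi(a)x,y)=-B_V(x,\phi(a)y)$. Let $\psi:V\times V\to A^*$, $\psi(x,y)(a)=B_V(\phi(a)x,y)$, let $\widetilde{\mathrm{ad}}_A(a)(f)=-f\circ[a,\cdot]_A$ for $f\in A^*$, and let $\gamma$ be a symmetric bilinear form on $A$ with $\gamma([a,b]_A,c)=\gamma(a,[b,c]_A)$ and $\gamma(\alpha_A(a),b)=\gamma(a,\alpha_A(b))$. The involutive double extension of $V$ by $A$ by means of $(\phi,\gamma)$ is $A^*\oplus V\oplus A$ with $[f+v+a,f'+v'+a']=\widetilde{\mathrm{ad}}_A(a)(f')-\widetilde{\mathrm{ad}}_A(a')(f)+\psi(v,v')+[v,v']_V+\phi(a)(v')-\phi(a')(v)+[a,a']_A$, twist map $f+v+a\mapsto f\circ\alpha_A+\alpha_V(v)+\alpha_A(a)$, and form $B_\gamma(f+v+a,f'+v'+a')=B_V(v,v')+f(a')+f'(a)+\gamma(a,a')$.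 "Obtained as" means up to isomorphism of quadratic Hom-Lie algebras (bijective linear map preserving brackets, twist maps and forms). *)

theory Defs
  imports
    "HOL-Computational_Algebra.Polynomial"
    "HOL-Library.Function_Algebras"
    "HOL-Library.Product_Plus"
begin

text \<open>
  Algebras are carried by a subspace of an ambient vector space.  The structure maps are total
  functions on the ambient type, but only their values on the carrier are ever constrained or used.
  Carriers (instead of whole types) make it possible to quantify existentially over algebras:
  up to isomorphism, every algebra of dimension at most that of a given one can be realised on a
  subspace of the ambient type of the latter.
\<close>

definition linear_map_on ::
    "('k \<Rightarrow> 'a \<Rightarrow> 'a) \<Rightarrow> 'a set \<Rightarrow> ('k \<Rightarrow> 'b \<Rightarrow> 'b) \<Rightarrow> 'b set \<Rightarrow> ('a::plus \<Rightarrow> 'b::plus) \<Rightarrow> bool"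
  where "linear_map_on s S t T f \<longleftrightarrow>
    (\<forall>x\<in>S. f x \<in> T) \<and>
    (\<forall>x\<in>S. \<forall>y\<in>S. f (x + y) = f x + f y) \<and>
    (\<forall>c. \<forall>x\<in>S. f (s c x) = t c (f x))"

definition bilinear_map_on ::
    "('k \<Rightarrow> 'a \<Rightarrow> 'a) \<Rightarrow> 'a set \<Rightarrow> ('k \<Rightarrow> 'b \<Rightarrow> 'b) \<Rightarrow> 'b set \<Rightarrow> ('k \<Rightarrow> 'c \<Rightarrow> 'c) \<Rightarrow> 'c set
      \<Rightarrow> ('a::plus \<Rightarrow> 'b::plus \<Rightarrow> 'c::plus) \<Rightarrow> bool"
  where "bilinear_map_on s S t T u U b \<longleftrightarrow>
    (\<forall>x\<in>S. linear_map_on t T u U (b x)) \<and>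
    (\<forall>y\<in>T. linear_map_on s S u U (\<lambda>x. b x y))"

record ('k, 'a) hom_lie =
  carr :: "'a set"
  scal :: "'k \<Rightarrow> 'a \<Rightarrow> 'a"
  brk :: "'a \<Rightarrow> 'a \<Rightarrow> 'a"
  twist :: "'a \<Rightarrow> 'a"

record ('k, 'a) quad_hom_lie = "('k, 'a) hom_lie" +
  form :: "'a \<Rightarrow> 'a \<Rightarrow> 'k"

locale hom_lie_algebra = vector_space "scal L"
  for L :: "('k::field, 'a::ab_group_add, 'z) hom_lie_scheme" +
  assumes subspace_carr: "subspace (carr L)"
    and brk_bilinear:
      "bilinear_map_on (scal L) (carr L) (scal L) (carr L) (scal L) (carr L) (brk L)"
    and twist_linear: "linear_map_on (scal L) (carr L) (scal L) (carr L) (twist L)"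
    and brk_skew: "\<lbrakk>x \<in> carr L; y \<in> carr L\<rbrakk> \<Longrightarrow> brk L x y = - brk L y x"
    and hom_jacobi: "\<lbrakk>x \<in> carr L; y \<in> carr L; z \<in> carr L\<rbrakk> \<Longrightarrow>
      brk L (twist L x) (brk L y z) + brk L (twist L y) (brk L z x)
        + brk L (twist L z) (brk L x y) = 0"

locale involutive_hom_lie_algebra = hom_lie_algebra L
  for L :: "('k::field, 'a::ab_group_add, 'z) hom_lie_scheme" +
  assumes twist_twist: "x \<in> carr L \<Longrightarrow> twist L (twist L x) = x"
    and twist_brk: "\<lbrakk>x \<in> carr L; y \<in> carr L\<rbrakk> \<Longrightarrow>
      twist L (brk L x y) = brk L (twist L x) (twist L y)"

definition nondegenerate_on :: "('a::zero \<Rightarrow> 'a \<Rightarrow> 'k::zero) \<Rightarrow> 'a set \<Rightarrow> bool"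
  where "nondegenerate_on B S \<longleftrightarrow> (\<forall>x\<in>S. (\<forall>y\<in>S. B x y = 0) \<longrightarrow> x = 0)"

definition invariant_symmetric_form ::
    "('k::field, 'a::ab_group_add, 'z) hom_lie_scheme \<Rightarrow> ('a \<Rightarrow> 'a \<Rightarrow> 'k) \<Rightarrow> bool"
  where "invariant_symmetric_form L B \<longleftrightarrow>
    bilinear_map_on (scal L) (carr L) (scal L) (carr L) (*) UNIV B \<and>
    (\<forall>x\<in>carr L. \<forall>y\<in>carr L. B x y = B y x) \<and>
    (\<forall>x\<in>carr L. \<forall>y\<in>carr L. \<forall>z\<in>carr L. B (brk L x y) z = B x (brk L y z)) \<and>
    (\<forall>x\<in>carr L. \<forall>y\<in>carr L. B (twist L x) y = B x (twist L y))"

locale iqh_lie_algebra = involutive_hom_lie_algebra L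
  for L :: "('k::field, 'a::ab_group_add, 'z) quad_hom_lie_scheme" +
  assumes form_invariant: "invariant_symmetric_form L (form L)"
    and form_nondegenerate: "nondegenerate_on (form L) (carr L)"

definition fin_dim :: "('k::field, 'a::ab_group_add, 'z) hom_lie_scheme \<Rightarrow> bool"
  where "fin_dim L \<longleftrightarrow> (\<exists>S. finite S \<and> module.span (scal L) S = carr L)"

definition center :: "('k::field, 'a::ab_group_add, 'z) hom_lie_scheme \<Rightarrow> 'a set"
  where "center L = {x \<in> carr L. \<forall>y\<in>carr L. brk L x y = 0}"

definition hom_ideal :: "('k::field, 'a::ab_group_add, 'z) hom_lie_scheme \<Rightarrow> 'a set \<Rightarrow> bool"
  where "hom_ideal L I \<longleftrightarrow>
    I \<subseteq> carr L \<and> module.subspace (scal L) I \<and>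
    (\<forall>x\<in>I. \<forall>y\<in>carr L. brk L x y \<in> I) \<and>
    (\<forall>x\<in>I. twist L x \<in> I)"

definition irreducible_quad :: "('k::field, 'a::ab_group_add, 'z) quad_hom_lie_scheme \<Rightarrow> bool"
  where "irreducible_quad L \<longleftrightarrow>
    (\<forall>I. hom_ideal L I \<and> nondegenerate_on (form L) I \<longrightarrow> I = {0} \<or> I = carr L)"

definition simple_hom_lie :: "('k::field, 'a::ab_group_add, 'z) hom_lie_scheme \<Rightarrow> bool"
  where "simple_hom_lie L \<longleftrightarrow>
    (\<exists>x\<in>carr L. \<exists>y\<in>carr L. brk L x y \<noteq> 0) \<and>
    (\<forall>I. hom_ideal L I \<longrightarrow> I = {0} \<or> I = carr L)"

definition quad_hom_lie_iso ::
    "('k::field, 'a::ab_group_add, 'y) quad_hom_lie_scheme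
      \<Rightarrow> ('k, 'b::ab_group_add, 'z) quad_hom_lie_scheme \<Rightarrow> ('a \<Rightarrow> 'b) \<Rightarrow> bool"
  where "quad_hom_lie_iso L M f \<longleftrightarrow>
    linear_map_on (scal L) (carr L) (scal M) (carr M) f \<and>
    bij_betw f (carr L) (carr M) \<and>
    (\<forall>x\<in>carr L. \<forall>y\<in>carr L. f (brk L x y) = brk M (f x) (f y)) \<and>
    (\<forall>x\<in>carr L. f (twist L x) = twist M (f x)) \<and>
    (\<forall>x\<in>carr L. \<forall>y\<in>carr L. form M (f x) (f y) = form L x y)"

text \<open>
  Functionals on the carrier of \<open>A\<close> are represented by functions that vanish off the carrier, so
  that each functional has exactly one representative and the pointwise operations are those of the
  dual space.
\<close>

definition restrict0 :: "'a set \<Rightarrow> ('a \<Rightarrow> 'k::zero) \<Rightarrow> 'a \<Rightarrow> 'k"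
  where "restrict0 S f = (\<lambda>x. if x \<in> S then f x else 0)"

definition dual_carr :: "('k::field, 'a::ab_group_add, 'z) hom_lie_scheme \<Rightarrow> ('a \<Rightarrow> 'k) set"
  where "dual_carr A =
    {f. linear_map_on (scal A) (carr A) (*) UNIV f \<and> (\<forall>x. x \<notin> carr A \<longrightarrow> f x = 0)}"

definition dual_twist ::
    "('k::field, 'a::ab_group_add, 'z) hom_lie_scheme \<Rightarrow> ('a \<Rightarrow> 'k) \<Rightarrow> 'a \<Rightarrow> 'k"
  where "dual_twist A f = restrict0 (carr A) (f \<circ> twist A)"

definition coad ::
    "('k::field, 'a::ab_group_add, 'z) hom_lie_scheme \<Rightarrow> 'a \<Rightarrow> ('a \<Rightarrow> 'k) \<Rightarrow> 'a \<Rightarrow> 'k"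
  where "coad A a f = restrict0 (carr A) (\<lambda>b. - f (brk A a b))"

definition psi ::
    "('k::field, 'v::ab_group_add, 'y) quad_hom_lie_scheme
      \<Rightarrow> ('k, 'a::ab_group_add, 'z) hom_lie_scheme \<Rightarrow> ('a \<Rightarrow> 'v \<Rightarrow> 'v) \<Rightarrow> 'v \<Rightarrow> 'v \<Rightarrow> 'a \<Rightarrow> 'k"
  where "psi V A \<phi> x y = restrict0 (carr A) (\<lambda>a. form V (\<phi> a x) y)"

locale double_extension_data = V: iqh_lie_algebra V + A: involutive_hom_lie_algebra A
  for V :: "('k::field, 'v::ab_group_add, 'y) quad_hom_lie_scheme"
  and A :: "('k, 'a::ab_group_add, 'z) hom_lie_scheme" +
  fixes \<phi> :: "'a \<Rightarrow> 'v \<Rightarrow> 'v"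
  and \<gamma> :: "'a \<Rightarrow> 'a \<Rightarrow> 'k"
  assumes phi_linear:
      "bilinear_map_on (scal A) (carr A) (scal V) (carr V) (scal V) (carr V) \<phi>"
    and phi_brk: "\<lbrakk>a \<in> carr A; b \<in> carr A; x \<in> carr V\<rbrakk> \<Longrightarrow>
      \<phi> (brk A a b) (twist V x) = \<phi> (twist A a) (\<phi> b x) - \<phi> (twist A b) (\<phi> a x)"
    and phi_deriv: "\<lbrakk>a \<in> carr A; x \<in> carr V; y \<in> carr V\<rbrakk> \<Longrightarrow>
      twist V (\<phi> a (brk V x y)) = brk V (\<phi> a (twist V x)) y + brk V x (\<phi> a (twist V y))"
    and phi_twist: "\<lbrakk>a \<in> carr A; x \<in> carr V\<rbrakk> \<Longrightarrow>
      \<phi> (twist A a) x = twist V (\<phi> a (twist V x))"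
    and phi_skew: "\<lbrakk>a \<in> carr A; x \<in> carr V; y \<in> carr V\<rbrakk> \<Longrightarrow>
      form V (\<phi> a x) y = - form V x (\<phi> a y)"
    and gamma_invariant: "invariant_symmetric_form A \<gamma>"

definition double_extension ::
    "('k::field, 'v::ab_group_add, 'y) quad_hom_lie_scheme
      \<Rightarrow> ('k, 'a::ab_group_add, 'z) hom_lie_scheme
      \<Rightarrow> ('a \<Rightarrow> 'v \<Rightarrow> 'v) \<Rightarrow> ('a \<Rightarrow> 'a \<Rightarrow> 'k) \<Rightarrow> ('k, ('a \<Rightarrow> 'k) \<times> 'v \<times> 'a) quad_hom_lie"
  where "double_extension V A \<phi> \<gamma> = \<lparr>
    carr = dual_carr A \<times> carr V \<times> carr A,
    scal = (\<lambda>c (f, v, a). (\<lambda>x. c * f x, scal V c v, scal A c a)),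
    brk = (\<lambda>(f, v, a) (f', v', a').
      (coad A a f' - coad A a' f + psi V A \<phi> v v',
       brk V v v' + \<phi> a v' - \<phi> a' v,
       brk A a a')),
    twist = (\<lambda>(f, v, a). (dual_twist A f, twist V v, twist A a)),
    form = (\<lambda>(f, v, a) (f', v', a'). form V v v' + f a' + f' a + \<gamma> a a')\<rparr>"

end

theory Submission
  imports Defs
begin

text \<open>
  Since \<open>\<alpha>\<close> is involutive, \<open>\<alpha> [x, y]\<close> is an ordinary Lie bracket with automorphism \<open>\<alpha>\<close>, and
  Hom-ideals are its \<open>\<alpha>\<close>-stable ideals.  If \<open>\<gg>\<close> is not simple, let \<open>I\<close> be a maximal proper ideal and
  \<open>J = I\<^sup>\<bottom>\<close>.  Irreducibility forces \<open>J \<subseteq> I\<close>, and the trivial center forces \<open>\<gg> / I\<close> to be non-abelian,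
  hence simple.  An \<open>\<alpha>\<close>-stable Levi complement \<open>S\<close> of \<open>I\<close> is paired with \<open>J\<close> by the form, and
  \<open>\<gg> = J \<oplus> V \<oplus> S\<close> with \<open>V = I \<inter> S\<^sup>\<bottom>\<close> is the double extension.

  The complement is found as a minimal \<open>\<alpha>\<close>-stable subalgebra \<open>S\<close> with \<open>S + I = \<gg>\<close>.  The ideal
  \<open>N = S \<inter> I\<close> of \<open>S\<close> contains only non-generators.  By a Fitting argument its \<open>\<alpha>\<close>-eigenvectors are
  ad-nilpotent, so the trace form of the adjoint module vanishes on \<open>N\<close> and, by Cartan's criterion,
  \<open>[N, N] \<noteq> N\<close> unless \<open>N = 0\<close>.  Complete reducibility of \<open>S\<close>-modules on which \<open>N\<close> is trivial,
  applied to linear maps \<open>S \<rightarrow> N\<close> that are scalar on \<open>N\<close> modulo \<open>[N, N]\<close>, yields an equivariant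
  projection onto \<open>N\<close> modulo \<open>[N, N]\<close>; its kernel supplements \<open>N\<close>, so \<open>N = [N, N]\<close> and hence
  \<open>N = 0\<close>.
\<close>

section \<open>Linear algebra on finite-dimensional subspaces\<close>

text \<open>The obstacle is equivariance. The quotient by \<open>I\<close> is simple only among
  \<open>\<alpha>\<close>-stable ideals and may be a product of Lie ideals permuted by
  \<open>\<alpha>\<close>, so every construction carries the involution along, and in the module
  theory simplicity enters as the hypothesis that proper stable ideals act trivially. Moreover
  \<open>S\<close> is not known to be semisimple before \<open>N = 0\<close> is proved; statements
  about semisimple algebras are therefore replaced by statements about perfect ones, with Casimir
  operators formed from trace forms modulo their radicals.

  Linear maps that are the identity on \<open>N\<close> modulo \<open>[N, N]\<close> form an affine
  set, not a module. Admitting an arbitrary scalar makes them a module, and \<open>S\<close> sends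
  all of it into the submodule of scalar zero; an invariant outside that submodule has nonzero
  scalar and can be normalized.

  A general ground field of characteristic 0 offers no complex conjugation for the positivity
  argument in Cartan's criterion; coordinates over the rationals take its place.\<close>

locale lin_space = vector_space scale
  for scale :: "'a::field \<Rightarrow> 'b::ab_group_add \<Rightarrow> 'b"
begin

abbreviation lin :: "'b set \<Rightarrow> 'b set \<Rightarrow> ('b \<Rightarrow> 'b) \<Rightarrow> bool"
  where "lin V U f \<equiv> linear_map_on scale V scale U f"

lemma linD:
  assumes "lin V U f"
  shows "x \<in> V \<Longrightarrow> f x \<in> U" "x \<in> V \<Longrightarrow> y \<in> V \<Longrightarrow> f (x + y) = f x + f y"
    "x \<in> V \<Longrightarrow> f (scale c x) = scale c (f x)"
  using assms by (auto simp: linear_map_on_def)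

lemma linI:
  assumes "\<And>x. x \<in> V \<Longrightarrow> f x \<in> U"
    and "\<And>x y. x \<in> V \<Longrightarrow> y \<in> V \<Longrightarrow> f (x + y) = f x + f y"
    and "\<And>c x. x \<in> V \<Longrightarrow> f (scale c x) = scale c (f x)"
  shows "lin V U f"
  using assms by (auto simp: linear_map_on_def)

lemma lin_0: assumes "subspace V" "lin V U f" shows "f 0 = 0"
  using linD(3)[OF assms(2) subspace_0[OF assms(1)], of 0] by simp

lemma lin_neg: assumes "subspace V" "lin V U f" "x \<in> V" shows "f (- x) = - f x"
  using linD(3)[OF assms(2,3), of "-1"] by simp

lemma lin_diff: assumes "subspace V" "lin V U f" "x \<in> V" "y \<in> V" shows "f (x - y) = f x - f y"
  using linD(2)[OF assms(2,3), of "-y"] lin_neg[OF assms(1,2,4)] subspace_neg[OF assms(1,4)] by simp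

lemma lin_sum:
  assumes "subspace V" "lin V U f" "\<And>i. i \<in> A \<Longrightarrow> g i \<in> V"
  shows "f (sum g A) = (\<Sum>i\<in>A. f (g i))"
  using assms(3)
proof (induction A rule: infinite_finite_induct)
  case (insert a A)
  then show ?case using linD(2)[OF assms(2)] subspace_sum[OF assms(1), of A g] by simp
qed (simp_all add: lin_0[OF assms(1,2)])

lemma lin_subset: "lin V U f \<Longrightarrow> V' \<subseteq> V \<Longrightarrow> (\<And>x. x \<in> V' \<Longrightarrow> f x \<in> U') \<Longrightarrow> lin V' U' f"
  unfolding linear_map_on_def by blast

lemma lin_add: "subspace U \<Longrightarrow> lin V U f \<Longrightarrow> lin V U g \<Longrightarrow> lin V U (\<lambda>x. f x + g x)"
  by (auto simp: linear_map_on_def subspace_add scale_right_distrib add_ac)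

lemma lin_diff_fun: "subspace U \<Longrightarrow> lin V U f \<Longrightarrow> lin V U g \<Longrightarrow> lin V U (\<lambda>x. f x - g x)"
  by (auto simp: linear_map_on_def subspace_diff scale_right_diff_distrib add_diff_add)

lemma lin_scale: "subspace U \<Longrightarrow> lin V U f \<Longrightarrow> lin V U (\<lambda>x. scale c (f x))"
  by (auto simp: linear_map_on_def subspace_scale scale_right_distrib scale_left_commute)

lemma lin_sum_fun:
  assumes "subspace U" "\<And>i. i \<in> A \<Longrightarrow> lin V U (g i)"
  shows "lin V U (\<lambda>x. \<Sum>i\<in>A. g i x)"
  using assms(2)
proof (induction A rule: infinite_finite_induct)
  case (insert a A)
  then show ?case using lin_add[OF assms(1), of V "g a" "\<lambda>x. \<Sum>i\<in>A. g i x"] by simp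
qed (auto simp: linear_map_on_def subspace_0[OF assms(1)])

lemma lin_compose: "lin V U f \<Longrightarrow> lin U W g \<Longrightarrow> lin V W (\<lambda>x. g (f x))"
  by (auto simp: linear_map_on_def)

lemma lin_id: "V \<subseteq> U \<Longrightarrow> lin V U (\<lambda>x. x)"
  by (auto simp: linear_map_on_def)

lemma lin_funpow: "lin V V f \<Longrightarrow> lin V V (f ^^ n)"
  by (induction n) (auto simp: linear_map_on_def)

lemma lin_shift: "subspace V \<Longrightarrow> lin V V f \<Longrightarrow> lin V V (\<lambda>x. f x - scale a x)"
  by (intro lin_diff_fun lin_scale lin_id) auto

lemma subspace_lin_image: assumes "subspace V" "lin V U f" shows "subspace (f ` V)"
proof (rule subspaceI)
  show "0 \<in> f ` V" using lin_0[OF assms] subspace_0[OF assms(1)] by force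
next
  fix x y assume "x \<in> f ` V" "y \<in> f ` V"
  then obtain a b where "a \<in> V" "b \<in> V" "x = f a" "y = f b" by auto
  then show "x + y \<in> f ` V" using linD(2)[OF assms(2), of a b] subspace_add[OF assms(1), of a b] by force
next
  fix c x assume "x \<in> f ` V"
  then obtain a where "a \<in> V" "x = f a" by auto
  then show "scale c x \<in> f ` V" using linD(3)[OF assms(2), of a c] subspace_scale[OF assms(1), of a c] by force
qed

subsection \<open>Dimension\<close>

text \<open>Containment in a finitely generated span, instead of equality, lets the property pass to
  subspaces at once.\<close>

definition fd :: "'b set \<Rightarrow> bool"
  where "fd V \<longleftrightarrow> subspace V \<and> (\<exists>F. finite F \<and> V \<subseteq> span F)"

lemma fd_subspace: "fd V \<Longrightarrow> subspace V"
  by (simp add: fd_def)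

lemma fd_subset: "fd V \<Longrightarrow> subspace U \<Longrightarrow> U \<subseteq> V \<Longrightarrow> fd U"
  by (auto simp: fd_def)

definition basis_of :: "'b set \<Rightarrow> 'b set \<Rightarrow> bool"
  where "basis_of B V \<longleftrightarrow> finite B \<and> independent B \<and> span B = V"

lemma basis_ofD: "basis_of B V \<Longrightarrow> finite B" "basis_of B V \<Longrightarrow> independent B"
    "basis_of B V \<Longrightarrow> span B = V" "basis_of B V \<Longrightarrow> B \<subseteq> V" "basis_of B V \<Longrightarrow> subspace V"
  using span_superset by (auto simp: basis_of_def)

lemma fd_independent_finite:
  assumes "fd V" "independent B" "B \<subseteq> V" shows "finite B"
proof -
  obtain F where "finite F" "V \<subseteq> span F" using assms(1) by (auto simp: fd_def)
  then show ?thesis using independent_span_bound[of F B] assms by auto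
qed

lemma basis_extend:
  assumes "fd V" "independent A" "A \<subseteq> V"
  obtains B where "A \<subseteq> B" "basis_of B V"
proof -
  obtain B where B: "A \<subseteq> B" "B \<subseteq> V" "independent B" "V \<subseteq> span B"
    using maximal_independent_subset_extend[OF assms(3,2)] by blast
  then have "span B = V" using span_minimal[of B V] fd_subspace[OF assms(1)] by auto
  then show ?thesis using B fd_independent_finite[OF assms(1)] that[of B] by (auto simp: basis_of_def)
qed

lemma basis_of_ex: assumes "fd V" shows "\<exists>B. basis_of B V"
  using basis_extend[OF assms independent_empty] by blast

lemma basis_of_fd: "basis_of B V \<Longrightarrow> fd V"
  by (auto simp: basis_of_def fd_def)

lemma basis_of_dim: "basis_of B V \<Longrightarrow> dim V = card B"
  by (metis basis_of_def dim_span_eq_card_independent)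

lemma dim_less:
  assumes "fd V" "subspace U" "U \<subseteq> V" "U \<noteq> V"
  shows "dim U < dim V"
proof -
  obtain A where A: "basis_of A U" using basis_of_ex[OF fd_subset[OF assms(1-3)]] by blast
  then obtain B where B: "A \<subseteq> B" "basis_of B V"
    using basis_extend[OF assms(1), of A] basis_ofD[OF A] assms(3) by blast
  have "A \<noteq> B" using basis_ofD(3)[OF A] basis_ofD(3)[OF B(2)] assms(4) by auto
  then have "card A < card B" using B(1) basis_ofD(1)[OF B(2)] by (simp add: psubset_card_mono)
  then show ?thesis using basis_of_dim A B(2) by simp
qed

lemma dim_le: assumes "fd V" "subspace U" "U \<subseteq> V" shows "dim U \<le> dim V"
  using dim_less[OF assms] by (cases "U = V") auto

lemma complement_ex:
  assumes "fd V" "subspace U" "U \<subseteq> V"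
  obtains C where "subspace C" "C \<subseteq> V" "C \<inter> U = {0}" "\<And>v. v \<in> V \<Longrightarrow> \<exists>c\<in>C. \<exists>u\<in>U. v = c + u"
proof -
  obtain A where A: "basis_of A U" using basis_of_ex[OF fd_subset[OF assms]] by blast
  then obtain B where B: "A \<subseteq> B" "basis_of B V"
    using basis_extend[OF assms(1), of A] basis_ofD[OF A] assms(3) by blast
  let ?C = "span (B - A)"
  have "V = span ((B - A) \<union> A)" using B basis_ofD(3)[OF B(2)] by (simp add: Un_absorb2)
  then have V: "V = {x + y | x y. x \<in> ?C \<and> y \<in> U}" using basis_ofD(3)[OF A] by (simp only: span_Un)
  have "?C \<inter> U = {0}"
  proof -
    have "x = 0" if x: "x \<in> ?C" "x \<in> U" for x
    proof -
      have r: "representation B x = representation (B - A) x"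
        using x by (intro representation_extend[OF basis_ofD(2)[OF B(2)]]) auto
      have r': "representation B x = representation A x"
        using x B(1) basis_ofD(3)[OF A] by (intro representation_extend[OF basis_ofD(2)[OF B(2)]]) auto
      have "representation B x b = 0" for b
        using representation_ne_zero[of "B - A" x b] representation_ne_zero[of A x b] r r' by auto
      then show ?thesis
        using sum_representation_eq[of B x B] basis_ofD[OF B(2)] x assms(3) by auto
    qed
    then show ?thesis using span_zero[of "B - A"] subspace_0[OF assms(2)] by blast
  qed
  moreover have "?C \<subseteq> V" using span_mono[of "B - A" B] basis_ofD(3)[OF B(2)] by auto
  ultimately show ?thesis using that[of ?C] V by blast
qed

text \<open>Linearity rests on the uniqueness of the component in \<open>C\<close>: two candidates
  differ by an element of \<open>C \<inter> U\<close>. The lemma later supplies projections onto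
  prescribed complements.\<close>

lemma projection_along:
  assumes "subspace V" "subspace U" "U \<subseteq> V"
    and C: "subspace C" "C \<subseteq> V" "C \<inter> U = {0}" "\<And>v. v \<in> V \<Longrightarrow> \<exists>c\<in>C. v - c \<in> U"
  shows "\<exists>\<pi>. lin V C \<pi> \<and> (\<forall>v\<in>V. v - \<pi> v \<in> U) \<and> (\<forall>c\<in>C. \<pi> c = c) \<and> (\<forall>u\<in>U. \<pi> u = 0)"
proof -
  define \<pi> where "\<pi> v = (SOME c. c \<in> C \<and> v - c \<in> U)" for v
  have p: "\<pi> v \<in> C \<and> v - \<pi> v \<in> U" if "v \<in> V" for v
    unfolding \<pi>_def by (rule someI_ex) (use C(4)[OF that] in auto)
  have u: "c = \<pi> v" if "v \<in> V" "c \<in> C" "v - c \<in> U" for v c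
  proof -
    have "(v - \<pi> v) - (v - c) \<in> U" by (rule subspace_diff[OF assms(2)]) (use p[OF that(1)] that(3) in auto)
    moreover have "c - \<pi> v \<in> C" by (rule subspace_diff[OF C(1)]) (use p[OF that(1)] that(2) in auto)
    ultimately have "c - \<pi> v \<in> C \<inter> U" by simp
    then show ?thesis using C(3) by simp
  qed
  note sV = assms(1)
  have "lin V C \<pi>"
  proof (rule linI)
    fix x y assume xy: "x \<in> V" "y \<in> V"
    have "(x - \<pi> x) + (y - \<pi> y) \<in> U" using p[OF xy(1)] p[OF xy(2)] assms(2) by (auto intro: subspace_add)
    then have "(x + y) - (\<pi> x + \<pi> y) \<in> U" by (simp add: algebra_simps)
    then show "\<pi> (x + y) = \<pi> x + \<pi> y"
      using u[of "x + y" "\<pi> x + \<pi> y"] xy p by (simp add: subspace_add[OF sV] subspace_add[OF C(1)])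
  next
    fix c x assume x: "x \<in> V"
    have "scale c (x - \<pi> x) \<in> U" using p[OF x] assms(2) by (auto intro: subspace_scale)
    then show "\<pi> (scale c x) = scale c (\<pi> x)"
      using u[of "scale c x" "scale c (\<pi> x)"] x p
      by (simp add: subspace_scale[OF sV] subspace_scale[OF C(1)] scale_right_diff_distrib)
  qed (use p in auto)
  moreover have "\<pi> c = c" if "c \<in> C" for c using u[of c c] that C(2) subspace_0[OF assms(2)] by auto
  moreover have "\<pi> x = 0" if "x \<in> U" for x using u[of x 0] that assms(3) subspace_0[OF C(1)] by auto
  ultimately show ?thesis using p by (intro exI[of _ \<pi>]) auto
qed

text \<open>The complement stands in for the quotient of \<open>V\<close> by \<open>U\<close>, with
  \<open>\<pi>\<close> as the quotient map.\<close>

lemma projection_ex: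
  assumes "fd V" "subspace U" "U \<subseteq> V"
  shows "\<exists>C \<pi>. subspace C \<and> C \<subseteq> V \<and> lin V C \<pi> \<and> (\<forall>v\<in>V. v - \<pi> v \<in> U)
    \<and> (\<forall>c\<in>C. \<pi> c = c) \<and> (\<forall>u\<in>U. \<pi> u = 0)"
proof -
  obtain C where C: "subspace C" "C \<subseteq> V" "C \<inter> U = {0}" "\<And>v. v \<in> V \<Longrightarrow> \<exists>c\<in>C. \<exists>u\<in>U. v = c + u"
    using complement_ex[OF assms] by blast
  have "\<exists>c\<in>C. v - c \<in> U" if "v \<in> V" for v using C(4)[OF that] by force
  from projection_along[OF fd_subspace[OF assms(1)] assms(2,3) C(1-3) this] C(1,2) show ?thesis by blast
qed

text \<open>The image of a basis is independent, hence extends to a basis; since all bases have the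
  same size, it already is one. This turns nondegeneracy of a form into representability of
  functionals.\<close>

lemma lin_inj_imp_surj:
  assumes "fd V" "lin V V f" "\<And>x. x \<in> V \<Longrightarrow> f x = 0 \<Longrightarrow> x = 0"
  shows "f ` V = V"
proof -
  note sV = fd_subspace[OF assms(1)]
  obtain B where B: "basis_of B V" using basis_of_ex[OF assms(1)] by blast
  note Bs = basis_ofD[OF B]
  have inj: "inj_on f B"
  proof (rule inj_onI)
    fix x y assume "x \<in> B" "y \<in> B" and e: "f x = f y"
    then have "x \<in> V" "y \<in> V" using Bs(4) by auto
    then show "x = y"
      using assms(3)[of "x - y"] lin_diff[OF sV assms(2), of x y] subspace_diff[OF sV, of x y] e by simp
  qed
  have "independent (f ` B)"
  proof (rule independent_if_scalars_zero)
    fix g x assume s: "(\<Sum>x\<in>f ` B. scale (g x) x) = 0" and x: "x \<in> f ` B"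
    have "f (\<Sum>b\<in>B. scale (g (f b)) b) = (\<Sum>b\<in>B. scale (g (f b)) (f b))"
    proof (subst lin_sum[OF sV assms(2)])
      show "scale (g (f b)) b \<in> V" if "b \<in> B" for b using that Bs(4) by (auto intro: subspace_scale[OF sV])
      show "(\<Sum>b\<in>B. f (scale (g (f b)) b)) = (\<Sum>b\<in>B. scale (g (f b)) (f b))"
        using Bs(4) linD(3)[OF assms(2)] by (intro sum.cong) auto
    qed
    also have "\<dots> = 0" using s by (simp add: sum.reindex[OF inj])
    finally have "f (\<Sum>b\<in>B. scale (g (f b)) b) = 0" .
    moreover have "(\<Sum>b\<in>B. scale (g (f b)) b) \<in> V"
      using Bs(4) by (intro subspace_sum[OF sV] subspace_scale[OF sV]) auto
    ultimately have "(\<Sum>b\<in>B. scale (g (f b)) b) = 0" using assms(3) by simp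
    then have "g (f b) = 0" if "b \<in> B" for b using independentD[OF Bs(2,1) subset_refl, of "\<lambda>b. g (f b)"] that by simp
    then show "g x = 0" using x by auto
  qed (use Bs(1) in auto)
  moreover have fB: "f ` B \<subseteq> V" using Bs(4) linD(1)[OF assms(2)] by auto
  ultimately obtain B' where B': "f ` B \<subseteq> B'" "basis_of B' V" using basis_extend[OF assms(1)] by blast
  have "card B' = card (f ` B)" using basis_of_dim[OF B] basis_of_dim[OF B'(2)] card_image[OF inj] by simp
  then have "f ` B = B'" using card_subset_eq[OF basis_ofD(1)[OF B'(2)] B'(1)] by simp
  then have "V = span (f ` B)" using basis_ofD(3)[OF B'(2)] by simp
  also have "\<dots> \<subseteq> f ` V" using subspace_lin_image[OF sV assms(2)] Bs(4) by (intro span_minimal) auto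
  finally have "V \<subseteq> f ` V" .
  moreover have "f ` V \<subseteq> V" using linD(1)[OF assms(2)] by auto
  ultimately show ?thesis by (rule equalityI[rotated])
qed

subsection \<open>Traces\<close>

definition tr_basis :: "'b set \<Rightarrow> ('b \<Rightarrow> 'b) \<Rightarrow> 'a"
  where "tr_basis B f = (\<Sum>b\<in>B. representation B (f b) b)"

text \<open>Both sides expand to the same double sum of matrix entries. Allowing two different
  spaces lets one identity yield independence of the basis, cyclicity, and the passage to a subspace
  containing the image.\<close>

lemma tr_basis_commute:
  assumes "basis_of B V" "basis_of C U" "lin V U g" "lin U V h"
  shows "tr_basis B (\<lambda>x. h (g x)) = tr_basis C (\<lambda>x. g (h x))"
proof -
  have *: "tr_basis B (\<lambda>x. h (g x)) = (\<Sum>b\<in>B. \<Sum>c\<in>C. representation C (g b) c * representation B (h c) b)"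
    if "basis_of B V" "basis_of C U" "lin V U g" "lin U V h" for B V C U g h
    unfolding tr_basis_def
  proof (rule sum.cong[OF refl])
    fix b assume b: "b \<in> B"
    note Bs = basis_ofD[OF that(1)] and Cs = basis_ofD[OF that(2)]
    have gb: "g b \<in> U" using b Bs linD(1)[OF that(3)] by auto
    have "g b = (\<Sum>c\<in>C. scale (representation C (g b) c) c)"
      using sum_representation_eq[OF Cs(2) _ Cs(1) subset_refl] gb Cs(3) by simp
    then have "h (g b) = h (\<Sum>c\<in>C. scale (representation C (g b) c) c)" by simp
    also have "\<dots> = (\<Sum>c\<in>C. scale (representation C (g b) c) (h c))"
    proof (subst lin_sum[OF Cs(5) that(4)])
      show "scale (representation C (g b) c) c \<in> U" if "c \<in> C" for c
        using that Cs(4) by (auto intro: subspace_scale[OF Cs(5)])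
      show "(\<Sum>c\<in>C. h (scale (representation C (g b) c) c)) = (\<Sum>c\<in>C. scale (representation C (g b) c) (h c))"
        using Cs(4) linD(3)[OF that(4)] by (intro sum.cong) auto
    qed
    finally have hg: "h (g b) = (\<Sum>c\<in>C. scale (representation C (g b) c) (h c))" .
    have hc: "h c \<in> span B" if "c \<in> C" for c using that Cs(4) linD(1)[OF \<open>lin U V h\<close>] Bs(3) by auto
    show "representation B (h (g b)) b = (\<Sum>c\<in>C. representation C (g b) c * representation B (h c) b)"
      unfolding hg using hc by (subst representation_sum[OF Bs(2)]) (auto simp: span_scale representation_scale[OF Bs(2)])
  qed
  show ?thesis
    unfolding *[OF assms] *[OF assms(2,1,4,3)] by (subst sum.swap) (simp add: mult.commute)
qed

lemma tr_basis_cong: "basis_of B V \<Longrightarrow> (\<And>x. x \<in> V \<Longrightarrow> f x = g x) \<Longrightarrow> tr_basis B f = tr_basis B g"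
  unfolding tr_basis_def by (intro sum.cong refl) (metis basis_ofD(4) subsetD)

definition tr :: "'b set \<Rightarrow> ('b \<Rightarrow> 'b) \<Rightarrow> 'a"
  where "tr V f = tr_basis (SOME B. basis_of B V) f"

lemma some_basis: "fd V \<Longrightarrow> basis_of (SOME B. basis_of B V) V"
  using basis_of_ex someI_ex[of "\<lambda>B. basis_of B V"] by blast

lemma tr_eq_tr_basis: assumes "basis_of B V" "lin V V f" shows "tr V f = tr_basis B f"
  unfolding tr_def
  using tr_basis_commute[OF some_basis assms(1) assms(2) lin_id[OF subset_refl]] basis_of_fd[OF assms(1)] by simp

lemma tr_commute:
  assumes "fd V" "fd U" "lin V U g" "lin U V h"
  shows "tr V (\<lambda>x. h (g x)) = tr U (\<lambda>x. g (h x))"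
  unfolding tr_def by (rule tr_basis_commute[OF some_basis some_basis assms(3,4)]; fact)

lemma tr_cong: "fd V \<Longrightarrow> (\<And>x. x \<in> V \<Longrightarrow> f x = g x) \<Longrightarrow> tr V f = tr V g"
  unfolding tr_def by (rule tr_basis_cong[OF some_basis]) auto

lemma tr_add:
  assumes "fd V" "lin V V f" "lin V V g"
  shows "tr V (\<lambda>x. f x + g x) = tr V f + tr V g"
proof -
  note B = basis_ofD[OF some_basis[OF assms(1)]]
  show ?thesis unfolding tr_def tr_basis_def sum.distrib[symmetric]
    using B(3,4) linD(1)[OF assms(2)] linD(1)[OF assms(3)]
    by (intro sum.cong refl) (subst representation_add[OF B(2)]; auto)
qed

lemma tr_scale:
  assumes "fd V" "lin V V f"
  shows "tr V (\<lambda>x. scale c (f x)) = c * tr V f"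
proof -
  note B = basis_ofD[OF some_basis[OF assms(1)]]
  show ?thesis unfolding tr_def tr_basis_def sum_distrib_left
    using B(3,4) linD(1)[OF assms(2)]
    by (intro sum.cong refl) (subst representation_scale[OF B(2)]; auto)
qed

lemma tr_0: assumes "fd V" shows "tr V (\<lambda>x. 0) = 0"
  by (simp add: tr_def tr_basis_def representation_zero)

lemma tr_diff:
  assumes "fd V" "lin V V f" "lin V V g"
  shows "tr V (\<lambda>x. f x - g x) = tr V f - tr V g"
proof -
  have "tr V (\<lambda>x. f x + scale (-1) (g x)) = tr V f + (-1) * tr V g"
    using assms fd_subspace by (subst tr_add) (auto simp: tr_scale simp del: scale_minus_left intro: lin_scale)
  then show ?thesis by simp
qed

lemma tr_sum:
  assumes "fd V" "\<And>i. i \<in> A \<Longrightarrow> lin V V (f i)"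
  shows "tr V (\<lambda>x. \<Sum>i\<in>A. f i x) = (\<Sum>i\<in>A. tr V (f i))"
  using assms(2)
proof (induction A rule: infinite_finite_induct)
  case (insert a A)
  then show ?case
    using tr_add[OF assms(1), of "f a" "\<lambda>x. \<Sum>i\<in>A. f i x"] lin_sum_fun[OF fd_subspace[OF assms(1)], of A V f] by simp
qed (simp_all add: tr_0[OF assms(1)])

text \<open>Cyclicity for \<open>f\<close> viewed as a map into \<open>U\<close>, followed by the
  inclusion of \<open>U\<close> in \<open>V\<close>.\<close>

lemma tr_image_subset:
  assumes "fd V" "lin V V f" "subspace U" "U \<subseteq> V" "f ` V \<subseteq> U"
  shows "tr V f = tr U f"
proof -
  have "lin V U f" using lin_subset[OF assms(2) subset_refl] assms(5) by auto
  then show ?thesis using tr_commute[OF assms(1) fd_subset[OF assms(1,3,4)] _ lin_id[OF assms(4)]] by simp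
qed

text \<open>Replacing \<open>V\<close> by the image of \<open>f\<close> keeps the trace and lowers
  the exponent by one.\<close>

lemma tr_nilpotent:
  assumes "fd V" "lin V V f" "\<And>x. x \<in> V \<Longrightarrow> (f ^^ n) x = 0"
  shows "tr V f = 0"
  using assms
proof (induction n arbitrary: V)
  case 0
  then show ?case using tr_cong[OF 0(1), of f "\<lambda>x. 0"] tr_0[OF 0(1)] linD(1)[OF 0(2)] by fastforce
next
  case (Suc n)
  let ?U = "f ` V"
  have U: "subspace ?U" "?U \<subseteq> V"
    using subspace_lin_image[OF fd_subspace[OF Suc.prems(1)] Suc.prems(2)] linD(1)[OF Suc.prems(2)] by auto
  have "tr V f = tr ?U f" by (rule tr_image_subset[OF Suc.prems(1,2) U]) simp
  also have "\<dots> = 0"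
  proof (rule Suc.IH)
    show "lin ?U ?U f" by (rule lin_subset[OF Suc.prems(2) U(2)]) (use U in auto)
    fix x assume "x \<in> ?U"
    then show "(f ^^ n) x = 0" using Suc.prems(3) by (auto simp: funpow_swap1)
  qed (rule fd_subset[OF Suc.prems(1) U])
  finally show ?case .
qed

end

section \<open>Generalized eigenspaces\<close>

locale ac_space = lin_space scale
  for scale :: "'a::{alg_closed_field,field_char_0} \<Rightarrow> 'b::ab_group_add \<Rightarrow> 'b"
begin

lemma funpow_zero_mono:
  fixes f :: "'b \<Rightarrow> 'b"
  assumes "(f ^^ n) v = 0" "f 0 = (0::'b)" "n \<le> m"
  shows "(f ^^ m) v = 0"
proof -
  obtain k where "m = k + n" using assms(3) by (metis add.commute le_Suc_ex)
  moreover have "(f ^^ k) 0 = 0" by (induction k) (simp_all add: assms(2))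
  ultimately show ?thesis using assms(1) by (simp add: funpow_add)
qed

definition shift :: "('b \<Rightarrow> 'b) \<Rightarrow> 'a \<Rightarrow> 'b \<Rightarrow> 'b"
  where "shift f a = (\<lambda>w. f w - scale a w)"

definition gen :: "'b set \<Rightarrow> ('b \<Rightarrow> 'b) \<Rightarrow> 'a \<Rightarrow> 'b set"
  where "gen V f a = {v \<in> V. \<exists>n. (shift f a ^^ n) v = 0}"

lemma shift_0: "shift f 0 = f"
  by (simp add: shift_def)

lemma gen_subset: "gen V f a \<subseteq> V"
  by (auto simp: gen_def)

context
  fixes V f
  assumes sV: "subspace V" and f: "lin V V f"
begin

lemma shift_lin: "lin V V (shift f a)"
  unfolding shift_def by (rule lin_shift[OF sV f])

lemma shift_zero: "shift f a 0 = 0"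
  by (rule lin_0[OF sV shift_lin])

lemma shift_pow_lin: "lin V V (shift f a ^^ n)"
  by (rule lin_funpow[OF shift_lin])

lemma shift_commute: "v \<in> V \<Longrightarrow> shift f a (shift f b v) = shift f b (shift f a v)"
  using linD(1,3)[OF f] lin_diff[OF sV f] subspace_scale[OF sV]
  by (simp add: shift_def scale_right_diff_distrib scale_left_commute)

lemma shift_pow_commute: "v \<in> V \<Longrightarrow> (shift f a ^^ n) (shift f b v) = shift f b ((shift f a ^^ n) v)"
  using linD(1)[OF shift_pow_lin] by (induction n) (simp_all add: shift_commute)

lemma gen_subspace: "subspace (gen V f a)"
proof (rule subspaceI)
  show "0 \<in> gen V f a" using subspace_0[OF sV] by (auto simp: gen_def intro: exI[of _ 0])
next
  fix x y assume "x \<in> gen V f a" "y \<in> gen V f a"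
  then obtain n m where n: "x \<in> V" "y \<in> V" "(shift f a ^^ n) x = 0" "(shift f a ^^ m) y = 0"
    by (auto simp: gen_def)
  have "(shift f a ^^ (n + m)) (x + y) = (shift f a ^^ (n + m)) x + (shift f a ^^ (n + m)) y"
    using linD(2)[OF shift_pow_lin] n by blast
  also have "\<dots> = 0"
    using funpow_zero_mono[OF n(3) shift_zero, of "n + m"] funpow_zero_mono[OF n(4) shift_zero, of "n + m"] by simp
  finally show "x + y \<in> gen V f a" using subspace_add[OF sV n(1,2)] by (auto simp: gen_def)
next
  fix c x assume "x \<in> gen V f a"
  then obtain n where n: "x \<in> V" "(shift f a ^^ n) x = 0" by (auto simp: gen_def)
  then have "(shift f a ^^ n) (scale c x) = 0" using linD(3)[OF shift_pow_lin n(1)] by simp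
  then show "scale c x \<in> gen V f a" using subspace_scale[OF sV n(1)] by (auto simp: gen_def)
qed

lemma gen_shift: "v \<in> gen V f a \<Longrightarrow> shift f b v \<in> gen V f a"
  using linD(1)[OF shift_lin] shift_pow_commute shift_zero by (auto simp: gen_def) metis

lemma gen_of_shift: assumes "v \<in> V" "shift f a v \<in> gen V f a" shows "v \<in> gen V f a"
proof -
  obtain n where "(shift f a ^^ n) (shift f a v) = 0" using assms by (auto simp: gen_def)
  then have "(shift f a ^^ Suc n) v = 0" by (simp add: funpow_swap1)
  then show ?thesis using assms(1) unfolding gen_def by blast
qed

text \<open>On \<open>gen V f b\<close> the map \<open>shift f a\<close> is a nonzero scalar plus a
  locally nilpotent map, hence onto.\<close>

lemma gen_solve:
  assumes "v \<in> gen V f b" "a \<noteq> b"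
  shows "\<exists>u \<in> gen V f b. shift f a u = v"
proof -
  obtain n where "(shift f b ^^ n) v = 0" using assms(1) by (auto simp: gen_def)
  then show ?thesis using assms(1)
  proof (induction n arbitrary: v)
    case 0
    then show ?case by (intro bexI[of _ 0]) (simp_all add: shift_zero subspace_0[OF gen_subspace])
  next
    case (Suc n)
    have "(shift f b ^^ n) (shift f b v) = 0" using Suc.prems(1) by (simp add: funpow_swap1)
    then obtain u where u: "u \<in> gen V f b" "shift f a u = shift f b v"
      using Suc.IH gen_shift[OF Suc.prems(2)] by blast
    have V: "u \<in> V" "v \<in> V" using u(1) Suc.prems(2) gen_subset by auto
    \<comment> \<open>\<open>shift f a v\<close> exceeds \<open>shift f b v\<close> by
      \<open>(b - a) v\<close>, so subtracting the solution \<open>u\<close> for the latter leaves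
      exactly \<open>(b - a) v\<close>.\<close>
    let ?w = "scale (1 / (b - a)) (v - u)"
    have "shift f a (v - u) = shift f a v - shift f a u" by (rule lin_diff[OF sV shift_lin V(2,1)])
    also have "\<dots> = scale (b - a) v" by (simp add: u(2)) (simp add: shift_def algebra_simps)
    finally have "shift f a ?w = scale (1 / (b - a)) (scale (b - a) v)"
      using linD(3)[OF shift_lin subspace_diff[OF sV V(2,1)]] by simp
    then have "shift f a ?w = v" using assms(2) by simp
    moreover have "?w \<in> gen V f b"
      using u(1) Suc.prems(2) by (intro subspace_scale[OF gen_subspace] subspace_diff[OF gen_subspace])
    ultimately show ?case by blast
  qed
qed

lemma gen_span_subset: "span (\<Union>a. gen V f a) \<subseteq> V"
  by (rule span_minimal[OF _ sV]) (use gen_subset in auto)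

text \<open>On the weight spaces other than \<open>a\<close> the map \<open>shift f a\<close> is
  onto. Hence \<open>v\<close> can be corrected by an element of the span until
  \<open>shift f a\<close> sends it into \<open>gen V f a\<close>, and the corrected vector then
  lies in \<open>gen V f a\<close> itself.\<close>

lemma gen_span_of_shift:
  assumes "v \<in> V" "shift f a v \<in> span (\<Union>a. gen V f a)"
  shows "v \<in> span (\<Union>a. gen V f a)"
proof -
  let ?S = "span (\<Union>a. gen V f a)"
  have "\<exists>u \<in> ?S. w - shift f a u \<in> gen V f a" if "w \<in> ?S" for w
    using that
  proof (induction w rule: span_induct_alt)
    case base
    then show ?case by (intro bexI[of _ 0]) (simp_all add: shift_zero span_zero subspace_0[OF gen_subspace])
  next
    case (step c x y)
    obtain u where u: "u \<in> ?S" "y - shift f a u \<in> gen V f a" using step.IH by blast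
    obtain b where b: "x \<in> gen V f b" using step.hyps by blast
    show ?case
    proof (cases "b = a")
      case True
      have "scale c x + (y - shift f a u) \<in> gen V f a"
        using True b u(2) by (intro subspace_add[OF gen_subspace] subspace_scale[OF gen_subspace]) auto
      then show ?thesis using u(1) by (auto simp: algebra_simps intro!: bexI[of _ u])
    next
      case False
      obtain w where w: "w \<in> gen V f b" "shift f a w = x" using gen_solve[OF b, of a] False by auto
      have V: "u \<in> V" "w \<in> V" using u(1) gen_span_subset subsetD[OF gen_subset w(1)] by auto
      have "shift f a (scale c w + u) = scale c x + shift f a u"
        using linD(2,3)[OF shift_lin] V subspace_scale[OF sV] w(2) by simp
      moreover have "scale c w + u \<in> ?S" using u(1) w(1) by (intro span_add span_scale) (auto intro: span_base)
      ultimately show ?thesis using u(2) by (auto intro!: bexI[of _ "scale c w + u"])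
    qed
  qed
  then obtain u where u: "u \<in> ?S" "shift f a v - shift f a u \<in> gen V f a" using assms(2) by blast
  have uV: "u \<in> V" using u(1) gen_span_subset by auto
  have "v - u \<in> gen V f a"
    using gen_of_shift[OF subspace_diff[OF sV assms(1) uV]] u(2) lin_diff[OF sV shift_lin assms(1) uV] by simp
  then have "(v - u) + u \<in> ?S" using u(1) by (intro span_add) (auto intro: span_base)
  then show ?thesis by simp
qed

text \<open>From \<open>a w = f w - (f - a) w\<close>, a vector of nonzero weight \<open>a\<close>
  is recovered from the range of \<open>f\<close>. This is the half of Fitting's decomposition that
  later puts the components of nonzero weight into an ideal or a submodule.\<close>

lemma gen_subset_of_range:
  assumes "subspace P" "\<And>w. w \<in> V \<Longrightarrow> f w \<in> P" "a \<noteq> 0"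
  shows "gen V f a \<subseteq> P"
proof -
  have "w \<in> P" if "w \<in> V" "(shift f a ^^ n) w = 0" for n w
    using that
  proof (induction n arbitrary: w)
    case 0
    then show ?case using subspace_0[OF assms(1)] by simp
  next
    case (Suc n)
    have "shift f a w \<in> P"
      using Suc.prems linD(1)[OF shift_lin Suc.prems(1)] by (intro Suc.IH) (auto simp: funpow_swap1)
    then have "f w - shift f a w \<in> P" using assms(2)[OF Suc.prems(1)] subspace_diff[OF assms(1)] by blast
    then have "scale a w \<in> P" by (simp add: shift_def)
    then have "scale (1 / a) (scale a w) \<in> P" by (rule subspace_scale[OF assms(1)])
    then show ?case using assms(3) by simp
  qed
  then show ?thesis by (auto simp: gen_def)
qed

text \<open>A root \<open>a\<close> of \<open>p\<close> exists over an algebraically closed field.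
  The quotient of \<open>p\<close> by \<open>X - a\<close> annihilates \<open>shift f a v\<close>,
  and \<open>gen_span_of_shift\<close> leads back from \<open>shift f a v\<close> to
  \<open>v\<close>.\<close>

lemma gen_span_of_poly:
  assumes "p \<noteq> 0" "v \<in> V" "(\<Sum>i\<le>degree p. scale (coeff p i) ((f ^^ i) v)) = 0"
  shows "v \<in> span (\<Union>a. gen V f a)"
  using assms
proof (induction "degree p" arbitrary: p v)
  case 0
  then have "coeff p 0 \<noteq> 0" by (metis leading_coeff_neq_0)
  then show ?case using 0 span_zero by simp
next
  case (Suc n)
  obtain a where "poly p a = 0" using alg_closed_imp_poly_has_root[of p] Suc.hyps(2) by auto
  then obtain q where q: "p = [:-a, 1:] * q" by (metis poly_eq_0_iff_dvd dvdE)
  have q0: "q \<noteq> 0" using Suc.prems(1) q by auto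
  have dp: "degree p = Suc (degree q)" unfolding q using q0 by (subst degree_mult_eq) auto
  have cp: "coeff p i = coeff (pCons 0 q) i - a * coeff q i" for i unfolding q by simp
  let ?w = "shift f a v"
  have fw: "(f ^^ i) ?w = (f ^^ Suc i) v - scale a ((f ^^ i) v)" for i
  proof -
    have "f v \<in> V" "scale a v \<in> V" using linD(1)[OF f] Suc.prems(2) subspace_scale[OF sV] by auto
    then show ?thesis
      using lin_diff[OF sV lin_funpow[OF f]] linD(3)[OF lin_funpow[OF f] Suc.prems(2)]
      by (simp add: shift_def funpow_swap1)
  qed
  have "(\<Sum>i\<le>degree p. scale (coeff p i) ((f ^^ i) v)) =
      (\<Sum>i\<le>Suc (degree q). scale (coeff (pCons 0 q) i) ((f ^^ i) v))
      - (\<Sum>i\<le>Suc (degree q). scale (a * coeff q i) ((f ^^ i) v))"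
    unfolding dp cp scale_left_diff_distrib sum_subtractf ..
  also have "(\<Sum>i\<le>Suc (degree q). scale (coeff (pCons 0 q) i) ((f ^^ i) v))
      = (\<Sum>i\<le>degree q. scale (coeff q i) ((f ^^ Suc i) v))"
    by (subst sum.atMost_Suc_shift) simp
  also have "(\<Sum>i\<le>Suc (degree q). scale (a * coeff q i) ((f ^^ i) v))
      = (\<Sum>i\<le>degree q. scale (coeff q i) (scale a ((f ^^ i) v)))"
    by (simp add: coeff_eq_0 mult.commute)
  also have "(\<Sum>i\<le>degree q. scale (coeff q i) ((f ^^ Suc i) v)) - \<dots> =
      (\<Sum>i\<le>degree q. scale (coeff q i) ((f ^^ i) ?w))"
    unfolding fw scale_right_diff_distrib sum_subtractf ..
  finally have "(\<Sum>i\<le>degree q. scale (coeff q i) ((f ^^ i) ?w)) = 0" using Suc.prems(3) by simp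
  then have "?w \<in> span (\<Union>a. gen V f a)"
    using Suc.hyps(1)[of q ?w] q0 dp Suc.hyps(2) linD(1)[OF shift_lin Suc.prems(2)] by simp
  then show ?case by (rule gen_span_of_shift[OF Suc.prems(2)])
qed

end

lemma span_finite_image:
  assumes "finite A" "x \<in> span (g ` A)"
  shows "\<exists>c. x = (\<Sum>i\<in>A. scale (c i) (g i))"
  using assms
proof (induction A arbitrary: x rule: finite_induct)
  case (insert a A)
  obtain k where "x - scale k (g a) \<in> span (g ` A)" using insert.prems span_breakdown_eq by auto
  then obtain c where c: "x - scale k (g a) = (\<Sum>i\<in>A. scale (c i) (g i))" using insert.IH by blast
  have "x = (\<Sum>i\<in>insert a A. scale ((c(a := k)) i) (g i))"
  proof -
    have "(\<Sum>i\<in>A. scale ((c(a := k)) i) (g i)) = (\<Sum>i\<in>A. scale (c i) (g i))"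
      using insert.hyps(2) by (intro sum.cong) auto
    then show ?thesis using c insert.hyps by (simp add: algebra_simps)
  qed
  then show ?case by blast
qed auto

text \<open>A linear dependence among the iterates of the single vector \<open>v\<close> gives a
  polynomial annihilating it; such a dependence exists because the number of independent iterates is
  bounded by the size of a spanning set.\<close>

lemma gen_span:
  assumes "fd V" "lin V V f" "v \<in> V"
  shows "v \<in> span (\<Union>a. gen V f a)"
proof -
  note sV = fd_subspace[OF assms(1)]
  let ?g = "\<lambda>i. (f ^^ i) v"
  have gV: "?g i \<in> V" for i using linD(1)[OF lin_funpow[OF assms(2)] assms(3)] .
  have "\<exists>k. ?g k \<in> span (?g ` {..<k})"
  proof (rule ccontr)
    assume n: "\<nexists>k. ?g k \<in> span (?g ` {..<k})"
    have "independent (?g ` {..<k}) \<and> card (?g ` {..<k}) = k" for k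
    proof (induction k)
      case (Suc k)
      have "?g k \<notin> span (?g ` {..<k})" using n by blast
      then have "independent (insert (?g k) (?g ` {..<k}))" "?g k \<notin> ?g ` {..<k}"
        using Suc independent_insertI[of "?g k" "?g ` {..<k}"] span_base[of "?g k" "?g ` {..<k}"] by blast+
      then show ?case using Suc by (simp add: lessThan_Suc)
    qed (simp add: independent_empty)
    then have ind: "independent (?g ` {..<k})" "card (?g ` {..<k}) = k" for k by blast+
    obtain F where F: "finite F" "V \<subseteq> span F" using assms(1) by (auto simp: fd_def)
    have "?g ` {..<Suc (card F)} \<subseteq> span F" using gV F(2) by blast
    then have "card (?g ` {..<Suc (card F)}) \<le> card F" using independent_span_bound[OF F(1) ind(1)] by blast
    then show False unfolding ind(2) by simp
  qed
  then obtain k where "?g k \<in> span (?g ` {..<k})" by blast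
  then obtain c where c: "?g k = (\<Sum>i<k. scale (c i) (?g i))" using span_finite_image[OF finite_lessThan] by blast
  \<comment> \<open>The monic polynomial of the dependence: \<open>X^k\<close> minus the sum of the
    \<open>c i X^i\<close>.\<close>
  define p where "p = (\<Sum>i\<le>k. monom (if i = k then 1 else - c i) i)"
  have cp: "coeff p i = (if i < k then - c i else if i = k then 1 else 0)" for i
    unfolding p_def by (auto simp: coeff_sum coeff_monom sum.delta')
  have "degree p = k"
  proof (rule antisym)
    show "degree p \<le> k" by (rule degree_le) (simp add: cp)
    show "k \<le> degree p" by (rule le_degree) (simp add: cp)
  qed
  moreover have "(\<Sum>i\<le>k. scale (coeff p i) (?g i)) = 0"
  proof -
    have "(\<Sum>i\<le>k. scale (coeff p i) (?g i)) = (\<Sum>i<k. scale (coeff p i) (?g i)) + ?g k"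
      unfolding lessThan_Suc_atMost[symmetric] sum.lessThan_Suc by (simp add: cp)
    also have "(\<Sum>i<k. scale (coeff p i) (?g i)) = (\<Sum>i<k. - scale (c i) (?g i))"
      by (intro sum.cong) (auto simp: cp)
    also have "\<dots> = - ?g k" unfolding sum_negf c[symmetric] ..
    finally show ?thesis by simp
  qed
  moreover have "p \<noteq> 0" using cp[of k] by auto
  ultimately show ?thesis using gen_span_of_poly[OF sV assms(2) _ assms(3), of p] by simp
qed

lemma gen_disjoint:
  assumes "subspace V" "lin V V f" "v \<in> gen V f a" "v \<in> gen V f c" "a \<noteq> c"
  shows "v = 0"
proof -
  have 1: "v = 0" if "v \<in> gen V f a" "shift f c v = 0" for v
  proof -
    obtain n where n: "v \<in> V" "(shift f a ^^ n) v = 0" using \<open>v \<in> gen V f a\<close> by (auto simp: gen_def)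
    have "f v = scale c v" using that(2) by (simp add: shift_def)
    then have s: "shift f a v = scale (c - a) v" by (simp add: shift_def algebra_simps)
    have "(shift f a ^^ k) v = scale ((c - a) ^ k) v" for k
      using linD(3)[OF shift_lin[OF assms(1,2)] n(1)] s by (induction k) (simp_all add: mult.commute)
    then show ?thesis using n(2) assms(5) by auto
  qed
  obtain m where "(shift f c ^^ m) v = 0" using assms(4) by (auto simp: gen_def)
  then show ?thesis using assms(3)
  proof (induction m arbitrary: v)
    case (Suc m)
    then have "shift f c v = 0" using gen_shift[OF assms(1,2)] by (simp add: funpow_swap1)
    then show ?case using 1 Suc.prems(2) by blast
  qed simp
qed

text \<open>A power of \<open>shift f a\<close> kills the component of weight \<open>a\<close>; by
  induction it kills the other components too, which then belong to two different weights.\<close>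

lemma gen_independent:
  assumes "subspace V" "lin V V f" "finite C"
    and "\<And>c. c \<in> C \<Longrightarrow> u c \<in> gen V f c" "(\<Sum>c\<in>C. u c) = 0" "c \<in> C"
  shows "u c = 0"
  using assms(3-6)
proof (induction C arbitrary: u c rule: finite_induct)
  case (insert a C)
  note sp = shift_pow_lin[OF assms(1,2)]
  have uV: "u c \<in> V" if "c \<in> insert a C" for c using insert.prems(1)[OF that] gen_subset by auto
  obtain n where n: "(shift f a ^^ n) (u a) = 0" using insert.prems(1)[of a] by (auto simp: gen_def)
  have "0 = (shift f a ^^ n) (\<Sum>c\<in>insert a C. u c)" using insert.prems(2) lin_0[OF assms(1) sp] by simp
  also have "\<dots> = (\<Sum>c\<in>insert a C. (shift f a ^^ n) (u c))"
    by (rule lin_sum[OF assms(1) sp]) (use uV in auto)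
  finally have s: "(\<Sum>c\<in>C. (shift f a ^^ n) (u c)) = 0" using insert.hyps n by simp
  have g: "(shift f a ^^ k) (u c) \<in> gen V f c" if "c \<in> C" for c k
    by (induction k) (use that insert.prems(1) gen_shift[OF assms(1,2)] in auto)
  have z: "u c = 0" if c: "c \<in> C" for c
  proof -
    have "(shift f a ^^ n) (u c) = 0" by (rule insert.IH[OF g s c])
    then have "u c \<in> gen V f a" using c uV by (auto simp: gen_def)
    moreover have "u c \<in> gen V f c" "a \<noteq> c" using insert.prems(1) insert.hyps(2) c by auto
    ultimately show ?thesis using gen_disjoint[OF assms(1,2)] by blast
  qed
  then have "u a = 0" using insert.prems(2) insert.hyps by simp
  then show ?case using z insert.prems(3) by auto
qed simp

lemma gen_basis:
  assumes "fd V" "lin V V f"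
  obtains B wt where "basis_of B V" "\<And>b. b \<in> B \<Longrightarrow> b \<in> gen V f (wt b)"
proof -
  note sV = fd_subspace[OF assms(1)]
  let ?G = "\<Union>a. gen V f a"
  obtain B where B: "B \<subseteq> ?G" "independent B" "?G \<subseteq> span B"
    using maximal_independent_subset[of ?G] by blast
  have "B \<subseteq> V" using B(1) by (auto simp: gen_def)
  moreover have "V \<subseteq> span B" using gen_span[OF assms] span_minimal[OF B(3) subspace_span] by auto
  ultimately have "basis_of B V"
    using fd_independent_finite[OF assms(1) B(2)] B(2) span_minimal[of B V] sV by (auto simp: basis_of_def)
  moreover have "\<exists>wt. \<forall>b\<in>B. b \<in> gen V f (wt b)" using B(1) by (intro bchoice) auto
  ultimately show ?thesis using that by blast
qed

lemma gen_representation: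
  assumes "subspace V" "lin V V f" "basis_of B V" "\<And>b. b \<in> B \<Longrightarrow> b \<in> gen V f (wt b)"
    and v: "v \<in> gen V f a" and b: "b \<in> B" "wt b \<noteq> a"
  shows "representation B v b = 0"
proof -
  note B = basis_ofD[OF assms(3)]
  let ?r = "representation B v"
  let ?C = "insert a (wt ` B)"
  \<comment> \<open>The part of weight \<open>c\<close> in the expansion of \<open>v\<close>, with
    \<open>v\<close> itself subtracted in weight \<open>a\<close>. These vectors sum to zero, so
    independence of the weight spaces makes each of them vanish.\<close>
  define u where "u c = (\<Sum>b\<in>{b \<in> B. wt b = c}. scale (?r b) b) - (if c = a then v else 0)" for c
  have vV: "v \<in> span B" using v gen_subset B(3) by auto
  have "u c \<in> gen V f c" for c
    unfolding u_def using assms(4) v subspace_0[OF gen_subspace[OF assms(1,2)]]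
    by (intro subspace_diff subspace_sum subspace_scale gen_subspace[OF assms(1,2)]) auto
  moreover have "(\<Sum>c\<in>?C. u c) = 0"
  proof -
    have "(\<Sum>c\<in>?C. \<Sum>b\<in>{b \<in> B. wt b = c}. scale (?r b) b) = (\<Sum>b\<in>B. scale (?r b) b)"
      by (rule sum.group) (use B(1) in auto)
    also have "\<dots> = v" using sum_representation_eq[OF B(2) vV B(1)] by simp
    finally show ?thesis unfolding u_def sum_subtractf using B(1) by (simp add: sum.delta)
  qed
  ultimately have "u (wt b) = 0"
    by (intro gen_independent[OF assms(1,2), of ?C u]) (use B(1) b in auto)
  then have s: "(\<Sum>b'\<in>{b' \<in> B. wt b' = wt b}. scale (?r b') b') = 0" using b(2) by (simp add: u_def)
  show ?thesis
    by (rule independentD[OF B(2) _ _ s]) (use B(1) b(1) in auto)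
qed

section \<open>Functions of the semisimple part, and a trace criterion for nilpotency\<close>

definition eigen_op :: "'b set \<Rightarrow> ('b \<Rightarrow> 'b) \<Rightarrow> ('a \<Rightarrow> 'a) \<Rightarrow> ('b \<Rightarrow> 'b) \<Rightarrow> bool"
  where "eigen_op V f \<phi> D \<longleftrightarrow> lin V V D \<and> (\<forall>a. \<forall>v\<in>gen V f a. D v = scale (\<phi> a) v)"

lemma eigen_op_ex:
  assumes "fd V" "lin V V f"
  obtains D where "eigen_op V f \<phi> D"
proof -
  note sV = fd_subspace[OF assms(1)]
  obtain B wt where B: "basis_of B V" and wt: "\<And>b. b \<in> B \<Longrightarrow> b \<in> gen V f (wt b)"
    using gen_basis[OF assms] by blast
  note Bs = basis_ofD[OF B]
  define D where "D v = (\<Sum>b\<in>B. scale (representation B v b * \<phi> (wt b)) b)" for v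
  have "lin V V D"
  proof (rule linI)
    show "D x \<in> V" for x unfolding D_def using Bs(4) by (auto intro!: subspace_sum[OF sV] subspace_scale[OF sV])
    show "D (x + y) = D x + D y" if "x \<in> V" "y \<in> V" for x y
      unfolding D_def using that Bs(3)
      by (simp add: representation_add[OF Bs(2)] algebra_simps sum.distrib)
    show "D (scale c x) = scale c (D x)" if "x \<in> V" for c x
      unfolding D_def using that Bs(3) by (simp add: representation_scale[OF Bs(2)] scale_sum_right mult.assoc)
  qed
  moreover have "D v = scale (\<phi> a) v" if v: "v \<in> gen V f a" for a v
  proof -
    have "representation B v b * \<phi> (wt b) = representation B v b * \<phi> a" if "b \<in> B" for b
      using gen_representation[OF sV assms(2) B wt v that] by (cases "wt b = a") auto
    then have "D v = (\<Sum>b\<in>B. scale (\<phi> a) (scale (representation B v b) b))"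
      unfolding D_def by (intro sum.cong) (auto simp: mult.commute)
    also have "\<dots> = scale (\<phi> a) v"
      using sum_representation_eq[OF Bs(2) _ Bs(1) subset_refl, of v] v gen_subset[of V f a] Bs(3)
      unfolding scale_sum_right[symmetric] by auto
    finally show ?thesis .
  qed
  ultimately show ?thesis by (intro that[of D]) (simp add: eigen_op_def)
qed

text \<open>The sum of the exponents found at the basis vectors bounds each of them.\<close>

lemma nil_uniform:
  assumes "fd V" "lin V V f" "\<And>v. v \<in> V \<Longrightarrow> \<exists>n. (f ^^ n) v = 0"
  shows "\<exists>n. \<forall>v\<in>V. (f ^^ n) v = 0"
proof -
  note sV = fd_subspace[OF assms(1)]
  obtain B where "basis_of B V" using basis_of_ex[OF assms(1)] by blast
  note B = basis_ofD[OF this]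
  have "\<exists>n. \<forall>b\<in>B. (f ^^ n b) b = 0" using assms(3) B(4) by (intro bchoice) auto
  then obtain n where n: "\<And>b. b \<in> B \<Longrightarrow> (f ^^ n b) b = 0" by blast
  let ?N = "\<Sum>b\<in>B. n b"
  let ?K = "{v \<in> V. (f ^^ ?N) v = 0}"
  note L = lin_funpow[OF assms(2), of ?N]
  have "subspace ?K"
    by (rule subspaceI) (auto simp: subspace_0[OF sV] subspace_add[OF sV] subspace_scale[OF sV] linD(2,3)[OF L] lin_0[OF sV L])
  moreover have "B \<subseteq> ?K"
    using B(1,4) n funpow_zero_mono[of "n b" f b ?N for b] lin_0[OF sV assms(2)] member_le_sum[of _ B n] by auto
  ultimately have "V \<subseteq> ?K" using span_minimal[of B ?K] B(3) by simp
  then show ?thesis by blast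
qed

lemma tr_nil:
  assumes "fd V" "lin V V f" "\<And>v. v \<in> V \<Longrightarrow> \<exists>n. (f ^^ n) v = 0"
  shows "tr V f = 0"
  using nil_uniform[OF assms] tr_nilpotent[OF assms(1,2)] by blast

text \<open>The operator \<open>D\<close> plays the role of a function of the semisimple part of \<open>f\<close>, without
  constructing the Jordan decomposition.\<close>

lemma tr_eigen_op:
  assumes "fd V" "lin V V f" "basis_of B V" "\<And>b. b \<in> B \<Longrightarrow> b \<in> gen V f (wt b)"
    and D: "eigen_op V f \<phi> D"
  shows "tr V (\<lambda>v. D (f v)) = (\<Sum>b\<in>B. \<phi> (wt b) * wt b)"
proof -
  note sV = fd_subspace[OF assms(1)]
  note B = basis_ofD[OF assms(3)]
  \<comment> \<open>\<open>X\<close> is the semisimple part of \<open>f\<close>. In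
    \<open>D f = D (f - X) + D X\<close> the first summand is nilpotent, because on
    \<open>gen V f a\<close> it is \<open>\<phi> a\<close> times \<open>shift f a\<close>, and the
    second is diagonal in \<open>B\<close>.\<close>
  obtain X where X: "eigen_op V f (\<lambda>a. a) X" using eigen_op_ex[OF assms(1,2)] by blast
  have lD: "lin V V D" and lX: "lin V V X" using D X by (auto simp: eigen_op_def)
  have eD: "D v = scale (\<phi> a) v" and eX: "X v = scale a v" if "v \<in> gen V f a" for v a
    using D X that by (auto simp: eigen_op_def)
  let ?N = "\<lambda>v. D (f v - X v)"
  have lN: "lin V V ?N" by (rule lin_compose[OF lin_diff_fun[OF sV assms(2) lX] lD])
  have N: "?N v = scale (\<phi> a) (shift f a v)" if "v \<in> gen V f a" for v a
    using eX[OF that] eD[OF gen_shift[OF sV assms(2) that], of a] by (simp add: shift_def)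
  have Npow: "(?N ^^ n) v = scale (\<phi> a ^ n) ((shift f a ^^ n) v)" if v: "v \<in> gen V f a" for v a n
  proof (induction n)
    case (Suc n)
    have g: "(shift f a ^^ n) v \<in> gen V f a" by (induction n) (use v gen_shift[OF sV assms(2)] in auto)
    then have gV: "(shift f a ^^ n) v \<in> V" using gen_subset by auto
    show ?case using Suc.IH linD(3)[OF lN gV] N[OF g] by (simp add: mult.commute)
  qed simp
  have "gen V f a \<subseteq> gen V ?N 0" for a
  proof
    fix v assume v: "v \<in> gen V f a"
    then obtain n where "v \<in> V" "(shift f a ^^ n) v = 0" by (auto simp: gen_def)
    then show "v \<in> gen V ?N 0" using Npow[OF v, of n] unfolding gen_def shift_0 by auto
  qed
  then have "span (\<Union>a. gen V f a) \<subseteq> gen V ?N 0" by (intro span_minimal gen_subspace[OF sV lN]) auto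
  then have N0: "\<exists>n. (?N ^^ n) v = 0" if "v \<in> V" for v
    using gen_span[OF assms(1,2) that] unfolding gen_def shift_0 by blast
  have "tr V (\<lambda>v. D (f v)) = tr V (\<lambda>v. ?N v + D (X v))"
    using lin_diff[OF sV lD] linD(1)[OF lX] linD(1)[OF assms(2)] by (intro tr_cong[OF assms(1)]) auto
  also have "\<dots> = tr V ?N + tr V (\<lambda>v. D (X v))" by (rule tr_add[OF assms(1) lN lin_compose[OF lX lD]])
  also have "\<dots> = tr_basis B (\<lambda>v. D (X v))"
    using tr_nil[OF assms(1) lN N0] tr_eq_tr_basis[OF assms(3) lin_compose[OF lX lD]] by simp
  also have "\<dots> = (\<Sum>b\<in>B. \<phi> (wt b) * wt b)"
    unfolding tr_basis_def
  proof (rule sum.cong[OF refl])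
    fix b assume b: "b \<in> B"
    have "D (X b) = scale (\<phi> (wt b) * wt b) b"
      using b eX[OF assms(4)[OF b]] eD[OF assms(4)[OF b]] linD(3)[OF lD, of b] B(4) by (auto simp: mult.commute)
    then show "representation B (D (X b)) b = \<phi> (wt b) * wt b"
      using b by (simp add: representation_scale[OF B(2)] span_base representation_basis[OF B(2)])
  qed
  finally show ?thesis .
qed

text \<open>The coordinate at \<open>a\<close> in a basis of the field over the rationals that
  contains \<open>a\<close>. Its values lie in an ordered field, which makes the positivity of sums
  of squares available over any ground field of characteristic 0.\<close>

lemma additive_rat_functional:
  assumes "a \<noteq> (0::'a)"
  obtains q :: "'a \<Rightarrow> rat" where "\<And>x y. q (x + y) = q x + q y" "\<And>r x. q (of_rat r * x) = r * q x" "q a = 1"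
proof -
  interpret Q: vector_space "\<lambda>(r::rat) (x::'a). of_rat r * x"
    by standard (simp_all add: of_rat_add of_rat_mult algebra_simps)
  have i: "Q.independent {a}" using assms by simp
  let ?B = "Q.extend_basis {a}"
  note B = Q.independent_extend_basis[OF i] and sp = Q.span_extend_basis[OF i]
  have a: "a \<in> ?B" using Q.extend_basis_superset[OF i] by auto
  show ?thesis
  proof (rule that[of "\<lambda>x. Q.representation ?B x a"])
    show "Q.representation ?B (x + y) a = Q.representation ?B x a + Q.representation ?B y a" for x y
      by (subst Q.representation_add[OF B]) (auto simp: sp)
    show "Q.representation ?B (of_rat r * x) a = r * Q.representation ?B x a" for r x
      by (subst Q.representation_scale[OF B]) (auto simp: sp)
    show "Q.representation ?B a a = 1" by (simp add: Q.representation_basis[OF B a])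
  qed
qed

lemma nilpotent_if_traces_vanish:
  assumes "fd V" "lin V V f"
    and tr0: "\<And>\<phi> D. (\<And>x y. \<phi> (x + y) = \<phi> x + \<phi> y) \<Longrightarrow> eigen_op V f \<phi> D \<Longrightarrow> tr V (\<lambda>v. D (f v)) = 0"
    and "v \<in> V"
  shows "\<exists>n. (f ^^ n) v = 0"
proof -
  note sV = fd_subspace[OF assms(1)]
  obtain B wt where B: "basis_of B V" and wt: "\<And>b. b \<in> B \<Longrightarrow> b \<in> gen V f (wt b)"
    using gen_basis[OF assms(1,2)] by blast
  note Bs = basis_ofD[OF B]
  have "wt b = 0" if b: "b \<in> B" for b
  proof (rule ccontr)
    assume "wt b \<noteq> 0"
    then obtain q :: "'a \<Rightarrow> rat" where q: "\<And>x y. q (x + y) = q x + q y" "\<And>r x. q (of_rat r * x) = r * q x"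
      "q (wt b) = 1" using additive_rat_functional by blast
    let ?\<phi> = "\<lambda>x. of_rat (q x) :: 'a"
    obtain D where D: "eigen_op V f ?\<phi> D" using eigen_op_ex[OF assms(1,2)] by blast
    have "(\<Sum>b\<in>B. ?\<phi> (wt b) * wt b) = 0"
      using tr0[OF _ D] tr_eigen_op[OF assms(1,2) B wt D] q(1) by (simp add: of_rat_add)
    \<comment> \<open>Since \<open>q\<close> is additive and rational-linear, applying it to the
      vanishing trace turns each summand into the square of the rational number
      \<open>q (wt b)\<close>.\<close>
    then have "q (\<Sum>b\<in>B. ?\<phi> (wt b) * wt b) = 0" using q(1)[of 0 0] by simp
    moreover have "q (\<Sum>b\<in>A. ?\<phi> (wt b) * wt b) = (\<Sum>b\<in>A. q (wt b) * q (wt b))" if "finite A" for A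
      using that by (induction A) (use q(1)[of 0 0] in \<open>auto simp: q\<close>)
    ultimately have "(\<Sum>b\<in>B. q (wt b) * q (wt b)) = 0" using Bs(1) by simp
    then have "q (wt b) * q (wt b) = 0" using Bs(1) b by (subst (asm) sum_nonneg_eq_0_iff) auto
    then show False using q(3) by simp
  qed
  then have "span B \<subseteq> gen V f 0" using wt by (intro span_minimal gen_subspace[OF sV assms(2)]) force
  then show ?thesis using assms(4) Bs(3) by (auto simp: gen_def shift_0)
qed

end

section \<open>Lie algebras and their modules\<close>

locale lie_algebra = ac_space scale
  for scale :: "'a::{alg_closed_field,field_char_0} \<Rightarrow> 'b::ab_group_add \<Rightarrow> 'b" +
  fixes L :: "'b set" and br :: "'b \<Rightarrow> 'b \<Rightarrow> 'b"
  assumes fdL: "fd L"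
    and br_lin: "x \<in> L \<Longrightarrow> lin L L (br x)"
    and br_skew: "x \<in> L \<Longrightarrow> y \<in> L \<Longrightarrow> br x y = - br y x"
    and br_jacobi: "x \<in> L \<Longrightarrow> y \<in> L \<Longrightarrow> z \<in> L \<Longrightarrow> br x (br y z) = br (br x y) z + br y (br x z)"
begin

lemma sL: "subspace L"
  by (rule fd_subspace[OF fdL])

lemma br_closed: "x \<in> L \<Longrightarrow> y \<in> L \<Longrightarrow> br x y \<in> L"
  using linD(1)[OF br_lin] .

lemma br_add_right: "x \<in> L \<Longrightarrow> y \<in> L \<Longrightarrow> z \<in> L \<Longrightarrow> br x (y + z) = br x y + br x z"
  using linD(2)[OF br_lin] .

lemma br_scale_right: "x \<in> L \<Longrightarrow> y \<in> L \<Longrightarrow> br x (scale c y) = scale c (br x y)"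
  using linD(3)[OF br_lin] .

lemma br_add_left: "x \<in> L \<Longrightarrow> y \<in> L \<Longrightarrow> z \<in> L \<Longrightarrow> br (x + y) z = br x z + br y z"
  using br_skew[of "x + y" z] br_skew[of x z] br_skew[of y z] subspace_add[OF sL] br_add_right by simp

lemma br_scale_left: "x \<in> L \<Longrightarrow> y \<in> L \<Longrightarrow> br (scale c x) y = scale c (br x y)"
  using br_skew[of "scale c x" y] br_skew[of x y] subspace_scale[OF sL] br_scale_right by simp

lemma br_zero_right: "x \<in> L \<Longrightarrow> br x 0 = 0"
  using lin_0[OF sL br_lin] .

lemma br_zero_left: "x \<in> L \<Longrightarrow> br 0 x = 0"
  using br_skew[of 0 x] br_zero_right subspace_0[OF sL] by simp

lemma br_diff_right: "x \<in> L \<Longrightarrow> y \<in> L \<Longrightarrow> z \<in> L \<Longrightarrow> br x (y - z) = br x y - br x z"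
  using lin_diff[OF sL br_lin] .

lemma br_diff_left: "x \<in> L \<Longrightarrow> y \<in> L \<Longrightarrow> z \<in> L \<Longrightarrow> br (x - y) z = br x z - br y z"
  using br_skew[of "x - y" z] br_skew[of x z] br_skew[of y z] subspace_diff[OF sL] br_diff_right by simp

definition perfect :: bool
  where "perfect \<longleftrightarrow> span {br x y | x y. x \<in> L \<and> y \<in> L} = L"

lemma eq_neg_self: "x = - x \<Longrightarrow> x = (0::'b)"
proof -
  assume "x = - x"
  then have "scale (1 + 1) x = 0" unfolding scale_left_distrib by (simp add: eq_neg_iff_add_eq_0)
  then show ?thesis by simp
qed

lemma br_self: "x \<in> L \<Longrightarrow> br x x = 0"
  by (rule eq_neg_self) (rule br_skew)

lemma perfect_induct:
  assumes perfect "subspace P" "\<And>x y. x \<in> L \<Longrightarrow> y \<in> L \<Longrightarrow> br x y \<in> P"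
  shows "L \<subseteq> P"
  using span_minimal[of "{br x y | x y. x \<in> L \<and> y \<in> L}" P] assms unfolding perfect_def by auto

lemma subalgebra:
  assumes "subspace U" "U \<subseteq> L" "\<And>x y. x \<in> U \<Longrightarrow> y \<in> U \<Longrightarrow> br x y \<in> U"
  shows "lie_algebra scale U br"
proof
  show "fd U" by (rule fd_subset[OF fdL assms(1,2)])
  show "lin U U (br x)" if "x \<in> U" for x
    using lin_subset[OF br_lin assms(2)] that assms(2,3) by auto
  show "br x y = - br y x" if "x \<in> U" "y \<in> U" for x y using that assms(2) br_skew by auto
  show "br x (br y z) = br (br x y) z + br y (br x z)" if "x \<in> U" "y \<in> U" "z \<in> U" for x y z
    using that br_jacobi[of x y z] assms(2) by blast
qed

end

text \<open>The module has its own ambient type, since spaces of linear maps, whose elements are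
  functions, occur as modules later.\<close>

locale lie_module = A: lie_algebra s L br + M: ac_space t
  for s :: "'a::{alg_closed_field,field_char_0} \<Rightarrow> 'b::ab_group_add \<Rightarrow> 'b" and L br
  and t :: "'a \<Rightarrow> 'w::ab_group_add \<Rightarrow> 'w" +
  fixes W :: "'w set" and r :: "'b \<Rightarrow> 'w \<Rightarrow> 'w"
  assumes fdW: "M.fd W"
    and r_lin: "x \<in> L \<Longrightarrow> M.lin W W (r x)"
    and r_add: "x \<in> L \<Longrightarrow> y \<in> L \<Longrightarrow> w \<in> W \<Longrightarrow> r (x + y) w = r x w + r y w"
    and r_scale: "x \<in> L \<Longrightarrow> w \<in> W \<Longrightarrow> r (s c x) w = t c (r x w)"
    and r_br: "x \<in> L \<Longrightarrow> y \<in> L \<Longrightarrow> w \<in> W \<Longrightarrow> r (br x y) w = r x (r y w) - r y (r x w)"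
begin

lemma sW: "M.subspace W"
  by (rule M.fd_subspace[OF fdW])

lemma r_closed: "x \<in> L \<Longrightarrow> w \<in> W \<Longrightarrow> r x w \<in> W"
  using M.linD(1)[OF r_lin] .

lemma r_add_right: "x \<in> L \<Longrightarrow> v \<in> W \<Longrightarrow> w \<in> W \<Longrightarrow> r x (v + w) = r x v + r x w"
  using M.linD(2)[OF r_lin] .

lemma r_scale_right: "x \<in> L \<Longrightarrow> w \<in> W \<Longrightarrow> r x (t c w) = t c (r x w)"
  using M.linD(3)[OF r_lin] .

lemma r_diff_right: "x \<in> L \<Longrightarrow> v \<in> W \<Longrightarrow> w \<in> W \<Longrightarrow> r x (v - w) = r x v - r x w"
  using M.lin_diff[OF sW r_lin] .

lemma r_zero_right: "x \<in> L \<Longrightarrow> r x 0 = 0"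
  using M.lin_0[OF sW r_lin] .

lemma r_zero: "w \<in> W \<Longrightarrow> r 0 w = 0"
  using r_scale[of 0 w 0] A.subspace_0[OF A.sL] by simp

lemma r_neg: "x \<in> L \<Longrightarrow> w \<in> W \<Longrightarrow> r (- x) w = - r x w"
  using r_scale[of x w "-1"] by simp

lemma r_diff: "x \<in> L \<Longrightarrow> y \<in> L \<Longrightarrow> w \<in> W \<Longrightarrow> r (x - y) w = r x w - r y w"
  using r_add[of x "-y" w] r_neg[of y w] A.subspace_neg[OF A.sL] by simp

lemma r_sum: "(\<And>i. i \<in> I \<Longrightarrow> g i \<in> L) \<Longrightarrow> w \<in> W \<Longrightarrow> r (sum g I) w = (\<Sum>i\<in>I. r (g i) w)"
proof (induction I rule: infinite_finite_induct)
  case (insert a I)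
  then show ?case using r_add[of "g a" "sum g I" w] A.subspace_sum[OF A.sL, of I g] by simp
qed (simp_all add: r_zero)

lemma submodule:
  assumes "M.subspace U" "U \<subseteq> W" "\<And>x w. x \<in> L \<Longrightarrow> w \<in> U \<Longrightarrow> r x w \<in> U"
  shows "lie_module s L br t U r"
proof
  show "M.fd U" by (rule M.fd_subset[OF fdW assms(1,2)])
  show "M.lin U U (r x)" if "x \<in> L" for x using M.lin_subset[OF r_lin assms(2)] that assms(2,3) by auto
qed (use r_add r_scale r_br subsetD[OF assms(2)] in auto)

lemma restrict_algebra:
  assumes "A.subspace U" "U \<subseteq> L" "\<And>x y. x \<in> U \<Longrightarrow> y \<in> U \<Longrightarrow> br x y \<in> U"
  shows "lie_module s U br t W r"
proof -
  interpret U: lie_algebra s U br by (rule A.subalgebra[OF assms])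
  show ?thesis by unfold_locales (use fdW r_lin r_add r_scale r_br subsetD[OF assms(2)] in auto)
qed

subsection \<open>Engel's theorem\<close>

text \<open>A quotient-free form of Engel's conclusion: every nonzero quotient of \<open>W\<close>
  by a stable subspace contains a nonzero vector killed by \<open>U\<close>.\<close>

definition triangular :: "'b set \<Rightarrow> bool"
  where "triangular U \<longleftrightarrow> (\<forall>Y. M.subspace Y \<and> Y \<subseteq> W \<and> Y \<noteq> W \<and> (\<forall>u\<in>U. \<forall>y\<in>Y. r u y \<in> Y)
    \<longrightarrow> (\<exists>w\<in>W. w \<notin> Y \<and> (\<forall>u\<in>U. r u w \<in> Y)))"

fun filt :: "'b set \<Rightarrow> nat \<Rightarrow> 'w set"
  where "filt U 0 = {0}" | "filt U (Suc i) = {w \<in> W. \<forall>u\<in>U. r u w \<in> filt U i}"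

lemma transporter_subspace:
  assumes "U \<subseteq> L" "M.subspace Y"
  shows "M.subspace {w \<in> W. \<forall>u\<in>U. r u w \<in> Y}"
  using assms r_zero_right r_add_right r_scale_right
  by (intro M.subspaceI)
    (auto simp: subset_iff M.subspace_0 M.subspace_add M.subspace_scale M.subspace_0[OF sW] M.subspace_add[OF sW] M.subspace_scale[OF sW])

lemma filt_subspace: "U \<subseteq> L \<Longrightarrow> M.subspace (filt U i)"
  by (induction i) (auto intro: transporter_subspace)

lemma filt_subset: "filt U i \<subseteq> W"
  using M.subspace_0[OF sW] by (cases i) auto

lemma filt_Suc: "U \<subseteq> L \<Longrightarrow> filt U i \<subseteq> filt U (Suc i)"
proof (induction i)
  case 0
  then show ?case using M.subspace_0[OF sW] r_zero_right by auto
next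
  case (Suc i)
  show ?case
  proof
    fix w assume "w \<in> filt U (Suc i)"
    then have "w \<in> W" "\<forall>u\<in>U. r u w \<in> filt U i" by auto
    then show "w \<in> filt U (Suc (Suc i))" using Suc.IH[OF Suc.prems] by (auto simp del: filt.simps(2) simp: filt.simps(2)[of U "Suc i"])
  qed
qed

lemma filt_step: "w \<in> filt U (Suc i) \<Longrightarrow> u \<in> U \<Longrightarrow> r u w \<in> filt U i"
  by simp

text \<open>As long as \<open>W\<close> is not reached, triangularity provides a new vector, so the
  dimension grows at each step.\<close>

lemma filt_exhausts:
  assumes "U \<subseteq> L" "triangular U"
  obtains n where "filt U n = W"
proof -
  have "filt U n = W \<or> n \<le> M.dim (filt U n)" for n
  proof (induction n)
    case (Suc n)
    show ?case
    proof (cases "filt U n = W")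
      case True
      then show ?thesis using filt_Suc[OF assms(1), of n] filt_subset[of U "Suc n"] by blast
    next
      case False
      have "r u w \<in> filt U n" if "u \<in> U" "w \<in> filt U n" for u w
        using filt_step[of w U n u] filt_Suc[OF assms(1), of n] that by blast
      then obtain w where "w \<in> W" "w \<notin> filt U n" "\<forall>u\<in>U. r u w \<in> filt U n"
        using assms(2) False filt_subspace[OF assms(1), of n] filt_subset[of U n] unfolding triangular_def by blast
      then have "w \<in> filt U (Suc n)" "w \<notin> filt U n" by auto
      then have "filt U n \<noteq> filt U (Suc n)" by blast
      then have "M.dim (filt U n) < M.dim (filt U (Suc n))"
        by (rule M.dim_less[OF M.fd_subset[OF fdW filt_subspace[OF assms(1)] filt_subset] filt_subspace[OF assms(1)] filt_Suc[OF assms(1)]])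
      then show ?thesis using Suc False by simp
    qed
  qed simp
  moreover have "M.dim (filt U n) \<le> M.dim W" for n
    by (rule M.dim_le[OF fdW filt_subspace[OF assms(1)] filt_subset])
  ultimately have "filt U (Suc (M.dim W)) = W" by (metis not_less_eq_eq)
  then show ?thesis using that by blast
qed

definition ker :: "'b set"
  where "ker = {x \<in> L. \<forall>w\<in>W. r x w = 0}"

lemma ker_subspace: "A.subspace ker"
  unfolding ker_def
  by (intro A.subspaceI)
    (auto simp: A.subspace_0[OF A.sL] A.subspace_add[OF A.sL] A.subspace_scale[OF A.sL] r_zero r_add r_scale)

text \<open>If \<open>U\<close> normalized nothing outside itself, an \<open>e\<close> outside
  \<open>U\<close> could be bracketed with elements of \<open>U\<close> again and again without
  falling into \<open>U\<close>. Each bracket lowers the filtration one degree further, so in the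
  end such an element acts as zero and lies in \<open>ker\<close>, hence in
  \<open>U\<close>.\<close>

lemma normalizer_step:
  assumes U: "U \<subseteq> L" "triangular U" "ker \<subseteq> U" "U \<noteq> L"
  shows "\<exists>e\<in>L. e \<notin> U \<and> (\<forall>u\<in>U. br u e \<in> U)"
proof (rule ccontr)
  assume none: "\<not> ?thesis"
  obtain n where n: "filt U n = W" using filt_exhausts[OF U(1,2)] .
  have mono: "filt U i \<subseteq> filt U (i + k)" for i k
    by (induction k) (use filt_Suc[OF U(1)] in \<open>auto simp del: filt.simps(2)\<close>)
  have big: "filt U i = W" if "n \<le> i" for i
    using mono[of n "i - n"] filt_subset[of U i] n that by auto
  \<comment> \<open>The number \<open>m\<close> measures how far \<open>e\<close> lowers the
    filtration: degree \<open>j\<close> is sent to degree \<open>j + n - m\<close>. For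
    \<open>m = 0\<close> this is trivial, as all degrees from \<open>n\<close> on equal
    \<open>W\<close>; for \<open>m = n + n\<close> it sends \<open>W\<close>, which is degree
    \<open>n\<close>, to zero.\<close>
  have "\<exists>e\<in>L. e \<notin> U \<and> (\<forall>i j. j + n \<le> i + m \<longrightarrow> (\<forall>w\<in>filt U j. r e w \<in> filt U i))" for m
  proof (induction m)
    case 0
    obtain e where "e \<in> L" "e \<notin> U" using U(1,4) by blast
    then show ?case using big filt_subset[of U] r_closed by (metis add_0_right add_leD2 subsetD)
  next
    case (Suc m)
    then obtain e where e: "e \<in> L" "e \<notin> U" "\<And>i j w. j + n \<le> i + m \<Longrightarrow> w \<in> filt U j \<Longrightarrow> r e w \<in> filt U i"
      by blast
    obtain u where u: "u \<in> U" "br u e \<notin> U" using none e by blast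
    have uL: "u \<in> L" using u U(1) by auto
    have "r (br u e) w \<in> filt U i" if ij: "j + n \<le> i + Suc m" and w: "w \<in> filt U j" for i j w
    proof -
      have wW: "w \<in> W" using w filt_subset by auto
      have 1: "r u (r e w) \<in> filt U i" using e(3)[of j "Suc i" w] ij w u(1) filt_step[of "r e w" U i u] by simp
      have 2: "r e (r u w) \<in> filt U i"
      proof (cases j)
        case 0
        then have "w = 0" using w by simp
        then show ?thesis using e(1) uL M.subspace_0[OF filt_subspace[OF U(1)]] by (simp add: r_zero_right)
      next
        case (Suc k)
        then have "r u w \<in> filt U k" using w u(1) filt_step by blast
        then show ?thesis using e(3)[of k i] ij Suc by simp
      qed
      show ?thesis using M.subspace_diff[OF filt_subspace[OF U(1)] 1 2] r_br[OF uL e(1) wW] by simp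
    qed
    then show ?case using u(2) A.br_closed[OF uL e(1)] by blast
  qed
  from this[of "n + n"] obtain e where e: "e \<in> L" "e \<notin> U"
    "\<And>i j w. j + n \<le> i + (n + n) \<Longrightarrow> w \<in> filt U j \<Longrightarrow> r e w \<in> filt U i" by blast
  have "r e w = 0" if "w \<in> W" for w using e(3)[of n 0 w] that n by simp
  then have "e \<in> ker" using e(1) by (simp add: ker_def)
  then show False using e(2) U(3) by auto
qed

lemma span_insertE:
  assumes "A.subspace U" "x \<in> A.span (insert e U)"
  obtains u k where "u \<in> U" "x = u + s k e"
proof -
  obtain k where "x - s k e \<in> U" using assms A.span_eq_iff[THEN iffD2, OF assms(1)] unfolding A.span_breakdown_eq by auto
  then show ?thesis using that[of "x - s k e" k] by simp
qed

lemma subalgebra_extend: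
  assumes "A.subspace U" "U \<subseteq> L" "\<And>x y. x \<in> U \<Longrightarrow> y \<in> U \<Longrightarrow> br x y \<in> U"
    and e: "e \<in> L" "\<And>u. u \<in> U \<Longrightarrow> br u e \<in> U"
    and xy: "x \<in> A.span (insert e U)" "y \<in> A.span (insert e U)"
  shows "br x y \<in> U"
proof -
  obtain u k where u: "u \<in> U" "x = u + s k e" using span_insertE[OF assms(1) xy(1)] .
  obtain v l where v: "v \<in> U" "y = v + s l e" using span_insertE[OF assms(1) xy(2)] .
  note sub = A.subspace_scale[OF A.sL] A.subspace_add[OF A.sL]
  have uv: "u \<in> L" "v \<in> L" using u v assms(2) by auto
  have "br x y = br u v + s l (br u e) - s k (br v e)"
    unfolding u(2) v(2) using uv e(1) A.br_skew[OF e(1) uv(2)]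
    by (simp add: sub A.br_add_left A.br_add_right A.br_scale_left A.br_scale_right A.br_self)
  also have "\<dots> \<in> U"
    using assms(3)[OF u(1) v(1)] e(2)[OF u(1)] e(2)[OF v(1)]
    by (simp add: A.subspace_diff[OF assms(1)] A.subspace_add[OF assms(1)] A.subspace_scale[OF assms(1)])
  finally show ?thesis .
qed

text \<open>The vectors that \<open>U\<close> sends into \<open>Y\<close> form an
  \<open>e\<close>-stable space because \<open>e\<close> normalizes \<open>U\<close>; local
  nilpotency of \<open>r e\<close> then yields one outside \<open>Y\<close> that \<open>e\<close>
  sends into \<open>Y\<close> as well.\<close>

lemma triangular_extend:
  assumes "A.subspace U" "U \<subseteq> L" "triangular U"
    and e: "e \<in> L" "\<And>u. u \<in> U \<Longrightarrow> br u e \<in> U" "\<And>w. w \<in> W \<Longrightarrow> \<exists>n. (r e ^^ n) w = 0"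
  shows "triangular (A.span (insert e U))" (is "triangular ?V")
  unfolding triangular_def
proof (intro allI impI, elim conjE)
  fix Y assume Y: "M.subspace Y" "Y \<subseteq> W" "Y \<noteq> W" "\<forall>u\<in>?V. \<forall>y\<in>Y. r u y \<in> Y"
  have UV: "u \<in> ?V" if "u \<in> U" for u using that A.span_base by blast
  have eV: "e \<in> ?V" using A.span_base by blast
  let ?X = "{w \<in> W. \<forall>u\<in>U. r u w \<in> Y}"
  have "\<forall>u\<in>U. \<forall>y\<in>Y. r u y \<in> Y" using Y(4) UV by blast
  then obtain w0 where w0: "w0 \<in> ?X" "w0 \<notin> Y" using assms(3) Y(1-3) unfolding triangular_def by blast
  have eX: "r e w \<in> ?X" if w: "w \<in> ?X" for w
  proof -
    have "r u (r e w) \<in> Y" if u: "u \<in> U" for u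
    proof -
      have uL: "u \<in> L" using u assms(2) by blast
      have "r u (r e w) = r (br u e) w + r e (r u w)" using r_br[OF uL e(1)] w by simp
      also have "\<dots> \<in> Y"
      proof (rule M.subspace_add[OF Y(1)])
        show "r (br u e) w \<in> Y" using w e(2)[OF u] by blast
        show "r e (r u w) \<in> Y" using w u Y(4) eV by blast
      qed
      finally show ?thesis .
    qed
    then show ?thesis using w r_closed[OF e(1)] by simp
  qed
  have "\<exists>w\<in>?X. w \<notin> Y \<and> r e w \<in> Y"
  proof (rule ccontr)
    assume c: "\<not> ?thesis"
    have "(r e ^^ m) w0 \<in> ?X \<and> (r e ^^ m) w0 \<notin> Y" for m
    proof (induction m)
      case (Suc m)
      then have "r e ((r e ^^ m) w0) \<in> ?X" "r e ((r e ^^ m) w0) \<notin> Y" using eX c by blast+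
      then show ?case by simp
    qed (use w0 in simp)
    moreover obtain m where "(r e ^^ m) w0 = 0" using e(3) w0(1) by blast
    ultimately show False using M.subspace_0[OF Y(1)] by metis
  qed
  then obtain w where w: "w \<in> ?X" "w \<notin> Y" "r e w \<in> Y" by blast
  have "r x w \<in> Y" if x: "x \<in> ?V" for x
  proof -
    obtain u k where u: "u \<in> U" "x = u + s k e" using span_insertE[OF assms(1) x] .
    have uL: "u \<in> L" "w \<in> W" "r u w \<in> Y" using u(1) assms(2) w(1) by auto
    have "r x w = r u w + t k (r e w)"
      unfolding u(2) using uL e(1) by (simp add: r_add r_scale A.subspace_scale[OF A.sL])
    then show ?thesis using M.subspace_add[OF Y(1) uL(3) M.subspace_scale[OF Y(1) w(3)]] by simp
  qed
  then show "\<exists>w\<in>W. w \<notin> Y \<and> (\<forall>u\<in>?V. r u w \<in> Y)" using w(1,2) by blast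
qed

text \<open>Among the subalgebras that contain \<open>ker\<close> and act triangularly, starting
  with \<open>ker\<close> itself, one of largest dimension must be \<open>L\<close>: otherwise
  \<open>normalizer_step\<close> and \<open>triangular_extend\<close> would enlarge it.\<close>

theorem engel:
  assumes nil: "\<And>x w. x \<in> L \<Longrightarrow> w \<in> W \<Longrightarrow> \<exists>n. (r x ^^ n) w = 0"
  shows "triangular L"
proof -
  define good where "good U \<longleftrightarrow> A.subspace U \<and> U \<subseteq> L \<and> ker \<subseteq> U \<and> (\<forall>x\<in>U. \<forall>y\<in>U. br x y \<in> U) \<and> triangular U" for U
  have kk: "br x y \<in> ker" if "x \<in> ker" "y \<in> ker" for x y
    using that r_br[of x y] A.br_closed[of x y] r_zero_right by (auto simp: ker_def)
  have tk: "triangular ker"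
    unfolding triangular_def
  proof (intro allI impI, elim conjE)
    fix Y assume Y: "M.subspace Y" "Y \<subseteq> W" "Y \<noteq> W"
    then obtain w where "w \<in> W" "w \<notin> Y" by blast
    then show "\<exists>w\<in>W. w \<notin> Y \<and> (\<forall>u\<in>ker. r u w \<in> Y)"
      using M.subspace_0[OF Y(1)] by (auto simp: ker_def)
  qed
  have "good ker" using ker_subspace kk tk by (auto simp: good_def ker_def)
  moreover have "\<forall>U. good U \<longrightarrow> A.dim U \<le> A.dim L" using A.dim_le[OF A.fdL] by (auto simp: good_def)
  ultimately have "\<exists>U. good U \<and> (\<forall>U'. good U' \<longrightarrow> A.dim U' \<le> A.dim U)" by (intro ex_has_greatest_nat[of good ker A.dim "Suc (A.dim L)"]) (auto simp: less_Suc_eq_le)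
  then obtain U where U: "good U" and max: "\<And>U'. good U' \<Longrightarrow> A.dim U' \<le> A.dim U" by blast
  from U have sU: "A.subspace U" and UL: "U \<subseteq> L" and kU: "ker \<subseteq> U" and bU: "\<And>x y. x \<in> U \<Longrightarrow> y \<in> U \<Longrightarrow> br x y \<in> U"
    and tU: "triangular U" by (auto simp: good_def)
  have "U = L"
  proof (rule ccontr)
    assume "U \<noteq> L"
    then obtain e where e: "e \<in> L" "e \<notin> U" "\<And>u. u \<in> U \<Longrightarrow> br u e \<in> U"
      using normalizer_step[OF UL tU kU] by blast
    let ?V = "A.span (insert e U)"
    have UV: "U \<subseteq> ?V" "e \<in> ?V" using A.span_superset[of "insert e U"] by auto
    have VL: "?V \<subseteq> L" by (rule A.span_minimal[OF _ A.sL]) (use e UL in auto)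
    have "good ?V"
      using VL UV kU triangular_extend[OF sU UL tU e(1,3) nil[OF e(1)]] subalgebra_extend[OF sU UL bU e(1,3)]
      by (simp add: good_def subset_iff)
    then have "A.dim ?V \<le> A.dim U" by (rule max)
    moreover have "A.dim U < A.dim ?V"
      by (rule A.dim_less[OF A.fd_subset[OF A.fdL A.subspace_span VL] sU UV(1)]) (use UV(2) e(2) in blast)
    ultimately show False by simp
  qed
  then show ?thesis using tU by simp
qed

text \<open>Engel's theorem modulo the invariants \<open>?Y\<close> yields a vector \<open>v\<close>
  outside them that \<open>L\<close> sends into them. Brackets then kill \<open>v\<close>, and by
  perfectness all of \<open>L\<close> does, which puts \<open>v\<close> among the
  invariants.\<close>

lemma perfect_nilpotent_trivial:
  assumes "A.perfect" "\<And>x w. x \<in> L \<Longrightarrow> w \<in> W \<Longrightarrow> \<exists>n. (r x ^^ n) w = 0" "x \<in> L" "w \<in> W"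
  shows "r x w = 0"
proof (rule ccontr)
  assume nz: "r x w \<noteq> 0"
  let ?Y = "{w \<in> W. \<forall>u\<in>L. r u w \<in> {0}}"
  have "M.subspace ?Y" by (rule transporter_subspace) auto
  moreover have "?Y \<noteq> W" using nz assms(3,4) by auto
  moreover have "\<forall>u\<in>L. \<forall>y\<in>?Y. r u y \<in> ?Y" using r_zero_right M.subspace_0[OF sW] by auto
  ultimately obtain v where v: "v \<in> W" "v \<notin> ?Y" "\<And>u. u \<in> L \<Longrightarrow> r u v \<in> ?Y"
    using engel[OF assms(2)] unfolding triangular_def by blast
  have "L \<subseteq> {x \<in> L. r x v = 0}"
  proof (rule A.perfect_induct[OF assms(1)])
    show "A.subspace {x \<in> L. r x v = 0}"
      using v(1) by (intro A.subspaceI)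
        (auto simp: A.subspace_0[OF A.sL] A.subspace_add[OF A.sL] A.subspace_scale[OF A.sL] r_zero r_add r_scale)
    show "br x y \<in> {x \<in> L. r x v = 0}" if "x \<in> L" "y \<in> L" for x y
      using that v(1) v(3)[of x] v(3)[of y] A.br_closed by (simp add: r_br)
  qed
  then show False using v(1,2) by auto
qed

subsection \<open>Trace forms\<close>

definition tf :: "'b \<Rightarrow> 'b \<Rightarrow> 'a"
  where "tf x y = M.tr W (\<lambda>w. r x (r y w))"

lemma r_comp_lin: "x \<in> L \<Longrightarrow> y \<in> L \<Longrightarrow> M.lin W W (\<lambda>w. r x (r y w))"
  by (rule M.lin_compose[OF r_lin r_lin])

lemma tf_commute: "x \<in> L \<Longrightarrow> y \<in> L \<Longrightarrow> tf x y = tf y x"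
  unfolding tf_def by (rule M.tr_commute[OF fdW fdW r_lin r_lin])

lemma tf_add_left: "x \<in> L \<Longrightarrow> y \<in> L \<Longrightarrow> z \<in> L \<Longrightarrow> tf (x + y) z = tf x z + tf y z"
  unfolding tf_def M.tr_add[OF fdW r_comp_lin r_comp_lin, symmetric]
  by (rule M.tr_cong[OF fdW]) (simp add: r_add r_closed)

lemma tf_scale_left: "x \<in> L \<Longrightarrow> z \<in> L \<Longrightarrow> tf (s c x) z = c * tf x z"
  unfolding tf_def M.tr_scale[OF fdW r_comp_lin, symmetric]
  by (rule M.tr_cong[OF fdW]) (simp add: r_scale r_closed)

lemma tf_add_right: "x \<in> L \<Longrightarrow> y \<in> L \<Longrightarrow> z \<in> L \<Longrightarrow> tf z (x + y) = tf z x + tf z y"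
  using tf_add_left[of x y z] by (simp add: tf_commute A.subspace_add[OF A.sL])

lemma tf_scale_right: "x \<in> L \<Longrightarrow> z \<in> L \<Longrightarrow> tf z (s c x) = c * tf z x"
  using tf_scale_left[of x z] by (simp add: tf_commute A.subspace_scale[OF A.sL])

lemma tf_zero_left: "x \<in> L \<Longrightarrow> tf 0 x = 0"
  using tf_scale_left[of 0 x 0] A.subspace_0[OF A.sL] by simp

lemma tf_zero_right: "x \<in> L \<Longrightarrow> tf x 0 = 0"
  using tf_scale_right[of 0 x 0] A.subspace_0[OF A.sL] by simp

lemma tf_invariant:
  assumes "x \<in> L" "y \<in> L" "z \<in> L"
  shows "tf (br x y) z = tf x (br y z)"
proof -
  have l: "M.lin W W (\<lambda>w. r x (r y (r z w)))" if "x \<in> L" "y \<in> L" "z \<in> L" for x y z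
    by (rule M.lin_compose[OF r_comp_lin[OF that(2,3)] r_lin[OF that(1)]])
  have "tf (br x y) z = M.tr W (\<lambda>w. r x (r y (r z w)) - r y (r x (r z w)))"
    unfolding tf_def by (rule M.tr_cong[OF fdW]) (simp add: assms r_br r_closed)
  also have "\<dots> = M.tr W (\<lambda>w. r x (r y (r z w))) - M.tr W (\<lambda>w. r y (r x (r z w)))"
    by (rule M.tr_diff[OF fdW l l]) (use assms in auto)
  also have "M.tr W (\<lambda>w. r y (r x (r z w))) = M.tr W (\<lambda>w. r x (r z (r y w)))"
    by (rule M.tr_commute[OF fdW fdW r_comp_lin r_lin]) (use assms in auto)
  also have "M.tr W (\<lambda>w. r x (r y (r z w))) - \<dots> = M.tr W (\<lambda>w. r x (r y (r z w)) - r x (r z (r y w)))"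
    by (rule M.tr_diff[OF fdW l l, symmetric]) (use assms in auto)
  also have "\<dots> = tf x (br y z)"
    unfolding tf_def by (rule M.tr_cong[OF fdW]) (simp add: assms r_br r_closed r_diff_right)
  finally show ?thesis .
qed

text \<open>The Leibniz rule \<open>(r x - a - c) (y w) = ((ad x - c) y) w + y ((r x - a) w)\<close>
  distributes a power over both factors; a total exponent of at least \<open>i + j\<close> exhausts
  one of them.\<close>

lemma weight_action:
  assumes "x \<in> L" "y \<in> A.gen L (br x) c" "w \<in> M.gen W (r x) a"
  shows "r y w \<in> M.gen W (r x) (a + c)"
proof -
  let ?sb = "A.shift (br x) c" and ?sr = "M.shift (r x)"
  note lb = A.shift_lin[OF A.sL A.br_lin[OF assms(1)]] and lr = M.shift_lin[OF sW r_lin[OF assms(1)]]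
  note zero = M.lin_0[OF sW M.lin_funpow[OF lr]]
  have *: "(?sr (a + c) ^^ n) (r y w) = 0"
    if "(?sb ^^ i) y = 0" "(?sr a ^^ j) w = 0" "i + j \<le> n" "y \<in> L" "w \<in> W" for n i j y w
    using that
  proof (induction n arbitrary: i j y w)
    case 0
    then show ?case using r_zero by simp
  next
    case (Suc n)
    show ?case
    proof (cases "i = 0 \<or> j = 0")
      case True
      then have "r y w = 0" using Suc.prems r_zero r_zero_right by auto
      then show ?thesis using zero by (simp del: funpow.simps)
    next
      case False
      then obtain i' j' where ij: "i = Suc i'" "j = Suc j'" by (meson not0_implies_Suc)
      have V: "?sb y \<in> L" "?sr a w \<in> W" using A.linD(1)[OF lb] M.linD(1)[OF lr] Suc.prems by auto
      have "?sr (a + c) (r y w) = r (?sb y) w + r y (?sr a w)"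
        using Suc.prems(4,5) assms(1)
        by (simp add: M.shift_def A.shift_def r_diff r_diff_right r_br r_scale r_scale_right A.br_closed r_closed
          A.subspace_scale[OF A.sL] M.subspace_scale[OF sW] algebra_simps)
      moreover have "(?sr (a + c) ^^ n) (r (?sb y) w) = 0"
        by (rule Suc.IH[of i' _ j]) (use Suc.prems V ij in \<open>auto simp: funpow_swap1\<close>)
      moreover have "(?sr (a + c) ^^ n) (r y (?sr a w)) = 0"
        by (rule Suc.IH[of i _ j']) (use Suc.prems V ij in \<open>auto simp: funpow_swap1\<close>)
      ultimately show ?thesis
        using M.linD(2)[OF M.lin_funpow[OF lr], of "r (?sb y) w" "r y (?sr a w)"] V Suc.prems(4,5) r_closed
        by (simp add: funpow_swap1)
    qed
  qed
  show ?thesis using *[OF _ _ order_refl] assms(2,3) r_closed unfolding A.gen_def M.gen_def by blast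
qed

text \<open>Cartan's criterion.  For additive \<open>\<phi>\<close>, let \<open>D\<close> act as \<open>\<phi> a\<close> on the generalized \<open>a\<close>-eigenspace of \<open>r x\<close>.
  If \<open>y\<close> has weight \<open>c\<close> under \<open>ad x\<close>, then \<open>[D, r y] = \<phi> c \<cdot> r y\<close>, so \<open>tr (D \<circ> r x) = 0\<close> because \<open>x\<close> is a
  sum of brackets; varying \<open>\<phi>\<close> over rational-valued maps shows that \<open>r x\<close> is nilpotent.\<close>

theorem perfect_trace_form_zero_trivial:
  assumes "A.perfect" and tf0: "\<And>x y. x \<in> L \<Longrightarrow> y \<in> L \<Longrightarrow> tf x y = 0" and xw: "x \<in> L" "w \<in> W"
  shows "r x w = 0"
proof (rule perfect_nilpotent_trivial[OF assms(1) _ xw])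
  fix x w assume x: "x \<in> L" and w: "w \<in> W"
  show "\<exists>n. (r x ^^ n) w = 0"
  proof (rule M.nilpotent_if_traces_vanish[OF fdW r_lin[OF x] _ w])
    fix \<phi> D assume add: "\<And>x y. \<phi> (x + y) = \<phi> x + \<phi> y" and D: "M.eigen_op W (r x) \<phi> D"
    have lD: "M.lin W W D" and eD: "D v = t (\<phi> a) v" if "v \<in> M.gen W (r x) a" for v a
      using D that by (auto simp: M.eigen_op_def)
    have lD: "M.lin W W D" using D by (auto simp: M.eigen_op_def)
    have Dcomm: "D (r y v) = r y (D v) + t (\<phi> c) (r y v)" if y: "y \<in> A.gen L (br x) c" and v: "v \<in> W" for y c v
    proof -
      have yL: "y \<in> L" using y A.gen_subset by auto
      let ?P = "{v \<in> W. D (r y v) = r y (D v) + t (\<phi> c) (r y v)}"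
      have "M.subspace ?P"
        using yL by (intro M.subspaceI)
          (auto simp: M.subspace_0[OF sW] M.subspace_add[OF sW] M.subspace_scale[OF sW] r_zero_right M.lin_0[OF sW lD]
            M.linD[OF lD] r_add_right r_scale_right r_closed algebra_simps)
      moreover have "M.gen W (r x) a \<subseteq> ?P" for a
      proof
        fix v assume v: "v \<in> M.gen W (r x) a"
        then have vW: "v \<in> W" using M.gen_subset by auto
        have "D (r y v) = t (\<phi> (a + c)) (r y v)" by (rule eD[OF weight_action[OF x y v]])
        then show "v \<in> ?P" using vW yL by (simp add: eD[OF v] add r_scale_right M.scale_left_distrib)
      qed
      ultimately have "M.span (\<Union>a. M.gen W (r x) a) \<subseteq> ?P" by (intro M.span_minimal) auto
      then show ?thesis using M.gen_span[OF fdW r_lin[OF x] v] by blast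
    qed
    \<comment> \<open>For \<open>y\<close> of weight \<open>c\<close> the two traces differ by
      \<open>\<phi> c\<close> times \<open>tf y z\<close>, which is zero. Both are linear in
      \<open>y\<close>, and the weight spaces of \<open>ad x\<close> span \<open>L\<close>.\<close>
    have trD: "M.tr W (\<lambda>w. D (r y (r z w))) = M.tr W (\<lambda>w. r y (D (r z w)))" if y: "y \<in> L" and z: "z \<in> L" for y z
    proof -
      note l1 = M.lin_compose[OF r_comp_lin lD] and l2 = M.lin_compose[OF M.lin_compose[OF r_lin lD] r_lin]
      let ?P = "{y \<in> L. M.tr W (\<lambda>w. D (r y (r z w))) = M.tr W (\<lambda>w. r y (D (r z w)))}"
      have "A.subspace ?P"
      proof (rule A.subspaceI)
        show "0 \<in> ?P"
          using A.subspace_0[OF A.sL] r_closed[OF z] M.linD(1)[OF lD] M.lin_0[OF sW lD]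
          by (auto intro!: M.tr_cong[OF fdW] simp: r_zero)
        show "u + v \<in> ?P" if u: "u \<in> ?P" "v \<in> ?P" for u v
        proof -
          have "M.tr W (\<lambda>w. D (r (u + v) (r z w))) = M.tr W (\<lambda>w. D (r u (r z w)) + D (r v (r z w)))"
            by (rule M.tr_cong[OF fdW]) (use u z in \<open>auto simp: r_add r_closed M.linD[OF lD]\<close>)
          moreover have "M.tr W (\<lambda>w. r (u + v) (D (r z w))) = M.tr W (\<lambda>w. r u (D (r z w)) + r v (D (r z w)))"
            by (rule M.tr_cong[OF fdW]) (use u z in \<open>auto simp: r_add r_closed M.linD[OF lD]\<close>)
          ultimately show ?thesis
            using u z A.subspace_add[OF A.sL] by (simp add: M.tr_add[OF fdW] l1 l2)
        qed
        show "s c u \<in> ?P" if u: "u \<in> ?P" for c u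
        proof -
          have "M.tr W (\<lambda>w. D (r (s c u) (r z w))) = M.tr W (\<lambda>w. t c (D (r u (r z w))))"
            by (rule M.tr_cong[OF fdW]) (use u z in \<open>auto simp: r_scale r_closed M.linD[OF lD]\<close>)
          moreover have "M.tr W (\<lambda>w. r (s c u) (D (r z w))) = M.tr W (\<lambda>w. t c (r u (D (r z w))))"
            by (rule M.tr_cong[OF fdW]) (use u z in \<open>auto simp: r_scale r_closed M.linD[OF lD]\<close>)
          ultimately show ?thesis
            using u z A.subspace_scale[OF A.sL] by (simp add: M.tr_scale[OF fdW] l1 l2)
        qed
      qed
      moreover have "A.gen L (br x) c \<subseteq> ?P" for c
      proof
        fix y assume y: "y \<in> A.gen L (br x) c"
        then have yL: "y \<in> L" using A.gen_subset by auto
        have "M.tr W (\<lambda>w. D (r y (r z w))) = M.tr W (\<lambda>w. r y (D (r z w)) + t (\<phi> c) (r y (r z w)))"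
          by (rule M.tr_cong[OF fdW]) (use z in \<open>simp add: Dcomm[OF y] r_closed\<close>)
        also have "\<dots> = M.tr W (\<lambda>w. r y (D (r z w))) + \<phi> c * tf y z"
          unfolding tf_def using yL z
          by (subst M.tr_add[OF fdW l2 M.lin_scale[OF sW r_comp_lin]]) (simp_all add: M.tr_scale[OF fdW r_comp_lin])
        finally show "y \<in> ?P" using tf0[OF yL z] yL by simp
      qed
      ultimately have "A.span (\<Union>a. A.gen L (br x) a) \<subseteq> ?P" by (intro A.span_minimal) auto
      then show ?thesis using A.gen_span[OF A.fdL A.br_lin[OF x] y] by blast
    qed
    \<comment> \<open>The vanishing is proved for all \<open>u\<close> with \<open>D\<close> fixed,
      so that perfectness applies; on a bracket, cyclicity of the trace reduces it to
      \<open>trD\<close>.\<close>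
    let ?Q = "{u \<in> L. M.tr W (\<lambda>w. D (r u w)) = 0}"
    note l = M.lin_compose[OF r_lin lD]
    have "L \<subseteq> ?Q"
    proof (rule A.perfect_induct[OF assms(1)])
      show "A.subspace ?Q"
      proof (rule A.subspaceI)
        show "0 \<in> ?Q"
          using A.subspace_0[OF A.sL] M.tr_cong[OF fdW, of "\<lambda>w. D (r 0 w)" "\<lambda>w. 0"] M.lin_0[OF sW lD]
          by (simp add: r_zero M.tr_0[OF fdW])
        show "u + v \<in> ?Q" if u: "u \<in> ?Q" "v \<in> ?Q" for u v
        proof -
          have "M.tr W (\<lambda>w. D (r (u + v) w)) = M.tr W (\<lambda>w. D (r u w) + D (r v w))"
            by (rule M.tr_cong[OF fdW]) (use u in \<open>auto simp: r_add r_closed M.linD[OF lD]\<close>)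
          then show ?thesis using u A.subspace_add[OF A.sL] by (simp add: M.tr_add[OF fdW] l)
        qed
        show "s c u \<in> ?Q" if u: "u \<in> ?Q" for c u
        proof -
          have "M.tr W (\<lambda>w. D (r (s c u) w)) = M.tr W (\<lambda>w. t c (D (r u w)))"
            by (rule M.tr_cong[OF fdW]) (use u in \<open>auto simp: r_scale r_closed M.linD[OF lD]\<close>)
          then show ?thesis using u A.subspace_scale[OF A.sL] by (simp add: M.tr_scale[OF fdW] l)
        qed
      qed
      fix y z assume yz: "y \<in> L" "z \<in> L"
      have "M.tr W (\<lambda>w. D (r (br y z) w)) = M.tr W (\<lambda>w. D (r y (r z w)) - D (r z (r y w)))"
        by (rule M.tr_cong[OF fdW]) (use yz in \<open>simp add: r_br M.lin_diff[OF sW lD] r_closed\<close>)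
      also have "\<dots> = M.tr W (\<lambda>w. D (r y (r z w))) - M.tr W (\<lambda>w. D (r z (r y w)))"
        using yz by (intro M.tr_diff[OF fdW] M.lin_compose[OF r_comp_lin lD])
      also have "M.tr W (\<lambda>w. D (r z (r y w))) = M.tr W (\<lambda>w. r y (D (r z w)))"
        by (rule M.tr_commute[OF fdW fdW r_lin[OF yz(1)] l[OF yz(2)]])
      finally show "br y z \<in> ?Q" using trD[OF yz] A.br_closed[OF yz] by simp
    qed
    then show "M.tr W (\<lambda>v. D (r x v)) = 0" using x by auto
  qed
qed

end

section \<open>Casimir operators and invariants\<close>

locale inv_lie_algebra = lie_algebra scale L br
  for scale :: "'a::{alg_closed_field,field_char_0} \<Rightarrow> 'b::ab_group_add \<Rightarrow> 'b" and L br +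
  fixes \<sigma> :: "'b \<Rightarrow> 'b"
  assumes \<sigma>_lin: "lin L L \<sigma>"
    and \<sigma>_inv: "x \<in> L \<Longrightarrow> \<sigma> (\<sigma> x) = x"
    and \<sigma>_br: "x \<in> L \<Longrightarrow> y \<in> L \<Longrightarrow> \<sigma> (br x y) = br (\<sigma> x) (\<sigma> y)"
begin

lemma \<sigma>_closed: "x \<in> L \<Longrightarrow> \<sigma> x \<in> L"
  using linD(1)[OF \<sigma>_lin] .

definition inv_ideal :: "'b set \<Rightarrow> bool"
  where "inv_ideal K \<longleftrightarrow> subspace K \<and> K \<subseteq> L \<and> (\<forall>x\<in>K. \<forall>y\<in>L. br x y \<in> K) \<and> (\<forall>x\<in>K. \<sigma> x \<in> K)"

lemma inv_idealD:
  assumes "inv_ideal K"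
  shows "subspace K" "K \<subseteq> L" "x \<in> K \<Longrightarrow> y \<in> L \<Longrightarrow> br x y \<in> K" "x \<in> K \<Longrightarrow> y \<in> L \<Longrightarrow> br y x \<in> K"
    "x \<in> K \<Longrightarrow> \<sigma> x \<in> K"
proof -
  show s: "subspace K" and KL: "K \<subseteq> L" and "x \<in> K \<Longrightarrow> \<sigma> x \<in> K"
    and b: "x \<in> K \<Longrightarrow> y \<in> L \<Longrightarrow> br x y \<in> K" using assms by (auto simp: inv_ideal_def)
  show "br y x \<in> K" if "x \<in> K" "y \<in> L"
    using br_skew[of y x] b[OF that] that KL subspace_neg[OF s] by auto
qed

end

locale inv_lie_module = lie_module s L br t W r + A: inv_lie_algebra s L br \<sigma>
  for s :: "'a::{alg_closed_field,field_char_0} \<Rightarrow> 'b::ab_group_add \<Rightarrow> 'b" and L br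
  and \<sigma> and t :: "'a \<Rightarrow> 'w::ab_group_add \<Rightarrow> 'w" and W r +
  fixes \<tau> :: "'w \<Rightarrow> 'w"
  assumes \<tau>_lin: "M.lin W W \<tau>"
    and \<tau>_inv: "w \<in> W \<Longrightarrow> \<tau> (\<tau> w) = w"
    and \<tau>_r: "x \<in> L \<Longrightarrow> w \<in> W \<Longrightarrow> \<tau> (r x w) = r (\<sigma> x) (\<tau> w)"
begin

lemma \<tau>_closed: "w \<in> W \<Longrightarrow> \<tau> w \<in> W"
  using M.linD(1)[OF \<tau>_lin] .

lemma inv_submodule:
  assumes "M.subspace U" "U \<subseteq> W" "\<And>x w. x \<in> L \<Longrightarrow> w \<in> U \<Longrightarrow> r x w \<in> U" "\<And>w. w \<in> U \<Longrightarrow> \<tau> w \<in> U"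
  shows "inv_lie_module s L br \<sigma> t U r \<tau>"
proof -
  interpret U: lie_module s L br t U r by (rule submodule[OF assms(1-3)])
  show ?thesis
    by unfold_locales (use assms(2,4) \<tau>_inv \<tau>_r M.lin_subset[OF \<tau>_lin assms(2)] in auto)
qed

text \<open>\<open>r (\<sigma> x)\<close> is the conjugate of \<open>r x\<close> by the involution
  \<open>\<tau>\<close>, and traces are invariant under conjugation.\<close>

lemma tf_\<sigma>: assumes "x \<in> L" "y \<in> L" shows "tf (\<sigma> x) (\<sigma> y) = tf x y"
proof -
  have eq: "r (\<sigma> x) w = \<tau> (r x (\<tau> w))" if "x \<in> L" "w \<in> W" for x w
    using \<tau>_r[OF that(1) \<tau>_closed[OF that(2)]] \<tau>_inv[OF that(2)] by simp
  have "tf (\<sigma> x) (\<sigma> y) = M.tr W (\<lambda>w. \<tau> (r x (r y (\<tau> w))))"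
    unfolding tf_def using assms by (intro M.tr_cong[OF fdW]) (simp add: eq \<tau>_inv \<tau>_closed r_closed)
  also have "\<dots> = M.tr W (\<lambda>w. r x (r y (\<tau> (\<tau> w))))"
    by (rule M.tr_commute[OF fdW fdW M.lin_compose[OF \<tau>_lin r_comp_lin[OF assms]] \<tau>_lin])
  also have "\<dots> = tf x y" unfolding tf_def by (rule M.tr_cong[OF fdW]) (simp add: \<tau>_inv)
  finally show ?thesis .
qed

lemma tf_\<sigma>_left: "x \<in> L \<Longrightarrow> y \<in> L \<Longrightarrow> tf (\<sigma> x) y = tf x (\<sigma> y)"
  using tf_\<sigma>[of x "\<sigma> y"] A.\<sigma>_inv A.\<sigma>_closed by simp

definition rad :: "'b set"
  where "rad = {x \<in> L. \<forall>y\<in>L. tf x y = 0}"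

lemma rad_ideal: "A.inv_ideal rad"
  unfolding A.inv_ideal_def
proof (intro conjI ballI)
  show "A.subspace rad" unfolding rad_def
    by (intro A.subspaceI)
      (auto simp: A.subspace_0[OF A.sL] A.subspace_add[OF A.sL] A.subspace_scale[OF A.sL] tf_zero_left tf_add_left tf_scale_left)
  show "rad \<subseteq> L" by (auto simp: rad_def)
  show "br x y \<in> rad" if "x \<in> rad" "y \<in> L" for x y
    using that by (auto simp: rad_def A.br_closed tf_invariant)
  show "\<sigma> x \<in> rad" if "x \<in> rad" for x
    using that by (auto simp: rad_def A.\<sigma>_closed tf_\<sigma>_left)
qed

lemma rad_subset: "rad \<subseteq> L"
  by (auto simp: rad_def)

lemma tf_sum_left: "(\<And>i. i \<in> I \<Longrightarrow> g i \<in> L) \<Longrightarrow> y \<in> L \<Longrightarrow> tf (sum g I) y = (\<Sum>i\<in>I. tf (g i) y)"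
proof (induction I rule: infinite_finite_induct)
  case (insert a I)
  then show ?case using A.subspace_sum[OF A.sL, of I g] by (simp add: tf_add_left)
qed (simp_all add: tf_zero_left)

lemma tf_diff_left: "x \<in> L \<Longrightarrow> y \<in> L \<Longrightarrow> z \<in> L \<Longrightarrow> tf (x - y) z = tf x z - tf y z"
  using tf_add_left[of x "s (-1) y" z] tf_scale_left[of y z "-1"] A.subspace_scale[OF A.sL, of y "-1"] by simp

text \<open>The trace form may be degenerate, so \<open>E\<close> is a basis of a complement of
  \<open>rad\<close>. The coordinates of \<open>T c\<close> are the values of the form on
  \<open>E\<close>; \<open>T\<close> is injective because only \<open>rad\<close> is orthogonal to
  \<open>E\<close>, and preimages under \<open>T\<close> of the elements of \<open>E\<close> form
  the dual family.\<close>

lemma dual_basis: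
  "\<exists>E d. finite E \<and> E \<subseteq> L \<and> (\<forall>e\<in>E. d e \<in> L)
    \<and> (\<forall>e\<in>E. \<forall>e'\<in>E. tf (d e) e' = (if e' = e then 1 else 0))
    \<and> (\<forall>x\<in>L. (\<forall>e\<in>E. tf x e = 0) \<longrightarrow> x \<in> rad)"
proof -
  note R = A.inv_idealD[OF rad_ideal]
  obtain C where C: "A.subspace C" "C \<subseteq> L" "C \<inter> rad = {0}" "\<And>v. v \<in> L \<Longrightarrow> \<exists>c\<in>C. \<exists>u\<in>rad. v = c + u"
    using A.complement_ex[OF A.fdL R(1,2)] by blast
  have fdC: "A.fd C" by (rule A.fd_subset[OF A.fdL C(1,2)])
  obtain E where E: "A.basis_of E C" using A.basis_of_ex[OF fdC] by blast
  note Es = A.basis_ofD[OF E]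
  have EL: "E \<subseteq> L" using Es(4) C(2) by blast
  have sep: "x \<in> rad" if x: "x \<in> L" "\<And>e. e \<in> E \<Longrightarrow> tf x e = 0" for x
  proof -
    have "A.subspace {y \<in> L. tf x y = 0}"
      using x(1) by (intro A.subspaceI)
        (auto simp: A.subspace_0[OF A.sL] A.subspace_add[OF A.sL] A.subspace_scale[OF A.sL] tf_zero_right tf_add_right tf_scale_right)
    moreover have "E \<subseteq> {y \<in> L. tf x y = 0}" using x(2) EL by blast
    ultimately have CE: "C \<subseteq> {y \<in> L. tf x y = 0}" using A.span_minimal Es(3) by blast
    have "tf x y = 0" if y: "y \<in> L" for y
    proof -
      obtain c u where cu: "c \<in> C" "u \<in> rad" "y = c + u" using C(4)[OF y] by blast
      have "u \<in> L" "tf x u = 0" using cu(2) x(1) by (auto simp: rad_def tf_commute[of x u])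
      then show ?thesis using cu CE x(1) by (auto simp: tf_add_right)
    qed
    then show ?thesis using x(1) by (simp add: rad_def)
  qed
  define T where "T c = (\<Sum>e\<in>E. s (tf c e) e)" for c
  have "A.lin C C T"
  proof (rule A.linI)
    show "T c \<in> C" for c unfolding T_def using Es(4) by (intro A.subspace_sum[OF C(1)] A.subspace_scale[OF C(1)]) auto
    show "T (x + y) = T x + T y" if "x \<in> C" "y \<in> C" for x y
    proof -
      have "x \<in> L" "y \<in> L" using that C(2) by auto
      then show ?thesis unfolding T_def sum.distrib[symmetric] using EL
        by (intro sum.cong) (auto simp: tf_add_left A.scale_left_distrib)
    qed
    show "T (s c x) = s c (T x)" if "x \<in> C" for c x
    proof -
      have "x \<in> L" using that C(2) by auto
      then show ?thesis unfolding T_def A.scale_sum_right using EL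
        by (intro sum.cong) (auto simp: tf_scale_left)
    qed
  qed
  moreover have Tz: "tf c e = tf c' e" if "T c = T c'" "e \<in> E" for c c' e
  proof -
    have "(\<Sum>e\<in>E. s (tf c e - tf c' e) e) = 0"
      using that(1) by (simp add: T_def A.scale_left_diff_distrib sum_subtractf)
    then have "tf c e - tf c' e = 0" by (rule A.independentD[OF Es(2,1) subset_refl _ that(2)])
    then show ?thesis by simp
  qed
  moreover have "c = 0" if c: "c \<in> C" "T c = 0" for c
  proof -
    have "tf c e = 0" if "e \<in> E" for e
      using A.independentD[OF Es(2,1) subset_refl, of "tf c" e] c(2) that by (simp add: T_def)
    then have "c \<in> rad" using sep[of c] c(1) C(2) by blast
    then show ?thesis using c(1) C(3) by blast
  qed
  ultimately have surj: "T ` C = C" using A.lin_inj_imp_surj[OF fdC] by blast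
  have "\<exists>c\<in>C. \<forall>e'\<in>E. tf c e' = (if e' = e then 1 else 0)" if e: "e \<in> E" for e
  proof -
    have "e \<in> T ` C" using e Es(4) surj by blast
    then obtain c where c: "c \<in> C" "T c = e" by blast
    have "tf c e' = (if e' = e then 1 else 0)" if e': "e' \<in> E" for e'
    proof -
      have "(\<Sum>x\<in>E. s (tf c x - (if x = e then 1 else 0)) x) = T c - (\<Sum>x\<in>E. s (if x = e then 1 else 0) x)"
        by (simp add: T_def A.scale_left_diff_distrib sum_subtractf)
      also have "(\<Sum>x\<in>E. s (if x = e then 1 else 0) x) = (\<Sum>x\<in>E. if x = e then x else 0)"
        by (intro sum.cong) auto
      also have "\<dots> = e" using Es(1) e by (simp add: sum.delta)
      finally have "(\<Sum>x\<in>E. s (tf c x - (if x = e then 1 else 0)) x) = 0" using c(2) by simp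
      from A.independentD[OF Es(2,1) subset_refl this e'] show ?thesis by simp
    qed
    then show ?thesis using c(1) by blast
  qed
  then have "\<exists>d. \<forall>e\<in>E. d e \<in> C \<and> (\<forall>e'\<in>E. tf (d e) e' = (if e' = e then 1 else 0))" by (intro bchoice) blast
  then obtain d where d: "\<And>e. e \<in> E \<Longrightarrow> d e \<in> C" "\<And>e e'. e \<in> E \<Longrightarrow> e' \<in> E \<Longrightarrow> tf (d e) e' = (if e' = e then 1 else 0)"
    by blast
  have "d e \<in> L" if "e \<in> E" for e using d(1)[OF that] C(2) by blast
  then show ?thesis using Es(1) EL d(2) sep by (intro exI[of _ E] exI[of _ d]) simp
qed

context
  fixes E d
  assumes E: "finite E" "E \<subseteq> L" and d_closed: "\<And>e. e \<in> E \<Longrightarrow> d e \<in> L"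
    and d: "\<And>e e'. e \<in> E \<Longrightarrow> e' \<in> E \<Longrightarrow> tf (d e) e' = (if e' = e then 1 else 0)"
    and sep: "\<And>x. x \<in> L \<Longrightarrow> (\<And>e. e \<in> E \<Longrightarrow> tf x e = 0) \<Longrightarrow> x \<in> rad"
begin

lemma E_closed: "e \<in> E \<Longrightarrow> e \<in> L"
  using E(2) by blast

lemmas L_scale = A.subspace_scale[OF A.sL]

lemma dual_combination_closed: "(\<Sum>e\<in>E. s (c e) (d e)) \<in> L"
  and combination_closed: "(\<Sum>e\<in>E. s (c e) e) \<in> L"
  using d_closed E_closed by (auto intro!: A.subspace_sum[OF A.sL] L_scale)

lemma dual_expansion:
  assumes y: "y \<in> L"
  shows "y - (\<Sum>e\<in>E. s (tf y e) (d e)) \<in> rad"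
proof (rule sep)
  show "y - (\<Sum>e\<in>E. s (tf y e) (d e)) \<in> L" by (rule A.subspace_diff[OF A.sL y dual_combination_closed])
  fix e assume e: "e \<in> E"
  have "tf (\<Sum>e\<in>E. s (tf y e) (d e)) e = (\<Sum>e'\<in>E. tf y e' * tf (d e') e)"
    using e E_closed d_closed by (subst tf_sum_left) (auto simp: L_scale tf_scale_left)
  also have "\<dots> = (\<Sum>e'\<in>E. if e = e' then tf y e' else 0)" using e by (intro sum.cong) (auto simp: d)
  also have "\<dots> = tf y e" using E(1) e by (simp add: sum.delta')
  finally show "tf (y - (\<Sum>e\<in>E. s (tf y e) (d e))) e = 0"
    using tf_diff_left[OF y dual_combination_closed E_closed[OF e]] by simp
qed

lemma tf_rad_right: assumes "u \<in> rad" "z \<in> L" shows "tf z u = 0"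
  using assms tf_commute[of z u] by (auto simp: rad_def)

text \<open>The difference is orthogonal to every dual vector, and modulo \<open>rad\<close> the
  dual vectors span \<open>L\<close> by \<open>dual_expansion\<close>.\<close>

lemma dual_expansion_swapped:
  assumes y: "y \<in> L"
  shows "y - (\<Sum>e\<in>E. s (tf (d e) y) e) \<in> rad"
proof -
  let ?u = "y - (\<Sum>e\<in>E. s (tf (d e) y) e)"
  have uL: "?u \<in> L" by (rule A.subspace_diff[OF A.sL y combination_closed])
  have ud: "tf ?u (d e) = 0" if e: "e \<in> E" for e
  proof -
    have "tf (\<Sum>e\<in>E. s (tf (d e) y) e) (d e) = (\<Sum>e'\<in>E. tf (d e') y * tf (d e) e')"
      using e E_closed d_closed by (subst tf_sum_left) (auto simp: L_scale tf_scale_left intro!: sum.cong tf_commute)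
    also have "\<dots> = (\<Sum>e'\<in>E. if e = e' then tf (d e') y else 0)" using e by (intro sum.cong) (auto simp: d)
    also have "\<dots> = tf y (d e)" using E(1) e d_closed y by (simp add: sum.delta' tf_commute)
    finally show ?thesis using tf_diff_left[OF y combination_closed d_closed[OF e]] by simp
  qed
  have "tf ?u z = 0" if z: "z \<in> L" for z
  proof -
    let ?v = "\<Sum>e\<in>E. s (tf z e) (d e)"
    have "tf (z - ?v) ?u = 0" using tf_rad_right[OF dual_expansion[OF z] uL] tf_commute[OF uL A.subspace_diff[OF A.sL z dual_combination_closed]] by simp
    moreover have "tf ?v ?u = (\<Sum>e\<in>E. tf z e * tf (d e) ?u)"
      using d_closed uL by (subst tf_sum_left) (auto simp: L_scale tf_scale_left)
    moreover have "\<dots> = 0" using ud d_closed uL by (intro sum.neutral) (simp add: tf_commute)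
    ultimately show ?thesis using tf_diff_left[OF z dual_combination_closed uL] tf_commute[OF uL z] by simp
  qed
  then show ?thesis using uL by (simp add: rad_def)
qed

context
  assumes radz: "\<And>x w. x \<in> rad \<Longrightarrow> w \<in> W \<Longrightarrow> r x w = 0"
begin

text \<open>As the radical acts by zero, expansions modulo \<open>rad\<close> become exact
  identities between operators on \<open>W\<close>.\<close>

lemma r_modulo_rad:
  assumes "y \<in> L" "w \<in> W" "\<And>e. e \<in> E \<Longrightarrow> g e \<in> L" "y - (\<Sum>e\<in>E. s (c e) (g e)) \<in> rad"
  shows "r y w = (\<Sum>e\<in>E. t (c e) (r (g e) w))"
proof -
  have gL: "(\<Sum>e\<in>E. s (c e) (g e)) \<in> L" using assms(3) by (intro A.subspace_sum[OF A.sL] L_scale) auto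
  have "r y w = r (\<Sum>e\<in>E. s (c e) (g e)) w"
    using radz[OF assms(4,2)] r_diff[OF assms(1) gL assms(2)] by simp
  also have "\<dots> = (\<Sum>e\<in>E. t (c e) (r (g e) w))"
    using assms(2,3) by (subst r_sum) (auto simp: L_scale r_scale)
  finally show ?thesis .
qed

lemma r_expansion_swapped: assumes "y \<in> L" "w \<in> W" shows "r y w = (\<Sum>e\<in>E. t (tf (d e) y) (r e w))"
  by (rule r_modulo_rad[OF assms E_closed dual_expansion_swapped[OF assms(1)]])

lemma r_expansion: assumes "y \<in> L" "w \<in> W" shows "r y w = (\<Sum>e\<in>E. t (tf y e) (r (d e) w))"
  by (rule r_modulo_rad[OF assms d_closed dual_expansion[OF assms(1)]])

definition casimir_op :: "'w \<Rightarrow> 'w"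
  where "casimir_op w = (\<Sum>e\<in>E. r e (r (d e) w))"

lemma r_sum_right:
  "x \<in> L \<Longrightarrow> (\<And>i. i \<in> E \<Longrightarrow> g i \<in> W) \<Longrightarrow> r x (\<Sum>i\<in>E. g i) = (\<Sum>i\<in>E. r x (g i))"
  by (rule M.lin_sum[OF sW r_lin])

lemma casimir_summand_lin: "e \<in> E \<Longrightarrow> M.lin W W (\<lambda>w. r e (r (d e) w))"
  by (rule r_comp_lin[OF E_closed d_closed])

lemma casimir_op_lin: "M.lin W W casimir_op"
  unfolding casimir_op_def by (rule M.lin_sum_fun[OF sW casimir_summand_lin])

text \<open>Invariance of the form makes the matrix of \<open>ad x\<close> on the dual family the
  negative transpose of its matrix on \<open>E\<close>, both modulo \<open>rad\<close>, so the two
  resulting double sums cancel.\<close>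

lemma casimir_op_commute:
  assumes x: "x \<in> L" and w: "w \<in> W"
  shows "casimir_op (r x w) = r x (casimir_op w)"
proof -
  have c: "r e (r (d e) w) \<in> W" if "e \<in> E" for e using that E_closed d_closed w r_closed by simp
  have b: "br x e \<in> L" "br x (d e) \<in> L" if "e \<in> E" for e using that E_closed d_closed x A.br_closed by auto
  have "r x (casimir_op w) - casimir_op (r x w) = (\<Sum>e\<in>E. r x (r e (r (d e) w)) - r e (r (d e) (r x w)))"
    unfolding casimir_op_def sum_subtractf using c by (simp add: r_sum_right[OF x])
  also have "\<dots> = (\<Sum>e\<in>E. r (br x e) (r (d e) w) + r e (r (br x (d e)) w))"
    using x w E_closed d_closed by (intro sum.cong) (auto simp: r_br r_closed r_diff_right)
  also have "\<dots> = (\<Sum>e\<in>E. r (br x e) (r (d e) w)) + (\<Sum>e'\<in>E. r e' (r (br x (d e')) w))"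
    by (rule sum.distrib)
  also have "(\<Sum>e\<in>E. r (br x e) (r (d e) w)) = (\<Sum>e\<in>E. \<Sum>e'\<in>E. t (tf (d e') (br x e)) (r e' (r (d e) w)))"
    by (intro sum.cong refl r_expansion_swapped) (auto simp: b E_closed d_closed r_closed w)
  also have "\<dots> = (\<Sum>e'\<in>E. \<Sum>e\<in>E. t (tf (d e') (br x e)) (r e' (r (d e) w)))" by (rule sum.swap)
  also have "(\<Sum>e'\<in>E. r e' (r (br x (d e')) w)) = (\<Sum>e'\<in>E. \<Sum>e\<in>E. t (tf (br x (d e')) e) (r e' (r (d e) w)))"
  proof (intro sum.cong refl)
    fix e' assume e': "e' \<in> E"
    have "r (br x (d e')) w = (\<Sum>e\<in>E. t (tf (br x (d e')) e) (r (d e) w))"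
      by (rule r_expansion) (auto simp: b e' d_closed w)
    moreover have "r e' (\<Sum>e\<in>E. t (tf (br x (d e')) e) (r (d e) w)) = (\<Sum>e\<in>E. r e' (t (tf (br x (d e')) e) (r (d e) w)))"
      by (rule r_sum_right[OF E_closed[OF e']]) (auto simp: d_closed w r_closed M.subspace_scale[OF sW])
    ultimately show "r e' (r (br x (d e')) w) = (\<Sum>e\<in>E. t (tf (br x (d e')) e) (r e' (r (d e) w)))"
      using e' by (simp add: r_scale_right E_closed d_closed r_closed w)
  qed
  also have "(\<Sum>e'\<in>E. \<Sum>e\<in>E. t (tf (d e') (br x e)) (r e' (r (d e) w))) + \<dots> = 0"
  proof -
    have "tf (br x (d e')) e = - tf (d e') (br x e)" if "e \<in> E" "e' \<in> E" for e e'
      using tf_invariant[OF d_closed[OF that(2)] x E_closed[OF that(1)]] A.br_skew[OF x d_closed[OF that(2)]]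
        tf_diff_left[OF A.subspace_0[OF A.sL] A.br_closed[OF d_closed[OF that(2)] x] E_closed[OF that(1)]] tf_zero_left[OF E_closed[OF that(1)]]
      by simp
    then show ?thesis unfolding sum.distrib[symmetric] by (intro sum.neutral ballI) simp
  qed
  finally show ?thesis by simp
qed

text \<open>The involution preserves the trace form and hence carries \<open>E\<close> and
  \<open>d\<close> to another dual pair modulo \<open>rad\<close>; the Casimir operator does not
  depend on the choice of the pair.\<close>

lemma casimir_op_\<tau>:
  assumes w: "w \<in> W"
  shows "casimir_op (\<tau> w) = \<tau> (casimir_op w)"
proof -
  have tw: "\<tau> w \<in> W" by (rule \<tau>_closed[OF w])
  have "\<tau> (casimir_op w) = (\<Sum>e\<in>E. \<tau> (r e (r (d e) w)))"
    unfolding casimir_op_def by (rule M.lin_sum[OF sW \<tau>_lin]) (simp add: E_closed d_closed w r_closed)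
  also have "\<dots> = (\<Sum>e\<in>E. r (\<sigma> e) (r (\<sigma> (d e)) (\<tau> w)))"
    by (intro sum.cong refl) (simp add: E_closed d_closed w r_closed \<tau>_r)
  also have "\<dots> = (\<Sum>e\<in>E. \<Sum>e'\<in>E. t (tf (d e') (\<sigma> e)) (r e' (r (\<sigma> (d e)) (\<tau> w))))"
    by (intro sum.cong refl r_expansion_swapped) (auto simp: A.\<sigma>_closed E_closed d_closed r_closed tw)
  also have "\<dots> = (\<Sum>e'\<in>E. \<Sum>e\<in>E. t (tf (d e') (\<sigma> e)) (r e' (r (\<sigma> (d e)) (\<tau> w))))" by (rule sum.swap)
  also have "\<dots> = (\<Sum>e'\<in>E. r e' (r (d e') (\<tau> w)))"
  proof (rule sum.cong[OF refl])
    fix e' assume e': "e' \<in> E"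
    let ?y = "\<sigma> (d e')"
    have yL: "?y \<in> L" by (rule A.\<sigma>_closed[OF d_closed[OF e']])
    have "\<sigma> (?y - (\<Sum>e\<in>E. s (tf ?y e) (d e))) = \<sigma> ?y - (\<Sum>e\<in>E. s (tf ?y e) (\<sigma> (d e)))"
      using A.lin_diff[OF A.sL A.\<sigma>_lin yL dual_combination_closed] A.lin_sum[OF A.sL A.\<sigma>_lin, of E "\<lambda>e. s (tf ?y e) (d e)"] d_closed
      by (simp add: L_scale A.linD(3)[OF A.\<sigma>_lin])
    then have "d e' - (\<Sum>e\<in>E. s (tf ?y e) (\<sigma> (d e))) \<in> rad"
      using A.inv_idealD(5)[OF rad_ideal dual_expansion[OF yL]] A.\<sigma>_inv[OF d_closed[OF e']] by simp
    then have "r (d e') (\<tau> w) = (\<Sum>e\<in>E. t (tf ?y e) (r (\<sigma> (d e)) (\<tau> w)))"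
      by (intro r_modulo_rad d_closed[OF e'] tw A.\<sigma>_closed[OF d_closed])
    then have "r e' (r (d e') (\<tau> w)) = (\<Sum>e\<in>E. t (tf ?y e) (r e' (r (\<sigma> (d e)) (\<tau> w))))"
      using r_sum_right[OF E_closed[OF e'], of "\<lambda>e. t (tf ?y e) (r (\<sigma> (d e)) (\<tau> w))"] e'
      by (simp add: r_scale_right E_closed d_closed A.\<sigma>_closed tw r_closed M.subspace_scale[OF sW])
    also have "\<dots> = (\<Sum>e\<in>E. t (tf (d e') (\<sigma> e)) (r e' (r (\<sigma> (d e)) (\<tau> w))))"
      using e' by (intro sum.cong refl) (simp add: tf_\<sigma>_left E_closed d_closed)
    finally show "(\<Sum>e\<in>E. t (tf (d e') (\<sigma> e)) (r e' (r (\<sigma> (d e)) (\<tau> w)))) = r e' (r (d e') (\<tau> w))" by simp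
  qed
  finally show ?thesis by (simp add: casimir_op_def)
qed

text \<open>Each dual pair contributes 1. In characteristic 0 the trace is therefore nonzero as soon
  as \<open>E\<close> is nonempty.\<close>

lemma casimir_op_trace: "M.tr W casimir_op = of_nat (card E)"
proof -
  have "M.tr W casimir_op = (\<Sum>e\<in>E. tf e (d e))" unfolding casimir_op_def tf_def by (rule M.tr_sum[OF fdW casimir_summand_lin])
  also have "\<dots> = (\<Sum>e\<in>E. 1)" by (intro sum.cong refl) (simp add: tf_commute[OF E_closed d_closed] d)
  finally show ?thesis by simp
qed

lemma casimir_op_in:
  assumes "M.subspace P" "\<And>x w. x \<in> L \<Longrightarrow> w \<in> W \<Longrightarrow> r x w \<in> P" "w \<in> W"
  shows "casimir_op w \<in> P"
  unfolding casimir_op_def by (rule M.subspace_sum[OF assms(1)]) (rule assms(2)[OF E_closed r_closed[OF d_closed assms(3)]])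

end

end

text \<open>By Cartan's criterion a nontrivial action of a perfect algebra has a nonzero trace form.
  Its radical is then a proper stable ideal, so it acts by zero, and \<open>E\<close> is
  nonempty.\<close>

lemma casimir:
  assumes perf: "A.perfect" and nontriv: "x0 \<in> L" "w0 \<in> W" "r x0 w0 \<noteq> 0"
    and ideals: "\<And>K x w. A.inv_ideal K \<Longrightarrow> K \<noteq> L \<Longrightarrow> x \<in> K \<Longrightarrow> w \<in> W \<Longrightarrow> r x w = 0"
  shows "\<exists>\<Omega>. M.lin W W \<Omega> \<and> (\<forall>x\<in>L. \<forall>w\<in>W. \<Omega> (r x w) = r x (\<Omega> w))
    \<and> (\<forall>w\<in>W. \<Omega> (\<tau> w) = \<tau> (\<Omega> w)) \<and> M.tr W \<Omega> \<noteq> 0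
    \<and> (\<forall>P. M.subspace P \<and> (\<forall>x\<in>L. \<forall>w\<in>W. r x w \<in> P) \<longrightarrow> (\<forall>w\<in>W. \<Omega> w \<in> P))"
proof -
  have radL: "rad \<noteq> L"
    using perfect_trace_form_zero_trivial[OF perf _ nontriv(1,2)] nontriv(3) by (auto simp: rad_def)
  note radz = ideals[OF rad_ideal this]
  from dual_basis obtain E d where D: "finite E \<and> E \<subseteq> L \<and> (\<forall>e\<in>E. d e \<in> L)
      \<and> (\<forall>e\<in>E. \<forall>e'\<in>E. tf (d e) e' = (if e' = e then 1 else 0))
      \<and> (\<forall>x\<in>L. (\<forall>e\<in>E. tf x e = 0) \<longrightarrow> x \<in> rad)" by (elim exE)
  have E: "finite E" "E \<subseteq> L" "\<And>e. e \<in> E \<Longrightarrow> d e \<in> L"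
    "\<And>e e'. e \<in> E \<Longrightarrow> e' \<in> E \<Longrightarrow> tf (d e) e' = (if e' = e then 1 else 0)"
    "\<And>x. x \<in> L \<Longrightarrow> (\<And>e. e \<in> E \<Longrightarrow> tf x e = 0) \<Longrightarrow> x \<in> rad"
    using D by simp_all
  have "\<not> L \<subseteq> rad" by (rule notI, rule notE[OF radL], rule subset_antisym, rule rad_subset, assumption)
  then obtain x where x: "x \<in> L" "x \<notin> rad" by (auto simp: subset_iff)
  have "(\<forall>e\<in>E. tf x e = 0) \<longrightarrow> x \<in> rad" using D x(1) by blast
  then have "\<not> (\<forall>e\<in>E. tf x e = 0)" using x(2) by iprover
  then have "E \<noteq> {}" by auto
  then have "card E \<noteq> 0" using E(1) by simp
  moreover have "M.tr W (casimir_op E d) = of_nat (card E)" by (rule casimir_op_trace[OF E radz])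
  ultimately have tr: "M.tr W (casimir_op E d) \<noteq> 0" by simp
  show ?thesis
  proof (intro exI[of _ "casimir_op E d"] conjI ballI allI impI)
    show "M.lin W W (casimir_op E d)" by (rule casimir_op_lin[OF E radz])
    show "casimir_op E d (r x w) = r x (casimir_op E d w)" if "x \<in> L" "w \<in> W" for x w by (rule casimir_op_commute[OF E radz that])
    show "casimir_op E d (\<tau> w) = \<tau> (casimir_op E d w)" if "w \<in> W" for w by (rule casimir_op_\<tau>[OF E radz that])
    show "casimir_op E d w \<in> P" if "M.subspace P \<and> (\<forall>x\<in>L. \<forall>w\<in>W. r x w \<in> P)" "w \<in> W" for P w
      by (rule casimir_op_in[OF E radz _ _ that(2)]) (use that(1) in blast)+
  qed (rule tr)
qed

end

text \<open>A form of \<open>H\<^sup>1 = 0\<close>, by induction on the dimension of \<open>W\<close>: the Casimir operator of the trace form of \<open>W\<close> itself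
  maps \<open>W\<close> into \<open>P\<close> and has non-zero trace, so its Fitting null component is a smaller submodule that is
  still not contained in \<open>P\<close>.\<close>

theorem invariant_outside:
  assumes "inv_lie_module s L br \<sigma> t W r \<tau>" "lie_algebra.perfect s L br"
    and "\<And>K x w. inv_lie_algebra.inv_ideal s L br \<sigma> K \<Longrightarrow> K \<noteq> L \<Longrightarrow> x \<in> K \<Longrightarrow> w \<in> W \<Longrightarrow> r x w = 0"
    and "module.subspace t P" "P \<subseteq> W" "P \<noteq> W" "\<And>x w. x \<in> L \<Longrightarrow> w \<in> W \<Longrightarrow> r x w \<in> P"
  shows "\<exists>w\<in>W. w \<notin> P \<and> (\<forall>x\<in>L. r x w = 0)"
  using assms(1,3-)
proof (induction "vector_space.dim t W" arbitrary: W P rule: less_induct)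
  case less
  interpret inv_lie_module s L br \<sigma> t W r \<tau> by (rule less.prems(1))
  note P = less.prems(3-6)
  show ?case
  proof (cases "\<forall>x\<in>L. \<forall>w\<in>W. r x w = 0")
    case True
    then show ?thesis using P(2,3) by blast
  next
    case False
    then obtain x0 w0 where nt: "x0 \<in> L" "w0 \<in> W" "r x0 w0 \<noteq> 0" by blast
    obtain \<Omega> where \<Omega>: "M.lin W W \<Omega>" "\<And>x w. x \<in> L \<Longrightarrow> w \<in> W \<Longrightarrow> \<Omega> (r x w) = r x (\<Omega> w)"
      "\<And>w. w \<in> W \<Longrightarrow> \<Omega> (\<tau> w) = \<tau> (\<Omega> w)" "M.tr W \<Omega> \<noteq> 0"
      and \<Omega>_in: "\<forall>P. M.subspace P \<and> (\<forall>x\<in>L. \<forall>w\<in>W. r x w \<in> P) \<longrightarrow> (\<forall>w\<in>W. \<Omega> w \<in> P)"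
    proof -
      have "\<exists>\<Omega>. M.lin W W \<Omega> \<and> (\<forall>x\<in>L. \<forall>w\<in>W. \<Omega> (r x w) = r x (\<Omega> w))
        \<and> (\<forall>w\<in>W. \<Omega> (\<tau> w) = \<tau> (\<Omega> w)) \<and> M.tr W \<Omega> \<noteq> 0
        \<and> (\<forall>P. M.subspace P \<and> (\<forall>x\<in>L. \<forall>w\<in>W. r x w \<in> P) \<longrightarrow> (\<forall>w\<in>W. \<Omega> w \<in> P))"
        by (rule casimir[OF assms(2) nt]) (rule less.prems(2))
      then show thesis by (elim exE conjE) (rule that, assumption, blast, blast, assumption, assumption)
    qed
    have \<Omega>P: "\<Omega> w \<in> P" if "w \<in> W" for w using \<Omega>_in P(1,4) that by blast
    have pW: "(\<Omega> ^^ n) w \<in> W" if "w \<in> W" for n w using M.linD(1)[OF M.lin_funpow[OF \<Omega>(1)] that] .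
    let ?W0 = "M.gen W \<Omega> 0"
    have W0: "w \<in> ?W0 \<longleftrightarrow> w \<in> W \<and> (\<exists>n. (\<Omega> ^^ n) w = 0)" for w unfolding M.gen_def M.shift_0 by auto
    have sW0: "M.subspace ?W0" by (rule M.gen_subspace[OF sW \<Omega>(1)])
    have ne: "?W0 \<noteq> W"
    proof
      assume "?W0 = W"
      then have "\<exists>n. (\<Omega> ^^ n) w = 0" if "w \<in> W" for w using W0 that by blast
      then show False using M.tr_nil[OF fdW \<Omega>(1)] \<Omega>(4) by blast
    qed
    have "(\<Omega> ^^ n) (r x w) = r x ((\<Omega> ^^ n) w)" if "x \<in> L" "w \<in> W" for n x w
      by (induction n) (use that pW \<Omega>(2) in auto)
    then have rW0: "r x w \<in> ?W0" if "x \<in> L" "w \<in> ?W0" for x w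
      using that r_closed r_zero_right unfolding W0 by metis
    have "(\<Omega> ^^ n) (\<tau> w) = \<tau> ((\<Omega> ^^ n) w)" if "w \<in> W" for n w
      by (induction n) (use that pW \<Omega>(3) in auto)
    then have tW0: "\<tau> w \<in> ?W0" if "w \<in> ?W0" for w
      using that \<tau>_closed M.lin_0[OF sW \<tau>_lin] unfolding W0 by metis
    interpret W0: inv_lie_module s L br \<sigma> t ?W0 r \<tau> by (rule inv_submodule[OF sW0 M.gen_subset rW0 tW0])
    have "\<not> ?W0 \<subseteq> P"
    proof
      assume W0P: "?W0 \<subseteq> P"
      \<comment> \<open>Components of nonzero weight lie in \<open>P\<close> because the range of
        \<open>\<Omega>\<close> does; if the null component did as well, \<open>P\<close> would be
        all of \<open>W\<close>.\<close>
      have "M.gen W \<Omega> a \<subseteq> P" for a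
        using W0P M.gen_subset_of_range[OF sW \<Omega>(1) P(1) \<Omega>P, of a] by (cases "a = 0") auto
      then have "M.span (\<Union>a. M.gen W \<Omega> a) \<subseteq> P" by (intro M.span_minimal[OF _ P(1)]) auto
      then have "W \<subseteq> P" using M.gen_span[OF fdW \<Omega>(1)] by blast
      then show False using P(2,3) by blast
    qed
    then have "P \<inter> ?W0 \<noteq> ?W0" by blast
    moreover have "M.dim ?W0 < M.dim W" by (rule M.dim_less[OF fdW sW0 M.gen_subset ne])
    moreover have "r x w = 0" if "inv_lie_algebra.inv_ideal s L br \<sigma> K" "K \<noteq> L" "x \<in> K" "w \<in> ?W0" for K x w
      using less.prems(2)[OF that(1-3)] that(4) M.gen_subset by blast
    moreover have "r x w \<in> P \<inter> ?W0" if "x \<in> L" "w \<in> ?W0" for x w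
      using P(4)[OF that(1)] that rW0 M.gen_subset by blast
    ultimately have "\<exists>w\<in>?W0. w \<notin> P \<inter> ?W0 \<and> (\<forall>x\<in>L. r x w = 0)"
      using less.hyps[of ?W0 "P \<inter> ?W0"] W0.inv_lie_module_axioms M.subspace_inter[OF P(1) sW0] by blast
    then show ?thesis using M.gen_subset by blast
  qed
qed

context inv_lie_module
begin

text \<open>The quotient of \<open>W\<close> by \<open>Q\<close> is modelled on a complement of \<open>Q\<close>, with the projected action.\<close>

theorem invariant_outside_modulo:
  assumes "A.perfect"
    and Q: "M.subspace Q" "\<And>x w. x \<in> L \<Longrightarrow> w \<in> Q \<Longrightarrow> r x w \<in> Q" "\<And>w. w \<in> Q \<Longrightarrow> \<tau> w \<in> Q"
    and ideals: "\<And>K x w. A.inv_ideal K \<Longrightarrow> K \<noteq> L \<Longrightarrow> x \<in> K \<Longrightarrow> w \<in> W \<Longrightarrow> r x w \<in> Q"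
    and P: "M.subspace P" "Q \<subseteq> P" "P \<subseteq> W" "P \<noteq> W" "\<And>x w. x \<in> L \<Longrightarrow> w \<in> W \<Longrightarrow> r x w \<in> P"
  shows "\<exists>w\<in>W. w \<notin> P \<and> (\<forall>x\<in>L. r x w \<in> Q)"
proof -
  have QW: "Q \<subseteq> W" using P by blast
  obtain C \<pi> where C: "M.subspace C" "C \<subseteq> W" "M.lin W C \<pi>"
    and \<pi>: "\<And>v. v \<in> W \<Longrightarrow> v - \<pi> v \<in> Q" "\<And>c. c \<in> C \<Longrightarrow> \<pi> c = c" "\<And>u. u \<in> Q \<Longrightarrow> \<pi> u = 0"
    using M.projection_ex[OF fdW Q(1) QW] by auto
  have CW: "c \<in> W" if "c \<in> C" for c using that C(2) by blast
  note \<pi>l = M.linD[OF C(3)]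
  have \<pi>W: "\<pi> v \<in> W" if "v \<in> W" for v using \<pi>l(1)[OF that] CW by blast
  have \<pi>eq: "\<pi> u = \<pi> v" if "u \<in> W" "v \<in> W" "u - v \<in> Q" for u v
    using \<pi>(3)[OF that(3)] M.lin_diff[OF sW C(3) that(1,2)] by simp
  \<comment> \<open>Replacing a vector by its projection changes it by an element of
    \<open>Q\<close>, which stays in \<open>Q\<close> under the action and is then killed by
    \<open>\<pi>\<close>.\<close>
  have \<pi>r: "\<pi> (r x (\<pi> v)) = \<pi> (r x v)" if "x \<in> L" "v \<in> W" for x v
  proof -
    have "r x v - r x (\<pi> v) \<in> Q" using Q(2)[OF that(1) \<pi>(1)[OF that(2)]] r_diff_right that \<pi>W by simp
    then show ?thesis using \<pi>eq[of "r x v" "r x (\<pi> v)"] r_closed that \<pi>W by simp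
  qed
  have \<pi>\<tau>: "\<pi> (\<tau> (\<pi> v)) = \<pi> (\<tau> v)" if "v \<in> W" for v
  proof -
    have "\<tau> v - \<tau> (\<pi> v) \<in> Q" using Q(3)[OF \<pi>(1)[OF that]] M.lin_diff[OF sW \<tau>_lin] that \<pi>W by simp
    then show ?thesis using \<pi>eq[of "\<tau> v" "\<tau> (\<pi> v)"] \<tau>_closed that \<pi>W by simp
  qed
  interpret C: inv_lie_module s L br \<sigma> t C "\<lambda>x w. \<pi> (r x w)" "\<lambda>w. \<pi> (\<tau> w)"
  proof unfold_locales
    show "M.fd C" by (rule M.fd_subset[OF fdW C(1,2)])
    show "M.lin C C (\<lambda>w. \<pi> (r x w))" if "x \<in> L" for x
      by (rule M.lin_subset[OF M.lin_compose[OF r_lin[OF that] C(3)] C(2)]) (use that CW r_closed \<pi>l(1) in auto)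
    show "\<pi> (r (x + y) w) = \<pi> (r x w) + \<pi> (r y w)" if "x \<in> L" "y \<in> L" "w \<in> C" for x y w
      using that CW by (simp add: r_add \<pi>l r_closed)
    show "\<pi> (r (s c x) w) = t c (\<pi> (r x w))" if "x \<in> L" "w \<in> C" for x c w
      using that CW by (simp add: r_scale \<pi>l r_closed)
    show "\<pi> (r (br x y) w) = \<pi> (r x (\<pi> (r y w))) - \<pi> (r y (\<pi> (r x w)))" if "x \<in> L" "y \<in> L" "w \<in> C" for x y w
      using that CW by (simp add: \<pi>r r_closed r_br M.lin_diff[OF sW C(3)])
    show "M.lin C C (\<lambda>w. \<pi> (\<tau> w))"
      by (rule M.lin_subset[OF M.lin_compose[OF \<tau>_lin C(3)] C(2)]) (use CW \<tau>_closed \<pi>l(1) in auto)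
    show "\<pi> (\<tau> (\<pi> (\<tau> w))) = w" if "w \<in> C" for w
      using that CW by (simp add: \<pi>\<tau> \<tau>_closed \<tau>_inv \<pi>(2))
    show "\<pi> (\<tau> (\<pi> (r x w))) = \<pi> (r (\<sigma> x) (\<pi> (\<tau> w)))" if "x \<in> L" "w \<in> C" for x w
      using that CW by (simp add: \<pi>\<tau> \<pi>r r_closed \<tau>_closed A.\<sigma>_closed \<tau>_r)
  qed
  have \<pi>P: "\<pi> v \<in> P" if "v \<in> P" for v
  proof -
    have "v - (v - \<pi> v) \<in> P" by (rule M.subspace_diff[OF P(1) that subsetD[OF P(2) \<pi>(1)[OF subsetD[OF P(3) that]]]])
    then show ?thesis by simp
  qed
  have "\<exists>w\<in>C. w \<notin> P \<inter> C \<and> (\<forall>x\<in>L. \<pi> (r x w) = 0)"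
  proof (rule invariant_outside[OF C.inv_lie_module_axioms assms(1)])
    show "\<pi> (r x w) = 0" if "A.inv_ideal K" "K \<noteq> L" "x \<in> K" "w \<in> C" for K x w
      by (rule \<pi>(3)[OF ideals[OF that(1-3) CW[OF that(4)]]])
    show "M.subspace (P \<inter> C)" by (rule M.subspace_inter[OF P(1) C(1)])
    show "P \<inter> C \<noteq> C"
    proof
      assume "P \<inter> C = C"
      then have CP: "C \<subseteq> P" by blast
      have "v \<in> P" if "v \<in> W" for v
      proof -
        have "(v - \<pi> v) + \<pi> v \<in> P"
          using \<pi>(1)[OF that] P(2) \<pi>l(1)[OF that] CP by (intro M.subspace_add[OF P(1)]) blast+
        then show ?thesis by simp
      qed
      then show False using P(3,4) by blast
    qed
    show "\<pi> (r x w) \<in> P \<inter> C" if "x \<in> L" "w \<in> C" for x w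
      using \<pi>P[OF P(5)[OF that(1) CW[OF that(2)]]] \<pi>l(1)[OF r_closed[OF that(1) CW[OF that(2)]]] by blast
  qed simp
  then obtain w where w: "w \<in> C" "w \<notin> P" "\<And>x. x \<in> L \<Longrightarrow> \<pi> (r x w) = 0" by blast
  have "r x w \<in> Q" if "x \<in> L" for x using \<pi>(1)[OF r_closed[OF that CW[OF w(1)]]] w(3)[OF that] by simp
  then show ?thesis using w CW by blast
qed

end

section \<open>Spaces of linear maps\<close>

lemma sum_fun_apply: "(\<Sum>i\<in>A. f i) x = (\<Sum>i\<in>A. f i x)" for f :: "'i \<Rightarrow> 'x \<Rightarrow> 'y::comm_monoid_add"
  by (induction A rule: infinite_finite_induct) simp_all

lemma (in ac_space) fun_ac_space: "ac_space (\<lambda>c (f :: 'c \<Rightarrow> 'b) x. scale c (f x))"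
  by unfold_locales (simp_all add: fun_eq_iff scale_right_distrib scale_left_distrib)

context ac_space
begin

text \<open>Extension by zero off \<open>V\<close> gives each linear map exactly one representative,
  so that the pointwise operations are those of the space of maps.\<close>

definition homs :: "'b set \<Rightarrow> 'b set \<Rightarrow> ('b \<Rightarrow> 'b) set"
  where "homs V U = {f. lin V U f \<and> (\<forall>x. x \<notin> V \<longrightarrow> f x = 0)}"

text \<open>The maps \<open>g b u\<close>, a coordinate on \<open>V\<close> times a basis vector of
  \<open>U\<close>, span; the matrix entries of \<open>f\<close> are the coefficients.\<close>

lemma homs_fd:
  assumes "fd V" "fd U"
  shows "lin_space.fd (\<lambda>c (f :: 'b \<Rightarrow> 'b) x. scale c (f x)) (homs V U)"
proof -
  interpret F: ac_space "\<lambda>c (f :: 'b \<Rightarrow> 'b) x. scale c (f x)" by (rule fun_ac_space)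
  note sV = fd_subspace[OF assms(1)] and sU = fd_subspace[OF assms(2)]
  obtain B where "basis_of B V" using basis_of_ex[OF assms(1)] by blast
  note B = basis_ofD[OF this]
  obtain C where "basis_of C U" using basis_of_ex[OF assms(2)] by blast
  note C = basis_ofD[OF this]
  define g where "g b u x = (if x \<in> V then scale (representation B x b) u else 0)" for b u x
  let ?G = "(\<lambda>(b, u). g b u) ` (B \<times> C)"
  have "homs V U \<subseteq> F.span ?G"
  proof
    fix f assume f: "f \<in> homs V U"
    then have lf: "lin V U f" by (simp add: homs_def)
    have "f = (\<Sum>b\<in>B. \<Sum>u\<in>C. (\<lambda>x. scale (representation C (f b) u) (g b u x)))"
    proof
      fix x
      have e: "(\<Sum>b\<in>B. \<Sum>u\<in>C. (\<lambda>x. scale (representation C (f b) u) (g b u x))) x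
        = (\<Sum>b\<in>B. \<Sum>u\<in>C. scale (representation C (f b) u) (g b u x))"
        by (simp add: sum_fun_apply)
      show "f x = (\<Sum>b\<in>B. \<Sum>u\<in>C. (\<lambda>x. scale (representation C (f b) u) (g b u x))) x"
      proof (cases "x \<in> V")
        case False
        then show ?thesis unfolding e using f by (simp add: g_def homs_def)
      next
        case True
        have "f x = f (\<Sum>b\<in>B. scale (representation B x b) b)"
          using sum_representation_eq[OF B(2) _ B(1) subset_refl, of x] True B(3) by simp
        also have "\<dots> = (\<Sum>b\<in>B. f (scale (representation B x b) b))"
          using B(4) by (intro lin_sum[OF sV lf]) (auto intro: subspace_scale[OF sV])
        also have "\<dots> = (\<Sum>b\<in>B. \<Sum>u\<in>C. scale (representation C (f b) u) (g b u x))"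
        proof (rule sum.cong[OF refl])
          fix b assume b: "b \<in> B"
          then have bV: "b \<in> V" using B(4) by auto
          have "f b = (\<Sum>u\<in>C. scale (representation C (f b) u) u)"
            using sum_representation_eq[OF C(2) _ C(1) subset_refl, of "f b"] linD(1)[OF lf bV] C(3) by simp
          then have "scale (representation B x b) (f b)
              = scale (representation B x b) (\<Sum>u\<in>C. scale (representation C (f b) u) u)" by simp
          also have "\<dots> = (\<Sum>u\<in>C. scale (representation C (f b) u) (g b u x))"
            unfolding scale_sum_right using True by (simp add: g_def mult.commute)
          finally show "f (scale (representation B x b) b) = (\<Sum>u\<in>C. scale (representation C (f b) u) (g b u x))"
            using linD(3)[OF lf bV] by simp
        qed
        finally show ?thesis unfolding e .
      qed
    qed
    also have "\<dots> \<in> F.span ?G" by (intro F.span_sum F.span_scale F.span_base) auto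
    finally show "f \<in> F.span ?G" .
  qed
  moreover have "finite ?G" using B(1) C(1) by simp
  moreover have "F.subspace (homs V U)"
    by (rule F.subspaceI)
      (auto simp: homs_def linear_map_on_def subspace_0[OF sU] subspace_add[OF sU] subspace_scale[OF sU]
        scale_right_distrib scale_left_commute add_ac)
  ultimately show ?thesis unfolding F.fd_def by blast
qed

end

section \<open>Equivariant Levi complements\<close>

context inv_lie_algebra
begin

lemma adjoint: "inv_lie_module scale L br \<sigma> scale L br \<sigma>"
proof unfold_locales
  show "br (br x y) w = br x (br y w) - br y (br x w)" if "x \<in> L" "y \<in> L" "w \<in> L" for x y w
    using br_jacobi[OF that] by simp
qed (use fdL br_lin br_add_left br_scale_left \<sigma>_lin \<sigma>_inv \<sigma>_br in auto)

lemma \<sigma>_add: "x \<in> L \<Longrightarrow> y \<in> L \<Longrightarrow> \<sigma> (x + y) = \<sigma> x + \<sigma> y"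
  using linD(2)[OF \<sigma>_lin] .

lemma \<sigma>_scale: "x \<in> L \<Longrightarrow> \<sigma> (scale c x) = scale c (\<sigma> x)"
  using linD(3)[OF \<sigma>_lin] .

lemma \<sigma>_diff: "x \<in> L \<Longrightarrow> y \<in> L \<Longrightarrow> \<sigma> (x - y) = \<sigma> x - \<sigma> y"
  using lin_diff[OF sL \<sigma>_lin] .

definition inv_subalgebra :: "'b set \<Rightarrow> bool"
  where "inv_subalgebra S \<longleftrightarrow> subspace S \<and> S \<subseteq> L \<and> (\<forall>x\<in>S. \<forall>y\<in>S. br x y \<in> S) \<and> (\<forall>x\<in>S. \<sigma> x \<in> S)"

lemma inv_subalgebra_locale:
  assumes "inv_subalgebra S" shows "inv_lie_algebra scale S br \<sigma>"
proof -
  have S: "subspace S" "S \<subseteq> L" "\<And>x y. x \<in> S \<Longrightarrow> y \<in> S \<Longrightarrow> br x y \<in> S" "\<And>x. x \<in> S \<Longrightarrow> \<sigma> x \<in> S"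
    using assms by (auto simp: inv_subalgebra_def)
  interpret S: lie_algebra scale S br by (rule subalgebra[OF S(1-3)])
  show ?thesis
    by unfold_locales (use lin_subset[OF \<sigma>_lin S(2)] S(4) \<sigma>_inv \<sigma>_br subsetD[OF S(2)] in auto)
qed

definition derived :: "'b set \<Rightarrow> 'b set"
  where "derived N = span {br x y | x y. x \<in> N \<and> y \<in> N}"

lemma derived_ideal:
  assumes "inv_ideal N"
  shows "inv_ideal (derived N)" "derived N \<subseteq> N"
proof -
  note N = inv_idealD[OF assms]
  have NL: "x \<in> L" if "x \<in> N" for x using that N(2) by blast
  show sub: "derived N \<subseteq> N"
    unfolding derived_def using NL N(3) by (intro span_minimal[OF _ N(1)]) auto
  have gen: "br x y \<in> derived N" if "x \<in> N" "y \<in> N" for x y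
    unfolding derived_def by (rule span_base) (use that in blast)
  have "derived N \<subseteq> {z \<in> L. (\<forall>y\<in>L. br z y \<in> derived N) \<and> \<sigma> z \<in> derived N}" (is "_ \<subseteq> ?P")
    unfolding derived_def
  proof (rule span_minimal, unfold derived_def[symmetric])
    have d: "subspace (derived N)" by (simp add: derived_def)
    show "subspace ?P"
      by (rule subspaceI) (auto simp: subspace_0[OF sL] subspace_add[OF sL] subspace_scale[OF sL] br_zero_left
        br_add_left br_scale_left \<sigma>_add \<sigma>_scale lin_0[OF sL \<sigma>_lin] subspace_0[OF d] subspace_add[OF d] subspace_scale[OF d])
    show "{br x y | x y. x \<in> N \<and> y \<in> N} \<subseteq> ?P"
    proof clarify
      fix x y assume xy: "x \<in> N" "y \<in> N"
      have xyL: "x \<in> L" "y \<in> L" using xy NL by auto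
      have "br (br x y) z \<in> derived N" if z: "z \<in> L" for z
      proof -
        have "br (br x y) z = br x (br y z) - br y (br x z)" using br_jacobi[OF xyL z] by simp
        then show ?thesis using gen[OF xy(1) N(3)[OF xy(2) z]] gen[OF xy(2) N(3)[OF xy(1) z]]
          subspace_diff[OF d] by simp
      qed
      moreover have "\<sigma> (br x y) \<in> derived N" using gen[OF N(5)[OF xy(1)] N(5)[OF xy(2)]] \<sigma>_br[OF xyL] by simp
      ultimately show "br x y \<in> L \<and> (\<forall>z\<in>L. br (br x y) z \<in> derived N) \<and> \<sigma> (br x y) \<in> derived N"
        using br_closed[OF xyL] by blast
    qed
  qed
  then show "inv_ideal (derived N)"
    unfolding inv_ideal_def by (auto simp: derived_def)
qed

section \<open>Stable ideals consisting of non-generators\<close>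

context
  fixes N
  assumes N: "inv_ideal N"
    and frattini: "\<And>S. inv_subalgebra S \<Longrightarrow> (\<And>x. x \<in> L \<Longrightarrow> \<exists>n\<in>N. x - n \<in> S) \<Longrightarrow> S = L"
begin

lemma NL: "x \<in> N \<Longrightarrow> x \<in> L"
  using inv_idealD(2)[OF N] by blast

lemmas Ns = inv_idealD(1)[OF N] and N_right = inv_idealD(3)[OF N] and N_left = inv_idealD(4)[OF N]
  and N_\<sigma> = inv_idealD(5)[OF N]

text \<open>The Fitting null component of an eigenvector \<open>x\<close> of \<open>\<sigma>\<close> in \<open>N\<close> is a \<open>\<sigma>\<close>-stable subalgebra
  that supplements \<open>N\<close>.\<close>

lemma eigen_ad_nilpotent:
  assumes x: "x \<in> N" "\<sigma> x = scale c x" and y: "y \<in> L"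
  shows "\<exists>n. (br x ^^ n) y = 0"
proof -
  interpret ad: inv_lie_module scale L br \<sigma> scale L br \<sigma> by (rule adjoint)
  have xL: "x \<in> L" by (rule NL[OF x(1)])
  note lx = br_lin[OF xL]
  let ?S = "gen L (br x) 0"
  have pL: "(br x ^^ n) y \<in> L" if "y \<in> L" for n y using linD(1)[OF lin_funpow[OF lx] that] .
  have S: "y \<in> ?S \<longleftrightarrow> y \<in> L \<and> (\<exists>n. (br x ^^ n) y = 0)" for y unfolding gen_def shift_0 by auto
  \<comment> \<open>As \<open>x\<close> is an eigenvector, \<open>\<sigma>\<close> commutes with the
    powers of \<open>ad x\<close> up to a scalar, and so it preserves the null component.\<close>
  have "\<exists>e. (br x ^^ n) (\<sigma> y) = scale e (\<sigma> ((br x ^^ n) y))" if y: "y \<in> L" for y n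
  proof (induction n)
    case 0
    then show ?case by (auto intro: exI[of _ 1])
  next
    case (Suc n)
    then obtain e where e: "(br x ^^ n) (\<sigma> y) = scale e (\<sigma> ((br x ^^ n) y))" by blast
    let ?z = "(br x ^^ n) y"
    have z: "?z \<in> L" by (rule pL[OF y])
    have "br x (\<sigma> ?z) = \<sigma> (br (\<sigma> x) ?z)" using \<sigma>_br[OF \<sigma>_closed[OF xL] z] \<sigma>_inv[OF xL] by simp
    also have "\<dots> = scale c (\<sigma> (br x ?z))" unfolding x(2) using xL z by (simp add: br_scale_left \<sigma>_scale br_closed)
    finally show ?case using e xL z \<sigma>_closed[OF z] by (auto simp: br_scale_right)
  qed
  then have S\<sigma>: "\<sigma> y \<in> ?S" if "y \<in> ?S" for y
    using that \<sigma>_closed lin_0[OF sL \<sigma>_lin] unfolding S by (metis scale_zero_right)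
  have Sbr: "br y z \<in> ?S" if "y \<in> ?S" "z \<in> ?S" for y z using ad.weight_action[OF xL that] by simp
  have "inv_subalgebra ?S"
    unfolding inv_subalgebra_def using S\<sigma> Sbr gen_subspace[OF sL lx] gen_subset by blast
  moreover have "\<exists>n\<in>N. y - n \<in> ?S" if y: "y \<in> L" for y
  proof -
    let ?P = "{y \<in> L. \<exists>n\<in>N. y - n \<in> ?S}"
    note sS = gen_subspace[OF sL lx, of 0]
    have "subspace ?P"
    proof (rule subspaceI)
      show "0 \<in> ?P" using subspace_0[OF sL] subspace_0[OF Ns] subspace_0[OF sS] by force
      fix u v assume "u \<in> ?P" "v \<in> ?P"
      then obtain m n where mn: "u \<in> L" "v \<in> L" "m \<in> N" "n \<in> N" "u - m \<in> ?S" "v - n \<in> ?S" by blast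
      have "(u + v) - (m + n) \<in> ?S" using subspace_add[OF sS mn(5,6)] by (simp add: algebra_simps)
      then show "u + v \<in> ?P" using subspace_add[OF sL mn(1,2)] subspace_add[OF Ns mn(3,4)] by blast
    next
      fix c u assume "u \<in> ?P"
      then obtain m where m: "u \<in> L" "m \<in> N" "u - m \<in> ?S" by blast
      have "scale c u - scale c m \<in> ?S" using subspace_scale[OF sS m(3)] by (simp add: scale_right_diff_distrib)
      then show "scale c u \<in> ?P" using subspace_scale[OF sL m(1)] subspace_scale[OF Ns m(2)] by blast
    qed
    \<comment> \<open>Weight 0 requires no correction; the other weight spaces lie in
      \<open>N\<close>, since \<open>ad x\<close> maps \<open>L\<close> into the ideal
      \<open>N\<close>.\<close>
    moreover have "gen L (br x) a \<subseteq> ?P" for a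
    proof (cases "a = 0")
      case True
      have "y - 0 \<in> ?S" if "y \<in> ?S" for y using that by simp
      then show ?thesis using True subspace_0[OF Ns] gen_subset by blast
    next
      case False
      have "gen L (br x) a \<subseteq> N" by (rule gen_subset_of_range[OF sL lx Ns N_right[OF x(1)] False])
      moreover have "y - y \<in> ?S" for y using subspace_0[OF sS] by simp
      ultimately show ?thesis using NL by blast
    qed
    ultimately have "span (\<Union>a. gen L (br x) a) \<subseteq> ?P" by (intro span_minimal) auto
    then show ?thesis using gen_span[OF fdL lx y] by blast
  qed
  ultimately have "?S = L" by (rule frattini)
  then show ?thesis using S y by blast
qed

text \<open>Ad-nilpotency is available for eigenvectors of \<open>\<sigma>\<close> only, so an
  arbitrary element of \<open>N\<close> is split into its even and odd parts.\<close>

lemma \<sigma>_split: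
  assumes x: "x \<in> N"
  shows "\<exists>p\<in>N. \<exists>m\<in>N. \<sigma> p = scale 1 p \<and> \<sigma> m = scale (-1) m \<and> x = p + m"
proof -
  let ?p = "scale (1/2) (x + \<sigma> x)" and ?m = "scale (1/2) (x - \<sigma> x)"
  have L: "x \<in> L" "\<sigma> x \<in> L" using NL[OF x] \<sigma>_closed by auto
  have p: "?p \<in> N" by (intro subspace_scale[OF Ns] subspace_add[OF Ns] x N_\<sigma>)
  have m: "?m \<in> N" by (intro subspace_scale[OF Ns] subspace_diff[OF Ns] x N_\<sigma>)
  have \<sigma>p: "\<sigma> ?p = scale 1 ?p"
    using L \<sigma>_inv[OF L(1)] add.commute[of x "\<sigma> x"] by (simp add: \<sigma>_scale \<sigma>_add subspace_add[OF sL])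
  have "\<sigma> ?m = scale (1/2) (\<sigma> x - x)"
    using L \<sigma>_inv[OF L(1)] by (simp add: \<sigma>_scale \<sigma>_diff subspace_diff[OF sL] del: scale_right_diff_distrib)
  also have "\<dots> = scale (-1) ?m" by (simp add: scale_right_diff_distrib)
  finally have \<sigma>m: "\<sigma> ?m = scale (-1) ?m" .
  have "x + x = scale 2 x" using scale_left_distrib[of 1 1 x] by simp
  then have "x = ?p + ?m" unfolding scale_right_distrib[symmetric] by simp
  then show ?thesis using p m \<sigma>p \<sigma>m by (intro bexI[of _ ?p] bexI[of _ ?m] conjI)
qed

lemma double_eq_zero: "a + a = (0::'a) \<Longrightarrow> a = 0"
  by (metis mult_2 mult_eq_0_iff zero_neq_numeral)

text \<open>Parts of equal parity are handled by polarization, since their sum is again an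
  eigenvector and hence ad-nilpotent; parts of opposite parity are orthogonal because
  \<open>\<sigma>\<close> preserves the trace form.\<close>

lemma trace_form_N:
  assumes "x \<in> N" "y \<in> N"
  shows "tr L (\<lambda>w. br x (br y w)) = 0"
proof -
  interpret ad: inv_lie_module scale L br \<sigma> scale L br \<sigma> by (rule adjoint)
  have xx: "ad.tf x x = 0" if x: "x \<in> N" "\<sigma> x = scale c x" for x c
  proof -
    have xL: "x \<in> L" by (rule NL[OF x(1)])
    have "\<exists>n. ((\<lambda>w. br x (br x w)) ^^ n) w = 0" if w: "w \<in> L" for w
    proof -
      obtain n where n: "(br x ^^ n) w = 0" using eigen_ad_nilpotent[OF x w] by blast
      have "(br x ^^ (2 * n)) w = 0"
        by (rule funpow_zero_mono[OF n br_zero_right[OF xL]]) simp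
      moreover have "((\<lambda>w. br x (br x w)) ^^ n) w = (br x ^^ (2 * n)) w" by (induction n) simp_all
      ultimately have "((\<lambda>w. br x (br x w)) ^^ n) w = 0" by simp
      then show ?thesis by (intro exI[of _ n])
    qed
    from tr_nil[OF fdL lin_compose[OF br_lin[OF xL] br_lin[OF xL]] this]
    show ?thesis unfolding ad.tf_def .
  qed
  have same: "ad.tf x y = 0" if x: "x \<in> N" "\<sigma> x = scale c x" and y: "y \<in> N" "\<sigma> y = scale c y" for x y c
  proof -
    have L: "x \<in> L" "y \<in> L" by (rule NL[OF x(1)], rule NL[OF y(1)])
    have xyN: "x + y \<in> N" by (rule subspace_add[OF Ns x(1) y(1)])
    have "ad.tf (x + y) (x + y) = 0"
      using xx[OF xyN, of c] \<sigma>_add[OF L] x(2) y(2) by (simp add: scale_right_distrib)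
    moreover have "ad.tf (x + y) (x + y) = (ad.tf x x + ad.tf x y) + (ad.tf y x + ad.tf y y)"
      by (simp only: ad.tf_add_left[OF L subspace_add[OF sL L]] ad.tf_add_right[OF L L(1)] ad.tf_add_right[OF L L(2)])
    ultimately have "ad.tf x y + ad.tf x y = 0"
      by (simp only: xx[OF x] xx[OF y] ad.tf_commute[OF L(2,1)] add_0_left add_0_right)
    then show ?thesis by (rule double_eq_zero)
  qed
  have opp: "ad.tf x y = 0" if x: "x \<in> N" "\<sigma> x = scale 1 x" and y: "y \<in> N" "\<sigma> y = scale (-1) y" for x y
  proof -
    have L: "x \<in> L" "y \<in> L" by (rule NL[OF x(1)], rule NL[OF y(1)])
    have "ad.tf x y = ad.tf x (scale (-1) y)" using ad.tf_\<sigma>[OF L] x(2) y(2) by simp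
    also have "\<dots> = - ad.tf x y" using ad.tf_scale_right[OF L(2,1), of "-1"] by simp
    finally have "ad.tf x y + ad.tf x y = 0" by (simp only: eq_neg_iff_add_eq_0)
    then show ?thesis by (rule double_eq_zero)
  qed
  obtain p m where x: "p \<in> N" "m \<in> N" "\<sigma> p = scale 1 p" "\<sigma> m = scale (-1) m" "x = p + m" using \<sigma>_split[OF assms(1)] by (elim bexE conjE)
  obtain q l where y: "q \<in> N" "l \<in> N" "\<sigma> q = scale 1 q" "\<sigma> l = scale (-1) l" "y = q + l" using \<sigma>_split[OF assms(2)] by (elim bexE conjE)
  have L: "p \<in> L" "m \<in> L" "q \<in> L" "l \<in> L" using x(1,2) y(1,2) NL by auto
  have "ad.tf p q = 0" "ad.tf m l = 0" "ad.tf p l = 0" "ad.tf m q = 0"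
    using same[OF x(1,3) y(1,3)] same[OF x(2,4) y(2,4)] opp[OF x(1,3) y(2,4)] opp[OF y(1,3) x(2,4)]
      ad.tf_commute[OF L(2,3)] by simp_all
  then have "ad.tf x y = 0"
    unfolding x(5) y(5) using L by (simp add: ad.tf_add_left ad.tf_add_right subspace_add[OF sL])
  then show ?thesis unfolding ad.tf_def .
qed

text \<open>For perfect \<open>N\<close>, Cartan's criterion applied to the adjoint module
  restricted to \<open>N\<close> makes \<open>N\<close> act by zero on \<open>L\<close>, so that
  \<open>[N, N] = 0\<close>.\<close>

lemma ideal_not_perfect:
  assumes "derived N = N"
  shows "N = {0}"
proof -
  interpret ad: inv_lie_module scale L br \<sigma> scale L br \<sigma> by (rule adjoint)
  interpret NM: lie_module scale N br scale L br
    by (rule ad.restrict_algebra[OF Ns]) (use NL N_right in auto)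
  have perf: "NM.A.perfect" using assms unfolding NM.A.perfect_def derived_def .
  have "br x w = 0" if "x \<in> N" "w \<in> L" for x w
    by (rule NM.perfect_trace_form_zero_trivial[OF perf _ that]) (simp add: NM.tf_def trace_form_N)
  then have "br x y \<in> {0}" if "x \<in> N" "y \<in> N" for x y using that NL by simp
  then have "derived N \<subseteq> {0}" unfolding derived_def by (intro span_minimal) auto
  then show ?thesis using assms subspace_0[OF Ns] by auto
qed

text \<open>\<open>hom_mod / hom_inner\<close> is a module of \<open>L\<close> on which \<open>N\<close> acts trivially.  An element of \<open>hom_mod\<close> outside
  \<open>hom_zero\<close> that is invariant modulo \<open>hom_inner\<close> splits the extension \<open>L\<close> of \<open>L / N\<close> modulo \<open>derived N\<close>.\<close>

definition hom_mod :: "('b \<Rightarrow> 'b) set"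
  where "hom_mod = {f \<in> homs L N. \<exists>c. \<forall>n\<in>N. f n - scale c n \<in> derived N}"

definition hom_zero :: "('b \<Rightarrow> 'b) set"
  where "hom_zero = {f \<in> homs L N. \<forall>n\<in>N. f n \<in> derived N}"

text \<open>Factoring out these maps makes \<open>N\<close> act trivially: modulo
  \<open>derived N\<close>, an element \<open>x\<close> of \<open>N\<close> moves a map with scalar
  \<open>c\<close> by \<open>- c\<close> times the inner map \<open>br x\<close>.\<close>

definition hom_inner :: "('b \<Rightarrow> 'b) set"
  where "hom_inner = {f \<in> homs L N. \<exists>n\<in>N. \<forall>x\<in>L. f x - br n x \<in> derived N}"

definition hact :: "'b \<Rightarrow> ('b \<Rightarrow> 'b) \<Rightarrow> 'b \<Rightarrow> 'b"
  where "hact x f = (\<lambda>y. if y \<in> L then br x (f y) - f (br x y) else 0)"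

definition htwist :: "('b \<Rightarrow> 'b) \<Rightarrow> 'b \<Rightarrow> 'b"
  where "htwist f = (\<lambda>y. if y \<in> L then \<sigma> (f (\<sigma> y)) else 0)"

lemmas dN = derived_ideal(1)[OF N]
lemmas dNs = inv_idealD(1)[OF dN] and dN_left = inv_idealD(4)[OF dN] and dN_\<sigma> = inv_idealD(5)[OF dN]

lemma dN_N: "x \<in> derived N \<Longrightarrow> x \<in> N"
  using derived_ideal(2)[OF N] by blast

lemma dN_gen: "x \<in> N \<Longrightarrow> y \<in> N \<Longrightarrow> br x y \<in> derived N"
  unfolding derived_def by (rule span_base) blast

lemma homsD:
  assumes "f \<in> homs L N"
  shows "lin L N f" "x \<in> L \<Longrightarrow> f x \<in> N" "x \<in> L \<Longrightarrow> f x \<in> L" "x \<notin> L \<Longrightarrow> f x = 0"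
    "x \<in> L \<Longrightarrow> y \<in> L \<Longrightarrow> f (x + y) = f x + f y" "x \<in> L \<Longrightarrow> f (scale c x) = scale c (f x)"
    "x \<in> L \<Longrightarrow> y \<in> L \<Longrightarrow> f (x - y) = f x - f y"
proof -
  show l: "lin L N f" and "x \<notin> L \<Longrightarrow> f x = 0" using assms by (auto simp: homs_def)
  show "x \<in> L \<Longrightarrow> f x \<in> N" "x \<in> L \<Longrightarrow> f x \<in> L" using linD(1)[OF l] NL by auto
  show "x \<in> L \<Longrightarrow> y \<in> L \<Longrightarrow> f (x + y) = f x + f y" "x \<in> L \<Longrightarrow> f (scale c x) = scale c (f x)"
    using linD(2,3)[OF l] by auto
  show "x \<in> L \<Longrightarrow> y \<in> L \<Longrightarrow> f (x - y) = f x - f y" using lin_diff[OF sL l] .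
qed

lemma homsI: "lin L N f \<Longrightarrow> (\<And>x. x \<notin> L \<Longrightarrow> f x = 0) \<Longrightarrow> f \<in> homs L N"
  by (simp add: homs_def)

lemma hact_homs: assumes x: "x \<in> L" and f: "f \<in> homs L N" shows "hact x f \<in> homs L N"
proof (rule homsI)
  note fD = homsD[OF f]
  show "lin L N (hact x f)"
  proof (rule linI)
    show "hact x f y \<in> N" if "y \<in> L" for y
      using that x fD(2)[OF that] fD(2)[OF br_closed[OF x that]] by (simp add: hact_def N_left subspace_diff[OF Ns])
    show "hact x f (y + z) = hact x f y + hact x f z" if "y \<in> L" "z \<in> L" for y z
      using that x by (simp add: hact_def subspace_add[OF sL] br_add_right fD br_closed)
    show "hact x f (scale c y) = scale c (hact x f y)" if "y \<in> L" for c y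
      using that x by (simp add: hact_def subspace_scale[OF sL] br_scale_right fD br_closed scale_right_diff_distrib)
  qed
  show "hact x f y = 0" if "y \<notin> L" for y using that by (simp add: hact_def)
qed

lemma htwist_homs: assumes f: "f \<in> homs L N" shows "htwist f \<in> homs L N"
proof (rule homsI)
  note fD = homsD[OF f]
  show "lin L N (htwist f)"
  proof (rule linI)
    show "htwist f y \<in> N" if "y \<in> L" for y
      using that fD(2)[OF \<sigma>_closed[OF that]] by (simp add: htwist_def N_\<sigma>)
    show "htwist f (y + z) = htwist f y + htwist f z" if "y \<in> L" "z \<in> L" for y z
      using that by (simp add: htwist_def subspace_add[OF sL] fD \<sigma>_closed \<sigma>_add)
    show "htwist f (scale c y) = scale c (htwist f y)" if "y \<in> L" for c y
      using that by (simp add: htwist_def subspace_scale[OF sL] fD \<sigma>_closed \<sigma>_scale)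
  qed
  show "htwist f y = 0" if "y \<notin> L" for y using that by (simp add: htwist_def)
qed

text \<open>A scalar commutes with \<open>ad x\<close>, so the scalar part of \<open>f\<close> on
  \<open>N\<close> cancels. This is the range condition under which an invariant outside
  \<open>hom_zero\<close> can be found.\<close>

lemma hact_hom_zero: assumes x: "x \<in> L" and f: "f \<in> hom_mod" shows "hact x f \<in> hom_zero"
proof -
  have fh: "f \<in> homs L N" using f by (simp add: hom_mod_def)
  note fD = homsD[OF fh]
  obtain c where c: "\<And>n. n \<in> N \<Longrightarrow> f n - scale c n \<in> derived N" using f by (auto simp: hom_mod_def)
  have "hact x f n \<in> derived N" if n: "n \<in> N" for n
  proof -
    have nL: "n \<in> L" by (rule NL[OF n])
    have "hact x f n = br x (f n - scale c n) - (f (br x n) - scale c (br x n))"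
      using nL x by (simp add: hact_def br_diff_right fD subspace_scale[OF sL] br_scale_right)
    then show ?thesis
      using dN_left[OF c[OF n] x] c[OF N_left[OF n x]] subspace_diff[OF dNs] by simp
  qed
  then show ?thesis using hact_homs[OF x fh] by (simp add: hom_zero_def)
qed

lemma hom_zero_mod: "hom_zero \<subseteq> hom_mod"
  unfolding hom_zero_def hom_mod_def by (auto intro!: exI[of _ 0])

lemma hom_inner_zero: "hom_inner \<subseteq> hom_zero"
proof
  fix f assume "f \<in> hom_inner"
  then obtain n where f: "f \<in> homs L N" "n \<in> N" "\<And>x. x \<in> L \<Longrightarrow> f x - br n x \<in> derived N" by (auto simp: hom_inner_def)
  have "f m \<in> derived N" if m: "m \<in> N" for m
    using subspace_add[OF dNs f(3)[OF NL[OF m]] dN_gen[OF f(2) m]] by simp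
  then show "f \<in> hom_zero" using f(1) by (simp add: hom_zero_def)
qed

text \<open>By the Jacobi identity the action carries \<open>br n\<close> to
  \<open>br (br x n)\<close>.\<close>

lemma hact_hom_inner: assumes x: "x \<in> L" and f: "f \<in> hom_inner" shows "hact x f \<in> hom_inner"
proof -
  obtain n where fh: "f \<in> homs L N" and n: "n \<in> N" "\<And>x. x \<in> L \<Longrightarrow> f x - br n x \<in> derived N"
    using f by (auto simp: hom_inner_def)
  note fD = homsD[OF fh]
  have nL: "n \<in> L" by (rule NL[OF n(1)])
  have "hact x f y - br (br x n) y \<in> derived N" if y: "y \<in> L" for y
  proof -
    have "hact x f y - br (br x n) y = br x (f y - br n y) - (f (br x y) - br n (br x y))"
      using y x nL br_jacobi[OF x nL y] by (simp add: hact_def br_diff_right fD br_closed)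
    then show ?thesis
      using dN_left[OF n(2)[OF y] x] n(2)[OF br_closed[OF x y]] subspace_diff[OF dNs] by simp
  qed
  then show ?thesis using hact_homs[OF x fh] N_left[OF n(1) x] by (auto simp: hom_inner_def)
qed

lemma htwist_hom_mod: assumes f: "f \<in> hom_mod" shows "htwist f \<in> hom_mod"
proof -
  have fh: "f \<in> homs L N" using f by (simp add: hom_mod_def)
  note fD = homsD[OF fh]
  obtain c where c: "\<And>n. n \<in> N \<Longrightarrow> f n - scale c n \<in> derived N" using f by (auto simp: hom_mod_def)
  have "htwist f n - scale c n \<in> derived N" if n: "n \<in> N" for n
  proof -
    have nL: "n \<in> L" by (rule NL[OF n])
    have "htwist f n - scale c n = \<sigma> (f (\<sigma> n) - scale c (\<sigma> n))"
      using nL by (simp add: htwist_def \<sigma>_diff fD \<sigma>_closed subspace_scale[OF sL] \<sigma>_scale \<sigma>_inv)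
    then show ?thesis using dN_\<sigma>[OF c[OF N_\<sigma>[OF n]]] by simp
  qed
  then show ?thesis using htwist_homs[OF fh] by (auto simp: hom_mod_def)
qed

lemma htwist_hom_inner: assumes f: "f \<in> hom_inner" shows "htwist f \<in> hom_inner"
proof -
  obtain n where fh: "f \<in> homs L N" and n: "n \<in> N" "\<And>x. x \<in> L \<Longrightarrow> f x - br n x \<in> derived N"
    using f by (auto simp: hom_inner_def)
  note fD = homsD[OF fh]
  have nL: "n \<in> L" by (rule NL[OF n(1)])
  have "htwist f y - br (\<sigma> n) y \<in> derived N" if y: "y \<in> L" for y
  proof -
    have "htwist f y - br (\<sigma> n) y = \<sigma> (f (\<sigma> y) - br n (\<sigma> y))"
      using y nL by (simp add: htwist_def \<sigma>_diff fD \<sigma>_closed br_closed \<sigma>_br \<sigma>_inv)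
    then show ?thesis using dN_\<sigma>[OF n(2)[OF \<sigma>_closed[OF y]]] by simp
  qed
  then show ?thesis using htwist_homs[OF fh] N_\<sigma>[OF n(1)] by (auto simp: hom_inner_def)
qed

abbreviation fscale :: "'a \<Rightarrow> ('b \<Rightarrow> 'b) \<Rightarrow> 'b \<Rightarrow> 'b"
  where "fscale \<equiv> \<lambda>c f x. scale c (f x)"

lemma homs_add: "f \<in> homs L N \<Longrightarrow> g \<in> homs L N \<Longrightarrow> f + g \<in> homs L N"
  using lin_add[OF Ns, of L f g] by (simp add: homs_def plus_fun_def)

lemma homs_scale: "f \<in> homs L N \<Longrightarrow> fscale c f \<in> homs L N"
  using lin_scale[OF Ns, of L f c] by (simp add: homs_def)

lemma homs_zero: "0 \<in> homs L N"
  using subspace_0[OF Ns] by (simp add: homs_def linear_map_on_def)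

lemma hom_mod_subspace: "module.subspace fscale hom_mod"
proof -
  interpret F: ac_space fscale by (rule fun_ac_space)
  show ?thesis
  proof (rule F.subspaceI)
    show "0 \<in> hom_mod" using homs_zero subspace_0[OF dNs] by (auto simp: hom_mod_def intro!: exI[of _ 0])
    fix f g assume "f \<in> hom_mod" "g \<in> hom_mod"
    then obtain c d where h: "f \<in> homs L N" "g \<in> homs L N"
      and c: "\<And>n. n \<in> N \<Longrightarrow> f n - scale c n \<in> derived N" and d: "\<And>n. n \<in> N \<Longrightarrow> g n - scale d n \<in> derived N"
      by (auto simp: hom_mod_def)
    have "(f + g) n - scale (c + d) n \<in> derived N" if "n \<in> N" for n
      using subspace_add[OF dNs c[OF that] d[OF that]] by (simp add: scale_left_distrib algebra_simps)
    then show "f + g \<in> hom_mod" using homs_add[OF h] by (auto simp: hom_mod_def)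
  next
    fix k f assume "f \<in> hom_mod"
    then obtain c where h: "f \<in> homs L N" and c: "\<And>n. n \<in> N \<Longrightarrow> f n - scale c n \<in> derived N"
      by (auto simp: hom_mod_def)
    have "scale k (f n) - scale (k * c) n \<in> derived N" if "n \<in> N" for n
      using subspace_scale[OF dNs c[OF that], of k] by (simp add: scale_right_diff_distrib)
    then show "fscale k f \<in> hom_mod" using homs_scale[OF h] by (auto simp: hom_mod_def)
  qed
qed

lemma hom_zero_subspace: "module.subspace fscale hom_zero"
proof -
  interpret F: ac_space fscale by (rule fun_ac_space)
  show ?thesis
    by (rule F.subspaceI)
      (auto simp: hom_zero_def homs_zero homs_add homs_scale subspace_0[OF dNs] subspace_add[OF dNs] subspace_scale[OF dNs])
qed

lemma hom_inner_subspace: "module.subspace fscale hom_inner"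
proof -
  interpret F: ac_space fscale by (rule fun_ac_space)
  show ?thesis
  proof (rule F.subspaceI)
    show "0 \<in> hom_inner"
      using homs_zero subspace_0[OF dNs] subspace_0[OF Ns] by (auto simp: hom_inner_def br_zero_left intro!: bexI[of _ 0])
    fix f g assume "f \<in> hom_inner" "g \<in> hom_inner"
    then obtain m n where h: "f \<in> homs L N" "g \<in> homs L N" and mn: "m \<in> N" "n \<in> N"
      and c: "\<And>x. x \<in> L \<Longrightarrow> f x - br m x \<in> derived N" and d: "\<And>x. x \<in> L \<Longrightarrow> g x - br n x \<in> derived N"
      by (auto simp: hom_inner_def)
    have "(f + g) x - br (m + n) x \<in> derived N" if "x \<in> L" for x
      using subspace_add[OF dNs c[OF that] d[OF that]] that mn NL by (simp add: br_add_left algebra_simps)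
    then show "f + g \<in> hom_inner" using homs_add[OF h] subspace_add[OF Ns mn] by (auto simp: hom_inner_def)
  next
    fix k f assume "f \<in> hom_inner"
    then obtain m where h: "f \<in> homs L N" and m: "m \<in> N" and c: "\<And>x. x \<in> L \<Longrightarrow> f x - br m x \<in> derived N"
      by (auto simp: hom_inner_def)
    have "scale k (f x) - br (scale k m) x \<in> derived N" if "x \<in> L" for x
      using subspace_scale[OF dNs c[OF that], of k] that m NL by (simp add: br_scale_left scale_right_diff_distrib)
    then show "fscale k f \<in> hom_inner" using homs_scale[OF h] subspace_scale[OF Ns m] by (auto simp: hom_inner_def)
  qed
qed

lemma hom_mod_homs: "f \<in> hom_mod \<Longrightarrow> f \<in> homs L N"
  by (simp add: hom_mod_def)

lemma hom_module: "inv_lie_module scale L br \<sigma> fscale hom_mod hact htwist"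
proof -
  interpret F: ac_space fscale by (rule fun_ac_space)
  have fdN: "fd N" by (rule fd_subset[OF fdL Ns]) (use NL in blast)
  show ?thesis
  proof unfold_locales
    show "F.fd hom_mod"
      by (rule F.fd_subset[OF homs_fd[OF fdL fdN] hom_mod_subspace]) (auto simp: hom_mod_def)
    show "F.lin hom_mod hom_mod (hact x)" if x: "x \<in> L" for x
    proof (rule F.linI)
      show "hact x f \<in> hom_mod" if "f \<in> hom_mod" for f using hact_hom_zero[OF x that] hom_zero_mod by blast
      show "hact x (f + g) = hact x f + hact x g" if "f \<in> hom_mod" "g \<in> hom_mod" for f g
        using homsD(3)[OF hom_mod_homs[OF that(1)]] homsD(3)[OF hom_mod_homs[OF that(2)]] x
        by (simp add: hact_def fun_eq_iff br_add_right)
      show "hact x (fscale c f) = fscale c (hact x f)" if "f \<in> hom_mod" for c f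
        using homsD(3)[OF hom_mod_homs[OF that]] x
        by (simp add: hact_def fun_eq_iff br_scale_right scale_right_diff_distrib)
    qed
    show "hact (x + y) f = hact x f + hact y f" if "x \<in> L" "y \<in> L" "f \<in> hom_mod" for x y f
      using homsD(3,5)[OF hom_mod_homs[OF that(3)]] that(1,2)
      by (simp add: hact_def fun_eq_iff br_add_left br_closed)
    show "hact (scale c x) f = fscale c (hact x f)" if "x \<in> L" "f \<in> hom_mod" for c x f
      using homsD(3,6)[OF hom_mod_homs[OF that(2)]] that(1)
      by (simp add: hact_def fun_eq_iff br_scale_left br_closed scale_right_diff_distrib)
    show "hact (br x y) f = hact x (hact y f) - hact y (hact x f)" if "x \<in> L" "y \<in> L" "f \<in> hom_mod" for x y f
    proof
      fix z
      note fD = homsD[OF hom_mod_homs[OF that(3)]]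
      show "hact (br x y) f z = (hact x (hact y f) - hact y (hact x f)) z"
      proof (cases "z \<in> L")
        case True
        have "br (br x y) (f z) = br x (br y (f z)) - br y (br x (f z))"
          using br_jacobi[OF that(1,2) fD(3)[OF True]] by simp
        moreover have "br (br x y) z = br x (br y z) - br y (br x z)" using br_jacobi[OF that(1,2) True] by simp
        ultimately show ?thesis using True that(1,2)
          by (simp add: hact_def br_closed br_diff_right fD(3) fD(7))
      qed (simp add: hact_def)
    qed
    show "F.lin hom_mod hom_mod htwist"
    proof (rule F.linI)
      show "htwist (f + g) = htwist f + htwist g" if "f \<in> hom_mod" "g \<in> hom_mod" for f g
        using homsD(3)[OF hom_mod_homs[OF that(1)]] homsD(3)[OF hom_mod_homs[OF that(2)]]
        by (simp add: htwist_def fun_eq_iff \<sigma>_add \<sigma>_closed)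
      show "htwist (fscale c f) = fscale c (htwist f)" if "f \<in> hom_mod" for c f
        using homsD(3)[OF hom_mod_homs[OF that]] by (simp add: htwist_def fun_eq_iff \<sigma>_scale \<sigma>_closed)
    qed (rule htwist_hom_mod)
    show "htwist (htwist f) = f" if "f \<in> hom_mod" for f
      using homsD(3,4)[OF hom_mod_homs[OF that]] by (auto simp: htwist_def fun_eq_iff \<sigma>_closed \<sigma>_inv)
    show "htwist (hact x f) = hact (\<sigma> x) (htwist f)" if "x \<in> L" "f \<in> hom_mod" for x f
      using homsD(3)[OF hom_mod_homs[OF that(2)]] that(1)
      by (simp add: htwist_def hact_def fun_eq_iff \<sigma>_closed \<sigma>_inv \<sigma>_diff \<sigma>_br br_closed)
  qed
qed

text \<open>Of the two terms of \<open>hact x f y\<close>, the first is a bracket of elements of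
  \<open>N\<close>, and the second is \<open>c\<close> times \<open>br x y\<close> modulo
  \<open>derived N\<close>.\<close>

lemma hact_N:
  assumes "x \<in> N" "f \<in> homs L N" "\<And>n. n \<in> N \<Longrightarrow> f n - scale c n \<in> derived N" "y \<in> L"
  shows "hact x f y + scale c (br x y) \<in> derived N"
proof -
  have eq: "hact x f y + scale c (br x y) = br x (f y) - (f (br x y) - scale c (br x y))"
    using assms(4) by (simp add: hact_def)
  show ?thesis
    unfolding eq
    by (rule subspace_diff[OF dNs dN_gen[OF assms(1) homsD(2)[OF assms(2,4)]] assms(3)[OF N_right[OF assms(1,4)]]])
qed

lemma hact_N_inner: assumes x: "x \<in> N" and f: "f \<in> hom_mod" shows "hact x f \<in> hom_inner"
proof -
  obtain c where c: "\<And>n. n \<in> N \<Longrightarrow> f n - scale c n \<in> derived N" using f by (auto simp: hom_mod_def)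
  have "hact x f y - br (scale (- c) x) y \<in> derived N" if "y \<in> L" for y
    using hact_N[OF x hom_mod_homs[OF f] c that] br_scale_left[OF NL[OF x] that, of "-c"] by simp
  then show ?thesis
    using hact_homs[OF NL[OF x] hom_mod_homs[OF f]] subspace_scale[OF Ns x, of "-c"] by (auto simp: hom_inner_def)
qed

text \<open>A linear projection of \<open>L\<close> onto \<open>N\<close> is the identity on
  \<open>N\<close>, hence has scalar 1, and cannot vanish on \<open>N\<close> modulo
  \<open>derived N\<close>.\<close>

lemma hom_mod_section:
  assumes "derived N \<noteq> N"
  shows "\<exists>f\<in>hom_mod. f \<notin> hom_zero"
proof -
  have NsL: "N \<subseteq> L" using NL by blast
  from projection_ex[OF fdL Ns NsL] obtain C \<pi> where C: "subspace C \<and> C \<subseteq> L \<and> lin L C \<pi> \<and> (\<forall>v\<in>L. v - \<pi> v \<in> N)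
    \<and> (\<forall>c\<in>C. \<pi> c = c) \<and> (\<forall>u\<in>N. \<pi> u = 0)" by (elim exE)
  then have \<pi>: "lin L C \<pi>" "\<And>v. v \<in> L \<Longrightarrow> v - \<pi> v \<in> N" "\<And>n. n \<in> N \<Longrightarrow> \<pi> n = 0" by auto
  define f where "f v = (if v \<in> L then v - \<pi> v else 0)" for v
  have "f \<in> homs L N"
  proof (rule homsI)
    show "lin L N f"
      by (rule linI) (use \<pi>(2) in \<open>auto simp: f_def subspace_add[OF sL] subspace_scale[OF sL] linD(2,3)[OF \<pi>(1)] scale_right_diff_distrib\<close>)
  qed (simp add: f_def)
  moreover have fn: "f n = n" if "n \<in> N" for n using that NL \<pi>(3) by (simp add: f_def)
  moreover have "f n - scale 1 n \<in> derived N" if "n \<in> N" for n using fn[OF that] subspace_0[OF dNs] by simp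
  ultimately have "f \<in> hom_mod" unfolding hom_mod_def by blast
  moreover obtain n where "n \<in> N" "n \<notin> derived N" using assms dN_N by blast
  ultimately show ?thesis using fn by (auto simp: hom_zero_def intro!: bexI[of _ f])
qed

text \<open>The submodules \<open>hom_inner\<close> and \<open>hom_zero\<close> take the places of
  \<open>Q\<close> and \<open>P\<close> in \<open>invariant_outside_modulo\<close>. Lying outside
  \<open>hom_zero\<close> means having a nonzero scalar, so the invariant can be normalized;
  averaging over the involution makes it commute with \<open>\<sigma>\<close>.\<close>

lemma equivariant_section:
  assumes perf: perfect and ideals: "\<And>K. inv_ideal K \<Longrightarrow> K \<noteq> L \<Longrightarrow> K \<subseteq> N" and ne: "derived N \<noteq> N"
  shows "\<exists>g\<in>homs L N. (\<forall>n\<in>N. g n - n \<in> derived N) \<and> (\<forall>y\<in>L. \<sigma> (g y) = g (\<sigma> y))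
    \<and> (\<forall>x\<in>L. hact x g \<in> hom_inner)"
proof -
  interpret F: inv_lie_module scale L br \<sigma> fscale hom_mod hact htwist by (rule hom_module)
  have "\<exists>f\<in>hom_mod. f \<notin> hom_zero \<and> (\<forall>x\<in>L. hact x f \<in> hom_inner)"
  proof (rule F.invariant_outside_modulo[OF perf hom_inner_subspace hact_hom_inner htwist_hom_inner _
        hom_zero_subspace hom_inner_zero hom_zero_mod _ hact_hom_zero])
    show "hact x f \<in> hom_inner" if "inv_ideal K" "K \<noteq> L" "x \<in> K" "f \<in> hom_mod" for K x f
      using hact_N_inner[OF subsetD[OF ideals[OF that(1,2)] that(3)] that(4)] .
    show "hom_zero \<noteq> hom_mod" using hom_mod_section[OF ne] by blast
  qed
  then obtain f where f: "f \<in> hom_mod" "f \<notin> hom_zero" "\<And>x. x \<in> L \<Longrightarrow> hact x f \<in> hom_inner" by blast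
  obtain c where c: "\<And>n. n \<in> N \<Longrightarrow> f n - scale c n \<in> derived N" using f(1) by (auto simp: hom_mod_def)
  have c0: "c \<noteq> 0" using c f(1,2) by (auto simp: hom_zero_def hom_mod_def)
  \<comment> \<open>Both \<open>f\<close> and \<open>htwist f\<close> have the scalar
    \<open>c\<close> on \<open>N\<close>, so their sum has the scalar \<open>2 * c\<close>.\<close>
  define k where "k = 1 / (2 * c)"
  define g where "g = fscale k (f + htwist f)"
  note tf = htwist_hom_mod[OF f(1)]
  have fD: "f x \<in> L" if "x \<in> L" for x using homsD(3)[OF hom_mod_homs[OF f(1)] that] .
  have gH: "g \<in> homs L N" unfolding g_def by (rule homs_scale[OF homs_add[OF hom_mod_homs[OF f(1)] hom_mod_homs[OF tf]]])
  moreover have "g n - n \<in> derived N" if n: "n \<in> N" for n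
  proof -
    have nL: "n \<in> L" by (rule NL[OF n])
    have t: "htwist f n - scale c n = \<sigma> (f (\<sigma> n) - scale c (\<sigma> n))"
      using nL by (simp add: htwist_def \<sigma>_diff fD \<sigma>_closed subspace_scale[OF sL] \<sigma>_scale \<sigma>_inv)
    have "scale k (scale c n + scale c n) = n"
      unfolding scale_left_distrib[symmetric] scale_scale using c0 by (simp add: k_def mult_2[symmetric])
    then have "g n - n = scale k ((f n - scale c n) + (htwist f n - scale c n))"
      by (simp add: g_def scale_right_distrib scale_right_diff_distrib algebra_simps)
    then show ?thesis
      using dN_\<sigma>[OF c[OF N_\<sigma>[OF n]]] c[OF n] by (simp add: t subspace_scale[OF dNs] subspace_add[OF dNs])
  qed
  moreover have "\<sigma> (g y) = g (\<sigma> y)" if y: "y \<in> L" for y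
    using y by (simp add: g_def htwist_def \<sigma>_scale \<sigma>_add \<sigma>_closed fD \<sigma>_inv subspace_add[OF sL] add.commute)
  moreover have "hact x g \<in> hom_inner" if x: "x \<in> L" for x
  proof -
    have "hact x (htwist f) = htwist (hact (\<sigma> x) f)"
      using F.\<tau>_r[OF \<sigma>_closed[OF x] f(1)] \<sigma>_inv[OF x] by simp
    then have "hact x (htwist f) \<in> hom_inner" using htwist_hom_inner[OF f(3)[OF \<sigma>_closed[OF x]]] by simp
    then show ?thesis
      unfolding g_def F.r_scale_right[OF x F.M.subspace_add[OF F.sW f(1) tf]] F.r_add_right[OF x f(1) tf]
      using f(3)[OF x] by (intro F.M.subspace_scale[OF hom_inner_subspace] F.M.subspace_add[OF hom_inner_subspace])
  qed
  ultimately show ?thesis by blast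
qed

text \<open>The hypothesis on supplements is used twice, always modulo \<open>derived N\<close>. For
  the annihilator of \<open>g\<close> under the action it makes \<open>g\<close> equivariant under
  all of \<open>L\<close>; for the kernel of \<open>g\<close>, a subalgebra by this equivariance, it
  makes \<open>g\<close> zero, although \<open>g\<close> is the identity on
  \<open>N\<close>.\<close>

lemma frattini_ideal_perfect:
  assumes perf: perfect and ideals: "\<And>K. inv_ideal K \<Longrightarrow> K \<noteq> L \<Longrightarrow> K \<subseteq> N"
  shows "derived N = N"
proof (rule ccontr)
  assume ne: "derived N \<noteq> N"
  interpret F: inv_lie_module scale L br \<sigma> fscale hom_mod hact htwist by (rule hom_module)
  obtain g where gH: "g \<in> homs L N" and gn: "\<And>n. n \<in> N \<Longrightarrow> g n - n \<in> derived N"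
    and g\<sigma>: "\<And>y. y \<in> L \<Longrightarrow> \<sigma> (g y) = g (\<sigma> y)" and ginner: "\<And>x. x \<in> L \<Longrightarrow> hact x g \<in> hom_inner"
    using equivariant_section[OF perf ideals ne] by blast
  note gD = homsD[OF gH]
  have gn1: "\<And>n. n \<in> N \<Longrightarrow> g n - scale 1 n \<in> derived N" using gn by simp
  then have gM: "g \<in> hom_mod" using gH unfolding hom_mod_def by blast
  have g_tw: "htwist g = g" using gD(4) by (auto simp: htwist_def fun_eq_iff g\<sigma> \<sigma>_closed \<sigma>_inv)
  let ?S = "{x \<in> L. \<forall>y\<in>L. hact x g y \<in> derived N}"
  have "?S = L"
  proof (rule frattini)
    show "inv_subalgebra ?S"
      unfolding inv_subalgebra_def
    proof (intro conjI ballI)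
      show "subspace ?S"
        by (rule subspaceI) (auto simp: subspace_0[OF sL] subspace_add[OF sL] subspace_scale[OF sL] F.r_zero[OF gM]
          F.r_add[OF _ _ gM] F.r_scale[OF _ gM] subspace_0[OF dNs] subspace_add[OF dNs] subspace_scale[OF dNs])
      show "?S \<subseteq> L" by blast
      show "br x y \<in> ?S" if "x \<in> ?S" "y \<in> ?S" for x y
      proof -
        have xy: "x \<in> L" "y \<in> L" using that by auto
        have "hact (br x y) g z \<in> derived N" if z: "z \<in> L" for z
        proof -
          have "hact (br x y) g z = (br x (hact y g z) - hact y g (br x z)) - (br y (hact x g z) - hact x g (br y z))"
            unfolding F.r_br[OF xy gM] using z by (simp add: hact_def[of x "hact y g"] hact_def[of y "hact x g"])
          also have "\<dots> \<in> derived N"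
            using \<open>x \<in> ?S\<close> \<open>y \<in> ?S\<close> z xy by (intro subspace_diff[OF dNs] dN_left) (auto simp: br_closed)
          finally show ?thesis .
        qed
        then show ?thesis using br_closed[OF xy] by blast
      qed
      show "\<sigma> x \<in> ?S" if x: "x \<in> ?S" for x
      proof -
        have xL: "x \<in> L" using x by blast
        have "hact (\<sigma> x) g y \<in> derived N" if y: "y \<in> L" for y
        proof -
          have "hact (\<sigma> x) g y = \<sigma> (hact x g (\<sigma> y))"
            using F.\<tau>_r[OF xL gM] y unfolding g_tw by (simp add: htwist_def fun_eq_iff) metis
          then show ?thesis using x \<sigma>_closed[OF y] dN_\<sigma> by simp
        qed
        then show ?thesis using \<sigma>_closed[OF xL] by blast
      qed
    qed
    show "\<exists>n\<in>N. x - n \<in> ?S" if x: "x \<in> L" for x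
    proof -
      \<comment> \<open>Modulo \<open>derived N\<close>, \<open>x\<close> moves \<open>g\<close> by
        \<open>br n\<close>, while \<open>n\<close> itself moves it by \<open>- br n\<close> because
        the scalar of \<open>g\<close> is 1. Hence \<open>x + n\<close> annihilates
        \<open>g\<close>.\<close>
      obtain n where n: "n \<in> N" "\<And>y. y \<in> L \<Longrightarrow> hact x g y - br n y \<in> derived N"
        using ginner[OF x] by (auto simp: hom_inner_def)
      have nL: "n \<in> L" by (rule NL[OF n(1)])
      have "hact (x - (- n)) g y \<in> derived N" if y: "y \<in> L" for y
      proof -
        have "hact (x - (- n)) g y = (hact x g y - br n y) + (hact n g y + scale 1 (br n y))"
          using F.r_add[OF x nL gM] by simp
        then show ?thesis using subspace_add[OF dNs n(2)[OF y] hact_N[OF n(1) gH gn1 y]] by simp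
      qed
      moreover have "x - (- n) \<in> L" using subspace_add[OF sL x nL] by simp
      ultimately show ?thesis using subspace_neg[OF Ns n(1)] by blast
    qed
  qed
  then have S: "hact x g y \<in> derived N" if "x \<in> L" "y \<in> L" for x y using that by blast
  let ?K = "{x \<in> L. g x \<in> derived N}"
  have "?K = L"
  proof (rule frattini)
    show "inv_subalgebra ?K"
      unfolding inv_subalgebra_def
    proof (intro conjI ballI)
      show "subspace ?K"
        by (rule subspaceI) (auto simp: subspace_0[OF sL] subspace_add[OF sL] subspace_scale[OF sL] lin_0[OF sL gD(1)] gD(5,6)
          subspace_0[OF dNs] subspace_add[OF dNs] subspace_scale[OF dNs])
      show "?K \<subseteq> L" by blast
      show "br x y \<in> ?K" if "x \<in> ?K" "y \<in> ?K" for x y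
      proof -
        have xy: "x \<in> L" "y \<in> L" "g y \<in> derived N" using that by auto
        have "g (br x y) = br x (g y) - hact x g y" using xy by (simp add: hact_def)
        then have "g (br x y) \<in> derived N" using dN_left[OF xy(3,1)] S[OF xy(1,2)] subspace_diff[OF dNs] by simp
        then show ?thesis using br_closed[OF xy(1,2)] by blast
      qed
      show "\<sigma> x \<in> ?K" if "x \<in> ?K" for x
      proof -
        have x: "x \<in> L" "g x \<in> derived N" using that by auto
        show ?thesis using dN_\<sigma>[OF x(2)] g\<sigma>[OF x(1)] \<sigma>_closed[OF x(1)] by simp
      qed
    qed
    show "\<exists>n\<in>N. x - n \<in> ?K" if x: "x \<in> L" for x
    proof -
      have gx: "g x \<in> N" "g x \<in> L" using gD(2,3)[OF x] by auto
      \<comment> \<open>Modulo \<open>derived N\<close> the map \<open>g\<close> is idempotent,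
        which makes \<open>g x\<close> the required correction in \<open>N\<close>.\<close>
      have "g (x - g x) = - (g (g x) - g x)" using gD(7)[OF x gx(2)] by simp
      then have "g (x - g x) \<in> derived N" using subspace_neg[OF dNs gn[OF gx(1)]] by simp
      then show ?thesis using gx subspace_diff[OF sL x gx(2)] by blast
    qed
  qed
  then have "n \<in> derived N" if n: "n \<in> N" for n
  proof -
    have "g n \<in> derived N" using NL[OF n] \<open>?K = L\<close> by blast
    then have "g n - (g n - n) \<in> derived N" using gn[OF n] by (rule subspace_diff[OF dNs])
    then show ?thesis by simp
  qed
  then show False using ne dN_N by blast
qed

lemma frattini_ideal_trivial:
  assumes perfect "\<And>K. inv_ideal K \<Longrightarrow> K \<noteq> L \<Longrightarrow> K \<subseteq> N"
  shows "N = {0}"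
  by (rule ideal_not_perfect[OF frattini_ideal_perfect[OF assms]])

end

text \<open>Minimality of the supplement \<open>S\<close> makes \<open>S \<inter> I\<close> an ideal
  of non-generators, maximality of \<open>I\<close> confines the proper stable ideals of
  \<open>S\<close> to \<open>I\<close>, and a bracket outside \<open>I\<close> makes
  \<open>S\<close> perfect. These are the hypotheses of
  \<open>frattini_ideal_trivial\<close>.\<close>

theorem equivariant_levi:
  assumes I: "inv_ideal I" and max: "\<And>K. inv_ideal K \<Longrightarrow> I \<subseteq> K \<Longrightarrow> K = I \<or> K = L"
    and nonab: "x0 \<in> L" "y0 \<in> L" "br x0 y0 \<notin> I"
  shows "\<exists>S. inv_subalgebra S \<and> S \<inter> I = {0} \<and> (\<forall>x\<in>L. \<exists>i\<in>I. x - i \<in> S)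
    \<and> (\<forall>K. inv_lie_algebra.inv_ideal scale S br \<sigma> K \<longrightarrow> K = {0} \<or> K = S)"
proof -
  note ID = inv_idealD[OF I]
  have IL: "x \<in> L" if "x \<in> I" for x using that ID(2) by blast
  define good where "good S \<longleftrightarrow> inv_subalgebra S \<and> (\<forall>x\<in>L. \<exists>i\<in>I. x - i \<in> S)" for S
  have "good L"
    unfolding good_def inv_subalgebra_def
    using sL br_closed \<sigma>_closed subspace_0[OF ID(1)] subspace_diff[OF sL] by (auto intro!: bexI[of _ 0])
  then obtain S where gS: "good S" and min: "\<And>S'. good S' \<Longrightarrow> dim S \<le> dim S'"
    using ex_has_least_nat[of good L dim] by blast
  have S: "subspace S" "S \<subseteq> L" "\<And>x y. x \<in> S \<Longrightarrow> y \<in> S \<Longrightarrow> br x y \<in> S" "\<And>x. x \<in> S \<Longrightarrow> \<sigma> x \<in> S"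
    and supp: "\<And>x. x \<in> L \<Longrightarrow> \<exists>i\<in>I. x - i \<in> S"
    using gS by (auto simp: good_def inv_subalgebra_def)
  have SL: "x \<in> L" if "x \<in> S" for x using that S(2) by blast
  have iS: "inv_subalgebra S" using gS by (simp add: good_def)
  interpret T: inv_lie_algebra scale S br \<sigma> by (rule inv_subalgebra_locale[OF iS])
  have minS: "S' = S" if "good S'" "S' \<subseteq> S" for S'
  proof (rule ccontr)
    assume "S' \<noteq> S"
    then have "dim S' < dim S"
      using dim_less[OF T.fdL _ that(2)] that(1) by (auto simp: good_def inv_subalgebra_def)
    then show False using min[OF that(1)] by simp
  qed
  \<comment> \<open>The sum \<open>K + I\<close> is an ideal of \<open>L\<close> because
    \<open>L = S + I\<close>, so it is \<open>I\<close> or \<open>L\<close>. In the second case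
    \<open>K\<close> is itself a supplement inside \<open>S\<close>, and minimality gives
    \<open>K = S\<close>.\<close>
  have idealS: "K \<subseteq> I \<or> K = S" if K: "T.inv_ideal K" for K
  proof -
    note KD = T.inv_idealD[OF K]
    have KL: "k \<in> L" if "k \<in> K" for k using that KD(2) SL by blast
    let ?K = "{k + i | k i. k \<in> K \<and> i \<in> I}"
    have KI: "inv_ideal ?K"
      unfolding inv_ideal_def
    proof (intro conjI ballI)
      show "subspace ?K" by (rule subspace_sums[OF KD(1) ID(1)])
      show "?K \<subseteq> L" using KL IL subspace_add[OF sL] by blast
      show "br x y \<in> ?K" if x: "x \<in> ?K" and y: "y \<in> L" for x y
      proof -
        obtain k i where ki: "x = k + i" "k \<in> K" "i \<in> I" using x by blast
        obtain j where j: "j \<in> I" "y - j \<in> S" using supp[OF y] by blast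
        have L: "k \<in> L" "i \<in> L" "j \<in> L" "y - j \<in> L" using ki j KL IL SL by auto
        have "br x y = br k (y - j) + (br k j + br i y)"
          unfolding ki(1) using L y by (simp add: br_add_left br_diff_right)
        moreover have "br k (y - j) \<in> K" by (rule KD(3)[OF ki(2) j(2)])
        moreover have "br k j + br i y \<in> I"
          by (rule subspace_add[OF ID(1) ID(4)[OF j(1) L(1)] ID(3)[OF ki(3) y]])
        ultimately show ?thesis by blast
      qed
      show "\<sigma> x \<in> ?K" if x: "x \<in> ?K" for x
      proof -
        obtain k i where ki: "x = k + i" "k \<in> K" "i \<in> I" using x by blast
        have "\<sigma> x = \<sigma> k + \<sigma> i" unfolding ki(1) by (rule \<sigma>_add[OF KL[OF ki(2)] IL[OF ki(3)]])
        then show ?thesis using KD(5)[OF ki(2)] ID(5)[OF ki(3)] by blast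
      qed
    qed
    have "I \<subseteq> ?K"
    proof
      fix i assume "i \<in> I"
      then have "0 + i \<in> ?K" using subspace_0[OF KD(1)] by blast
      then show "i \<in> ?K" by simp
    qed
    then have "?K = I \<or> ?K = L" by (rule max[OF KI])
    then show ?thesis
    proof
      assume e: "?K = I"
      have "k \<in> I" if "k \<in> K" for k
      proof -
        have "k + 0 \<in> ?K" using that subspace_0[OF ID(1)] by blast
        then show ?thesis using e by simp
      qed
      then show ?thesis by blast
    next
      assume e: "?K = L"
      have "\<exists>i\<in>I. x - i \<in> K" if x: "x \<in> L" for x
      proof -
        obtain k i where "x = k + i" "k \<in> K" "i \<in> I" using x e by blast
        then show ?thesis by (intro bexI[of _ i]) auto
      qed
      moreover have "inv_subalgebra K"
        unfolding inv_subalgebra_def using KD KL by blast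
      ultimately have "K = S" using KD(2) by (intro minS) (auto simp: good_def)
      then show ?thesis ..
    qed
  qed
  let ?N = "S \<inter> I"
  have N: "T.inv_ideal ?N"
    unfolding T.inv_ideal_def
    using subspace_inter[OF S(1) ID(1)] S(3,4) ID(3,5) SL by blast
  have frat: "S' = S" if S': "T.inv_subalgebra S'" and sup: "\<And>x. x \<in> S \<Longrightarrow> \<exists>n\<in>?N. x - n \<in> S'" for S'
  proof (rule minS)
    have S'D: "subspace S'" "S' \<subseteq> S" "\<forall>x\<in>S'. \<forall>y\<in>S'. br x y \<in> S'" "\<forall>x\<in>S'. \<sigma> x \<in> S'"
      using S' by (auto simp: T.inv_subalgebra_def)
    have "\<exists>i\<in>I. x - i \<in> S'" if x: "x \<in> L" for x
    proof -
      obtain i where i: "i \<in> I" "x - i \<in> S" using supp[OF x] by blast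
      obtain n where n: "n \<in> I" "x - i - n \<in> S'" using sup[OF i(2)] by blast
      have "x - (i + n) \<in> S'" using n(2) by (simp add: diff_diff_add)
      then show ?thesis using subspace_add[OF ID(1) i(1) n(1)] by blast
    qed
    then show "good S'" using S'D S(2) by (auto simp: good_def inv_subalgebra_def)
    show "S' \<subseteq> S" by (rule S'D(2))
  qed
  have "T.inv_ideal S" unfolding T.inv_ideal_def using S by blast
  then have dS: "T.inv_ideal (T.derived S)" by (rule T.derived_ideal(1))
  \<comment> \<open>Modulo \<open>I\<close> the vectors \<open>x0\<close> and \<open>y0\<close> can
    be moved into \<open>S\<close>, which thus inherits a bracket outside \<open>I\<close>;
    \<open>idealS\<close> then leaves only \<open>derived S = S\<close>.\<close>
  have "\<not> T.derived S \<subseteq> I"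
  proof
    assume dI: "T.derived S \<subseteq> I"
    obtain i where i: "i \<in> I" "x0 - i \<in> S" using supp[OF nonab(1)] by blast
    obtain j where j: "j \<in> I" "y0 - j \<in> S" using supp[OF nonab(2)] by blast
    have "br (x0 - i) (y0 - j) \<in> T.derived S" unfolding T.derived_def by (rule span_base) (use i j in blast)
    then have b: "br (x0 - i) (y0 - j) \<in> I" using dI by blast
    have "br x0 y0 = br (x0 - i) (y0 - j) + (br (x0 - i) j + br i y0)"
      using nonab(1,2) IL[OF i(1)] IL[OF j(1)] by (simp add: br_diff_left br_diff_right subspace_diff[OF sL])
    also have "\<dots> \<in> I"
      by (intro subspace_add[OF ID(1)] b ID(4)[OF j(1) SL[OF i(2)]] ID(3)[OF i(1) nonab(2)])
    finally show False using nonab(3) by contradiction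
  qed
  then have "T.derived S = S" using idealS[OF dS] by blast
  then have perf: "T.perfect" by (simp add: T.perfect_def T.derived_def)
  have N0: "?N = {0}"
  proof (rule T.frattini_ideal_trivial[OF N _ perf])
    show "S' = S" if "T.inv_subalgebra S'" "\<And>x. x \<in> S \<Longrightarrow> \<exists>n\<in>?N. x - n \<in> S'" for S'
      by (rule frat[OF that])
    show "K \<subseteq> ?N" if "T.inv_ideal K" "K \<noteq> S" for K
      using idealS[OF that(1)] that(2) T.inv_idealD(2)[OF that(1)] by blast
  qed
  have "K = {0} \<or> K = S" if K: "T.inv_ideal K" for K
    using idealS[OF K] T.inv_idealD(2)[OF K] subspace_0[OF T.inv_idealD(1)[OF K]] N0 by blast
  then show ?thesis using iS N0 supp by blast
qed

end

section \<open>Quadratic Hom-Lie algebras and double extensions\<close>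

locale fd_quad = iqh_lie_algebra G
  for G :: "('k::{alg_closed_field,field_char_0}, 'a::ab_group_add) quad_hom_lie" +
  assumes fin: "fin_dim G"
begin

sublocale ac_space "scal G" ..

abbreviation (input) "X \<equiv> carr G"
abbreviation (input) "s \<equiv> scal G"
abbreviation (input) "b \<equiv> brk G"
abbreviation (input) "\<alpha> \<equiv> twist G"
abbreviation (input) "B \<equiv> form G"

lemma fdX: "fd X"
  using fin subspace_carr unfolding fin_dim_def fd_def by auto

lemmas sX = subspace_carr

lemma b_lin: "x \<in> X \<Longrightarrow> lin X X (b x)"
  using brk_bilinear by (simp add: bilinear_map_on_def)

lemma b_right:
  assumes "x \<in> X"
  shows "y \<in> X \<Longrightarrow> b x y \<in> X" "y \<in> X \<Longrightarrow> z \<in> X \<Longrightarrow> b x (y + z) = b x y + b x z"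
    "y \<in> X \<Longrightarrow> b x (s c y) = s c (b x y)" "y \<in> X \<Longrightarrow> z \<in> X \<Longrightarrow> b x (y - z) = b x y - b x z"
    "y \<in> X \<Longrightarrow> b x (- y) = - b x y"
  using linD[OF b_lin[OF assms]] lin_diff[OF sX b_lin[OF assms]] lin_neg[OF sX b_lin[OF assms]] by auto

lemma b_left:
  assumes "z \<in> X"
  shows "x \<in> X \<Longrightarrow> y \<in> X \<Longrightarrow> b (x + y) z = b x z + b y z"
    "x \<in> X \<Longrightarrow> b (s c x) z = s c (b x z)" "x \<in> X \<Longrightarrow> y \<in> X \<Longrightarrow> b (x - y) z = b x z - b y z"
    "x \<in> X \<Longrightarrow> b (- x) z = - b x z"
proof -
  have l: "lin X X (\<lambda>x. b x z)" using brk_bilinear assms by (simp add: bilinear_map_on_def)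
  show "x \<in> X \<Longrightarrow> y \<in> X \<Longrightarrow> b (x + y) z = b x z + b y z"
    "x \<in> X \<Longrightarrow> b (s c x) z = s c (b x z)" "x \<in> X \<Longrightarrow> y \<in> X \<Longrightarrow> b (x - y) z = b x z - b y z"
    "x \<in> X \<Longrightarrow> b (- x) z = - b x z"
    using linD[OF l] lin_diff[OF sX l] lin_neg[OF sX l] by auto
qed

lemma \<alpha>_add: "x \<in> X \<Longrightarrow> y \<in> X \<Longrightarrow> \<alpha> (x + y) = \<alpha> x + \<alpha> y"
  and \<alpha>_closed: "x \<in> X \<Longrightarrow> \<alpha> x \<in> X"
  using linD[OF twist_linear] by auto

lemma \<alpha>_diff: "x \<in> X \<Longrightarrow> y \<in> X \<Longrightarrow> \<alpha> (x - y) = \<alpha> x - \<alpha> y"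
  by (rule lin_diff[OF sX twist_linear])

lemma B_sym: "x \<in> X \<Longrightarrow> y \<in> X \<Longrightarrow> B x y = B y x"
  and B_inv: "x \<in> X \<Longrightarrow> y \<in> X \<Longrightarrow> z \<in> X \<Longrightarrow> B (b x y) z = B x (b y z)"
  and B_\<alpha>: "x \<in> X \<Longrightarrow> y \<in> X \<Longrightarrow> B (\<alpha> x) y = B x (\<alpha> y)"
  and B_add_right: "x \<in> X \<Longrightarrow> y \<in> X \<Longrightarrow> z \<in> X \<Longrightarrow> B x (y + z) = B x y + B x z"
  and B_scale_right: "x \<in> X \<Longrightarrow> y \<in> X \<Longrightarrow> B x (s c y) = c * B x y"
  and B_add_left: "x \<in> X \<Longrightarrow> y \<in> X \<Longrightarrow> z \<in> X \<Longrightarrow> B (x + y) z = B x z + B y z"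
  and B_scale_left: "x \<in> X \<Longrightarrow> y \<in> X \<Longrightarrow> B (s c x) y = c * B x y"
  using form_invariant unfolding invariant_symmetric_form_def bilinear_map_on_def linear_map_on_def by blast+

lemma B_neg_left: "x \<in> X \<Longrightarrow> y \<in> X \<Longrightarrow> B (- x) y = - B x y"
  using B_scale_left[of x y "-1"] by simp

lemma B_diff_left: "x \<in> X \<Longrightarrow> y \<in> X \<Longrightarrow> z \<in> X \<Longrightarrow> B (x - y) z = B x z - B y z"
  using B_add_left[of x "- y" z] B_neg_left[of y z] subspace_neg[OF sX] by simp

lemma B_zero_left: "x \<in> X \<Longrightarrow> B 0 x = 0"
  using B_scale_left[of 0 x 0] subspace_0[OF sX] by simp

lemma B_zero_right: "x \<in> X \<Longrightarrow> B x 0 = 0"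
  using B_scale_right[of x 0 0] subspace_0[OF sX] by simp

lemma B_nondeg: "x \<in> X \<Longrightarrow> (\<And>y. y \<in> X \<Longrightarrow> B x y = 0) \<Longrightarrow> x = 0"
  using form_nondegenerate by (auto simp: nondegenerate_on_def)

text \<open>By involutivity the twisted bracket \<open>\<alpha> [x, y]\<close> is a Lie bracket with automorphism \<open>\<alpha>\<close>, and it
  has the same \<open>\<alpha>\<close>-stable subalgebras and ideals.\<close>

definition yau :: "'a \<Rightarrow> 'a \<Rightarrow> 'a"
  where "yau x y = \<alpha> (b x y)"

text \<open>The two twists on \<open>b y z\<close> cancel, which turns the Hom-Jacobi identity into
  the Jacobi identity of \<open>yau\<close>.\<close>

lemma yau_yau: "x \<in> X \<Longrightarrow> y \<in> X \<Longrightarrow> z \<in> X \<Longrightarrow> yau x (yau y z) = b (\<alpha> x) (b y z)"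
  by (simp add: yau_def twist_brk twist_twist b_right \<alpha>_closed)

sublocale Y: inv_lie_algebra "scal G" X yau \<alpha>
proof unfold_locales
  show "fd X" by (rule fdX)
  show "lin X X (yau x)" if "x \<in> X" for x
    unfolding yau_def by (rule lin_compose[OF b_lin[OF that] twist_linear])
  show "yau x y = - yau y x" if "x \<in> X" "y \<in> X" for x y
    using brk_skew[OF that] lin_neg[OF sX twist_linear b_right(1)[OF that(2,1)]] by (simp add: yau_def)
  show "yau x (yau y z) = yau (yau x y) z + yau y (yau x z)" if "x \<in> X" "y \<in> X" "z \<in> X" for x y z
  proof -
    have "yau (yau x y) z = b (b x y) (\<alpha> z)"
      using that by (simp add: yau_def twist_brk twist_twist b_right \<alpha>_closed)
    also have "\<dots> = - b (\<alpha> z) (b x y)" using that by (intro brk_skew) (auto simp: b_right \<alpha>_closed)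
    finally have 1: "yau (yau x y) z = - b (\<alpha> z) (b x y)" .
    have "b x z = - b z x" by (rule brk_skew[OF that(1,3)])
    then have 2: "b (\<alpha> y) (b x z) = - b (\<alpha> y) (b z x)"
      using that by (simp add: b_right \<alpha>_closed)
    show ?thesis
      using hom_jacobi[OF that] unfolding yau_yau[OF that] yau_yau[OF that(2,1,3)] 1 2
      by (simp add: algebra_simps eq_neg_iff_add_eq_0)
  qed
  show "lin X X \<alpha>" by (rule twist_linear)
  show "\<alpha> (\<alpha> x) = x" if "x \<in> X" for x by (rule twist_twist[OF that])
  show "\<alpha> (yau x y) = yau (\<alpha> x) (\<alpha> y)" if "x \<in> X" "y \<in> X" for x y
    using that by (simp add: yau_def twist_brk b_right)
qed

text \<open>Since \<open>\<alpha>\<close> is its own inverse on the carrier, an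
  \<open>\<alpha>\<close>-stable set cannot distinguish the two brackets.\<close>

lemma twisted_mem:
  assumes "\<And>x. x \<in> K \<Longrightarrow> \<alpha> x \<in> K" "x \<in> X" "y \<in> X"
  shows "yau x y \<in> K \<longleftrightarrow> b x y \<in> K"
  using assms(1)[of "b x y"] assms(1)[of "yau x y"] twist_twist[OF b_right(1)[OF assms(2,3)]]
  by (auto simp: yau_def)

lemma hom_ideal_iff: "hom_ideal G K \<longleftrightarrow> Y.inv_ideal K"
proof -
  have "(\<forall>x\<in>K. \<forall>y\<in>X. b x y \<in> K) \<longleftrightarrow> (\<forall>x\<in>K. \<forall>y\<in>X. yau x y \<in> K)"
    if "K \<subseteq> X" "\<forall>x\<in>K. \<alpha> x \<in> K" using twisted_mem[of K] that by blast
  then show ?thesis unfolding hom_ideal_def Y.inv_ideal_def by blast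
qed

lemma hom_idealD:
  assumes "hom_ideal G K"
  shows "subspace K" "x \<in> K \<Longrightarrow> x \<in> X" "x \<in> K \<Longrightarrow> y \<in> X \<Longrightarrow> b x y \<in> K" "x \<in> K \<Longrightarrow> y \<in> X \<Longrightarrow> b y x \<in> K"
    "x \<in> K \<Longrightarrow> \<alpha> x \<in> K"
proof -
  show k: "subspace K" and sub: "x \<in> K \<Longrightarrow> x \<in> X" and l: "x \<in> K \<Longrightarrow> y \<in> X \<Longrightarrow> b x y \<in> K" and "x \<in> K \<Longrightarrow> \<alpha> x \<in> K"
    using assms by (auto simp: hom_ideal_def)
  show "b y x \<in> K" if "x \<in> K" "y \<in> X"
    using subspace_neg[OF k l[OF that]] brk_skew[OF that(2) sub[OF that(1)]] by simp
qed

text \<open>The coordinates of \<open>T u\<close> are the values of \<open>B u\<close> on a basis.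
  Nondegeneracy makes \<open>T\<close> injective, hence onto, and a preimage of the vector with
  coordinates \<open>F e\<close> represents \<open>F\<close>.\<close>

lemma form_represents:
  assumes F: "linear_map_on s X (*) UNIV F"
  shows "\<exists>u\<in>X. \<forall>x\<in>X. B u x = F x"
proof -
  have FD: "F (x + y) = F x + F y" "F (s c x) = c * F x" if "x \<in> X" "y \<in> X" for x y c
    using F that by (auto simp: linear_map_on_def)
  have F0: "F 0 = 0" using FD(2)[of 0 0 0] subspace_0[OF sX] by simp
  obtain E where "basis_of E X" using basis_of_ex[OF fdX] by blast
  note E = basis_ofD[OF this]
  have EX: "e \<in> X" if "e \<in> E" for e using that E(4) by blast
  have ext: "\<forall>x\<in>X. B u x = F' x"
    if u: "u \<in> X" and F': "\<And>x y. x \<in> X \<Longrightarrow> y \<in> X \<Longrightarrow> F' (x + y) = F' x + F' y"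
      "\<And>c x. x \<in> X \<Longrightarrow> F' (s c x) = c * F' x" and e: "\<And>e. e \<in> E \<Longrightarrow> B u e = F' e" for u F'
  proof -
    have "F' 0 = 0" using F'(2)[of 0 0] subspace_0[OF sX] by simp
    then have "subspace {x \<in> X. B u x = F' x}"
      using u by (intro subspaceI) (auto simp: subspace_0[OF sX] subspace_add[OF sX] subspace_scale[OF sX]
        B_zero_right B_add_right B_scale_right F')
    moreover have "E \<subseteq> {x \<in> X. B u x = F' x}" using EX e by blast
    ultimately have "span E \<subseteq> {x \<in> X. B u x = F' x}" by (intro span_minimal)
    then show ?thesis using E(3) by blast
  qed
  define T where "T u = (\<Sum>e\<in>E. s (B u e) e)" for u
  have T_eq: "B u e = c e" if "T u = (\<Sum>e\<in>E. s (c e) e)" "e \<in> E" for u c e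
  proof -
    have "(\<Sum>e\<in>E. s (B u e - c e) e) = 0" using that(1) by (simp add: T_def scale_left_diff_distrib sum_subtractf)
    from independentD[OF E(2,1) subset_refl this that(2)] show ?thesis by simp
  qed
  have comb: "(\<Sum>e\<in>E. s (c e) e) \<in> X" for c
    by (intro subspace_sum[OF sX] subspace_scale[OF sX] EX)
  have "lin X X T"
  proof (rule linI)
    show "T u \<in> X" for u unfolding T_def by (rule comb)
    show "T (u + v) = T u + T v" if "u \<in> X" "v \<in> X" for u v
      unfolding T_def sum.distrib[symmetric] using that by (intro sum.cong) (auto simp: B_add_left EX scale_left_distrib)
    show "T (s c u) = s c (T u)" if "u \<in> X" for c u
      unfolding T_def scale_sum_right using that by (intro sum.cong) (auto simp: B_scale_left EX)
  qed
  moreover have "u = 0" if u: "u \<in> X" "T u = 0" for u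
  proof -
    have "B u e = 0" if "e \<in> E" for e by (rule T_eq[of u "\<lambda>e. 0"]) (use u(2) that in auto)
    then have "\<forall>x\<in>X. B u x = 0" by (intro ext[OF u(1)]) auto
    then show ?thesis using B_nondeg[OF u(1)] by blast
  qed
  ultimately have surj: "T ` X = X" by (rule lin_inj_imp_surj[OF fdX])
  have "(\<Sum>e\<in>E. s (F e) e) \<in> T ` X" unfolding surj by (rule comb)
  then obtain u where u: "u \<in> X" "T u = (\<Sum>e\<in>E. s (F e) e)" by auto
  have "\<forall>x\<in>X. B u x = F x" by (rule ext[OF u(1) FD T_eq[OF u(2)]])
  then show ?thesis using u(1) by blast
qed

definition perp :: "'a set \<Rightarrow> 'a set"
  where "perp I = {x \<in> X. \<forall>y\<in>I. B x y = 0}"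

lemma perp_subspace: "I \<subseteq> X \<Longrightarrow> subspace (perp I)"
  unfolding perp_def
  by (intro subspaceI) (auto simp: subset_iff subspace_0[OF sX] subspace_add[OF sX] subspace_scale[OF sX]
    B_zero_left B_add_left B_scale_left)

lemma perp_ideal: assumes I: "hom_ideal G I" shows "hom_ideal G (perp I)"
proof -
  note ID = hom_idealD[OF I]
  have IX: "I \<subseteq> X" using ID(2) by blast
  have "b x y \<in> perp I" if x: "x \<in> perp I" and y: "y \<in> X" for x y
    using x y ID(2) ID(4)[OF _ y] by (auto simp: perp_def b_right B_inv)
  moreover have "\<alpha> x \<in> perp I" if x: "x \<in> perp I" for x
    using x ID(2,5) by (auto simp: perp_def \<alpha>_closed B_\<alpha>)
  moreover have "perp I \<subseteq> X" by (auto simp: perp_def)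
  ultimately show ?thesis using perp_subspace[OF IX] by (auto simp: hom_ideal_def)
qed

text \<open>A coordinate functional on a complement of \<open>I\<close>, extended by zero on
  \<open>I\<close>, is represented by a nonzero vector orthogonal to \<open>I\<close>.\<close>

lemma perp_nontrivial:
  assumes "subspace I" "I \<subseteq> X" "I \<noteq> X"
  shows "\<exists>u\<in>perp I. u \<noteq> 0"
proof -
  from projection_ex[OF fdX assms(1,2)] obtain C \<pi> where C: "subspace C \<and> C \<subseteq> X \<and> lin X C \<pi> \<and> (\<forall>v\<in>X. v - \<pi> v \<in> I)
    \<and> (\<forall>c\<in>C. \<pi> c = c) \<and> (\<forall>u\<in>I. \<pi> u = 0)" by (elim exE)
  then have \<pi>: "lin X C \<pi>" "\<And>v. v \<in> X \<Longrightarrow> v - \<pi> v \<in> I" "\<And>c. c \<in> C \<Longrightarrow> \<pi> c = c" "\<And>u. u \<in> I \<Longrightarrow> \<pi> u = 0"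
    and sC: "subspace C" "C \<subseteq> X" by auto
  obtain E where "basis_of E C" using basis_of_ex[OF fd_subset[OF fdX sC]] by blast
  note E = basis_ofD[OF this]
  have "E \<noteq> {}"
  proof
    assume "E = {}"
    then have "C = {0}" using E(3) by simp
    then have "v \<in> I" if "v \<in> X" for v using \<pi>(2)[OF that] linD(1)[OF \<pi>(1) that] by simp
    then show False using assms(2,3) by blast
  qed
  then obtain e where e: "e \<in> E" by blast
  have eC: "e \<in> C" using e E(4) by blast
  have "linear_map_on s X (*) UNIV (\<lambda>x. representation E (\<pi> x) e)"
    using linD[OF \<pi>(1)] E(3) by (auto simp: linear_map_on_def representation_add[OF E(2)] representation_scale[OF E(2)])
  then obtain u where u: "u \<in> X" "\<And>x. x \<in> X \<Longrightarrow> B u x = representation E (\<pi> x) e"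
    using form_represents by blast
  have "u \<in> perp I" using u assms(2) \<pi>(4) by (auto simp: perp_def representation_zero subset_iff)
  moreover have "B u e = 1"
    using u(2)[of e] eC sC(2) \<pi>(3)[OF eC] representation_basis[OF E(2) e] by auto
  then have "u \<noteq> 0" using B_zero_left[of e] eC sC(2) by auto
  ultimately show ?thesis by blast
qed

end

section \<open>Decomposition of the carrier into \<open>perp I\<close>, a middle part and
  \<open>S\<close>\<close>

locale split_quad = fd_quad G
  for G :: "('k::{alg_closed_field,field_char_0}, 'a::ab_group_add) quad_hom_lie" +
  fixes I S
  assumes I: "hom_ideal G I" and perp_I: "perp I \<subseteq> I"
    and S: "Y.inv_subalgebra S" and SI: "S \<inter> I = {0}" and supp: "\<And>x. x \<in> X \<Longrightarrow> \<exists>i\<in>I. x - i \<in> S"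
begin

abbreviation "J \<equiv> perp I"

lemmas ID = hom_idealD[OF I]
lemmas JD = hom_idealD[OF perp_ideal[OF I]]

lemma JI: "x \<in> J \<Longrightarrow> x \<in> I"
  using perp_I by blast

lemma SX: "x \<in> S \<Longrightarrow> x \<in> X" and S_sub: "subspace S" and S_\<alpha>: "x \<in> S \<Longrightarrow> \<alpha> x \<in> S"
  using S by (auto simp: Y.inv_subalgebra_def)

lemma S_b: "x \<in> S \<Longrightarrow> y \<in> S \<Longrightarrow> b x y \<in> S"
  using S twisted_mem[of S x y] SX S_\<alpha> by (auto simp: Y.inv_subalgebra_def)

lemma J_orth: "u \<in> J \<Longrightarrow> i \<in> I \<Longrightarrow> B u i = 0"
  by (simp add: perp_def)

lemma J_orth': "u \<in> J \<Longrightarrow> i \<in> I \<Longrightarrow> B i u = 0"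
  using J_orth[of u i] B_sym[of i u] ID(2)[of i] JD(2)[of u] by simp

text \<open>Invariance moves the bracket with \<open>i\<close> to the other argument, where it lands
  in \<open>I\<close> and is orthogonal to \<open>J\<close>.\<close>

lemma I_J_brk: assumes "i \<in> I" "u \<in> J" shows "b i u = 0" "b u i = 0"
proof -
  have X: "i \<in> X" "u \<in> X" using assms ID(2) JD(2) by auto
  show u: "b u i = 0"
  proof (rule B_nondeg)
    fix y assume y: "y \<in> X"
    show "B (b u i) y = 0" using B_inv[OF X(2,1) y] J_orth[OF assms(2) ID(3)[OF assms(1) y]] by simp
  qed (rule b_right(1)[OF X(2,1)])
  show "b i u = 0" using brk_skew[OF X] u by simp
qed

definition part :: "'a \<Rightarrow> 'a"
  where "part = (SOME p. lin X S p \<and> (\<forall>x\<in>X. x - p x \<in> I) \<and> (\<forall>a\<in>S. p a = a) \<and> (\<forall>i\<in>I. p i = 0))"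

lemma part: "lin X S part" "x \<in> X \<Longrightarrow> x - part x \<in> I" "a \<in> S \<Longrightarrow> part a = a" "i \<in> I \<Longrightarrow> part i = 0"
proof -
  have IX: "I \<subseteq> X" and SX': "S \<subseteq> X" using ID(2) SX by auto
  have "\<exists>c\<in>S. x - c \<in> I" if x: "x \<in> X" for x
  proof -
    obtain i where "i \<in> I" "x - i \<in> S" using supp[OF x] by blast
    then show ?thesis by (intro bexI[of _ "x - i"]) auto
  qed
  note someI_ex[OF projection_along[OF sX ID(1) IX S_sub SX' SI this], folded part_def]
  then show "lin X S part" "x \<in> X \<Longrightarrow> x - part x \<in> I" "a \<in> S \<Longrightarrow> part a = a" "i \<in> I \<Longrightarrow> part i = 0" by auto
qed

text \<open>Elements of \<open>J\<close> are orthogonal to \<open>I\<close>, and \<open>S\<close>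
  supplements \<open>I\<close>; thus \<open>J\<close> embeds into the dual of
  \<open>S\<close>.\<close>

lemma J_eqI:
  assumes "u \<in> J" "v \<in> J" "\<And>a. a \<in> S \<Longrightarrow> B u a = B v a"
  shows "u = v"
proof -
  have uv: "u - v \<in> J" by (rule subspace_diff[OF JD(1) assms(1,2)])
  have X: "u \<in> X" "v \<in> X" "u - v \<in> X" using assms uv JD(2) by auto
  have "B (u - v) x = 0" if x: "x \<in> X" for x
  proof -
    have p: "part x \<in> S" "part x \<in> X" using linD(1)[OF part(1) x] SX by auto
    have "B (u - v) (part x + (x - part x)) = B (u - v) (part x) + B (u - v) (x - part x)"
      by (rule B_add_right[OF X(3) p(2) subspace_diff[OF sX x p(2)]])
    then show ?thesis
      using J_orth[OF uv part(2)[OF x]] B_diff_left[OF X(1,2) p(2)] assms(3)[OF p(1)] by simp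
  qed
  then have "u - v = 0" by (rule B_nondeg[OF X(3)])
  then show ?thesis by simp
qed

text \<open>Extending \<open>F\<close> by zero along \<open>I\<close> makes the representing vector
  orthogonal to \<open>I\<close>. Together with \<open>J_eqI\<close> this identifies
  \<open>J\<close> with the dual of \<open>S\<close>.\<close>

lemma J_represents:
  assumes "linear_map_on s S (*) UNIV F"
  shows "\<exists>u\<in>J. \<forall>a\<in>S. B u a = F a"
proof -
  have "linear_map_on s X (*) UNIV (\<lambda>x. F (part x))"
    using assms linD[OF part(1)] by (auto simp: linear_map_on_def)
  then obtain u where u: "u \<in> X" "\<And>x. x \<in> X \<Longrightarrow> B u x = F (part x)" using form_represents by blast
  have "0 \<in> S" by (rule subspace_0[OF S_sub])
  then have "F (s 0 0) = 0 * F 0" using assms unfolding linear_map_on_def by blast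
  then have "F 0 = 0" by simp
  then have "u \<in> J" using u ID(2) part(4) by (simp add: perp_def)
  moreover have "B u a = F a" if "a \<in> S" for a using u(2)[OF SX[OF that]] part(3)[OF that] by simp
  ultimately show ?thesis by blast
qed

definition mid :: "'a set"
  where "mid = {x \<in> I. \<forall>a\<in>S. B x a = 0}"

lemma mid_I: "v \<in> mid \<Longrightarrow> v \<in> I" and mid_X: "v \<in> mid \<Longrightarrow> v \<in> X" and mid_S: "v \<in> mid \<Longrightarrow> a \<in> S \<Longrightarrow> B v a = 0"
  using ID(2) by (auto simp: mid_def)

lemma mid_S': "v \<in> mid \<Longrightarrow> a \<in> S \<Longrightarrow> B a v = 0"
  using mid_S[of v a] B_sym[of a v] mid_X[of v] SX[of a] by simp

lemma mid_subspace: "subspace mid"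
  by (rule subspaceI) (auto simp: mid_def ID(2) SX subspace_0[OF ID(1)] subspace_add[OF ID(1)] subspace_scale[OF ID(1)]
    B_zero_left B_add_left B_scale_left)

lemma mid_J: "mid \<inter> J = {0}"
proof -
  have "x = 0" if "x \<in> mid" "x \<in> J" for x
    by (rule J_eqI[OF that(2) subspace_0[OF JD(1)]]) (simp add: mid_S[OF that(1)] B_zero_left SX)
  then show ?thesis using subspace_0[OF JD(1)] subspace_0[OF mid_subspace] by blast
qed

text \<open>The space \<open>mid\<close> is a model of the quotient of \<open>I\<close> by
  \<open>J\<close>, with \<open>q\<close> as the quotient map.\<close>

definition q :: "'a \<Rightarrow> 'a"
  where "q = (SOME p. lin I mid p \<and> (\<forall>x\<in>I. x - p x \<in> J) \<and> (\<forall>v\<in>mid. p v = v) \<and> (\<forall>u\<in>J. p u = 0))"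

lemma q: "lin I mid q" "i \<in> I \<Longrightarrow> i - q i \<in> J" "v \<in> mid \<Longrightarrow> q v = v" "u \<in> J \<Longrightarrow> q u = 0"
proof -
  have mI: "mid \<subseteq> I" using mid_I by auto
  have "\<exists>v\<in>mid. i - v \<in> J" if i: "i \<in> I" for i
  proof -
    have iX: "i \<in> X" by (rule ID(2)[OF i])
    have "linear_map_on s S (*) UNIV (B i)"
      using iX SX by (auto simp: linear_map_on_def B_add_right B_scale_right)
    \<comment> \<open>Subtracting the element of \<open>J\<close> that pairs with \<open>S\<close>
      in the same way as \<open>i\<close> leaves a vector orthogonal to \<open>S\<close>.\<close>
    then obtain u where u: "u \<in> J" "\<And>a. a \<in> S \<Longrightarrow> B u a = B i a" using J_represents by blast
    have "i - u \<in> mid"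
      using u iX JD(2) SX subspace_diff[OF ID(1) i JI[OF u(1)]] by (simp add: mid_def B_diff_left)
    moreover have "i - (i - u) \<in> J" using u(1) by simp
    ultimately show ?thesis by blast
  qed
  note someI_ex[OF projection_along[OF ID(1) JD(1) perp_I mid_subspace mI mid_J this], folded q_def]
  then show "lin I mid q" "i \<in> I \<Longrightarrow> i - q i \<in> J" "v \<in> mid \<Longrightarrow> q v = v" "u \<in> J \<Longrightarrow> q u = 0" by auto
qed

lemma q_mid: "i \<in> I \<Longrightarrow> q i \<in> mid"
  using linD(1)[OF q(1)] .

lemma q_add: "i \<in> I \<Longrightarrow> j \<in> I \<Longrightarrow> q (i + j) = q i + q j"
  using linD(2)[OF q(1)] .

lemma q_diff: "i \<in> I \<Longrightarrow> j \<in> I \<Longrightarrow> q (i - j) = q i - q j"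
  using lin_diff[OF ID(1) q(1)] .

lemma q_scale: "i \<in> I \<Longrightarrow> q (s c i) = s c (q i)"
  using linD(3)[OF q(1)] .

lemma q_0: "q 0 = 0"
  using lin_0[OF ID(1) q(1)] .

lemma q_X: "i \<in> I \<Longrightarrow> q i \<in> X"
  using mid_X[OF q_mid] .

lemma q_eqI: "i \<in> I \<Longrightarrow> j \<in> I \<Longrightarrow> i - j \<in> J \<Longrightarrow> q i = q j"
  using q_diff q(4) by fastforce

lemma mid_\<alpha>: "v \<in> mid \<Longrightarrow> \<alpha> v \<in> mid"
  using ID(2,5) SX S_\<alpha> by (auto simp: mid_def B_\<alpha>)

lemma q_\<alpha>: assumes "i \<in> I" shows "q (\<alpha> i) = \<alpha> (q i)"
proof -
  have "q (\<alpha> i) = q (\<alpha> (q i))"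
    using JD(5)[OF q(2)[OF assms]] assms
    by (intro q_eqI) (auto simp: \<alpha>_diff[OF ID(2)[OF assms] q_X[OF assms]] ID(5) mid_I q_mid)
  then show ?thesis using q(3)[OF mid_\<alpha>[OF q_mid[OF assms]]] by simp
qed

text \<open>By invariance the orthogonal space of the subalgebra \<open>S\<close> is stable under
  \<open>S\<close>.\<close>

lemma mid_act: assumes a: "a \<in> S" and v: "v \<in> mid" shows "b a v \<in> mid"
proof -
  have X: "a \<in> X" "v \<in> X" using SX[OF a] mid_X[OF v] by auto
  have "B (b a v) c = 0" if c: "c \<in> S" for c
  proof -
    have "B (b a v) c = - B (b v a) c" using brk_skew[OF X] B_neg_left[OF b_right(1)[OF X(2,1)] SX[OF c]] by simp
    also have "\<dots> = 0" using B_inv[OF X(2,1) SX[OF c]] mid_S[OF v S_b[OF a c]] by simp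
    finally show ?thesis .
  qed
  then show ?thesis using ID(4)[OF mid_I[OF v] X(1)] by (simp add: mid_def)
qed

lemma q_act: assumes a: "a \<in> S" and i: "i \<in> I" shows "q (b a i) = b a (q i)"
proof -
  have X: "a \<in> X" "i \<in> X" "q i \<in> X" using SX[OF a] ID(2)[OF i] q_X[OF i] by auto
  have "q (b a i) = q (b a (q i))"
  proof (rule q_eqI)
    show "b a i \<in> I" "b a (q i) \<in> I" using ID(4) i mid_I[OF q_mid[OF i]] X by auto
    show "b a i - b a (q i) \<in> J" using JD(4)[OF q(2)[OF i] X(1)] b_right(4)[OF X] by simp
  qed
  then show ?thesis using q(3)[OF mid_act[OF a q_mid[OF i]]] by simp
qed

text \<open>Brackets between \<open>I\<close> and \<open>J\<close> vanish, so the correction made by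
  \<open>q\<close> is invisible to brackets with \<open>mid\<close>.\<close>

lemma b_mid_q: assumes v: "v \<in> mid" and i: "i \<in> I" shows "b v (q i) = b v i" "b (q i) v = b i v"
proof -
  have X: "v \<in> X" "i \<in> X" "q i \<in> X" using mid_X[OF v] ID(2)[OF i] q_X[OF i] by auto
  show "b v (q i) = b v i"
    using I_J_brk(1)[OF mid_I[OF v] q(2)[OF i]] b_right(4)[OF X] by simp
  show "b (q i) v = b i v"
    using I_J_brk(2)[OF mid_I[OF v] q(2)[OF i]] b_left(3)[OF X] by simp
qed

lemma B_q: assumes i: "i \<in> I" and j: "j \<in> I" shows "B (q i) j = B i j" "B j (q i) = B j i"
proof -
  have X: "i \<in> X" "j \<in> X" "q i \<in> X" using ID(2) i j q_X by auto
  show "B (q i) j = B i j" using J_orth[OF q(2)[OF i] j] B_diff_left[OF X(1,3,2)] by simp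
  then show "B j (q i) = B j i" using B_sym X by simp
qed

text \<open>The bracket of two elements of \<open>mid\<close> can have a component in
  \<open>J\<close>. It is removed here by \<open>q\<close> and reappears as the term
  \<open>psi\<close> of the double extension.\<close>

abbreviation V :: "('k, 'a) quad_hom_lie"
  where "V \<equiv> \<lparr>carr = mid, scal = s, brk = (\<lambda>x y. q (b x y)), twist = \<alpha>, form = B\<rparr>"

abbreviation A :: "('k, 'a) hom_lie"
  where "A \<equiv> \<lparr>carr = S, scal = s, brk = b, twist = \<alpha>\<rparr>"

lemma mid_b: "x \<in> mid \<Longrightarrow> y \<in> X \<Longrightarrow> b x y \<in> I" "x \<in> mid \<Longrightarrow> y \<in> X \<Longrightarrow> b y x \<in> I"
  using ID(3,4) mid_I by auto

lemma V_iqh: "iqh_lie_algebra V"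
proof -
  have jac: "b (\<alpha> x) (b y z) + b (\<alpha> y) (b z x) + b (\<alpha> z) (b x y) = 0" if "x \<in> mid" "y \<in> mid" "z \<in> mid" for x y z
    using hom_jacobi mid_X that by simp
  show ?thesis
  proof (unfold_locales, simp_all add: mid_subspace scale_right_distrib scale_left_distrib)
    show "bilinear_map_on s mid s mid s mid (\<lambda>x y. q (b x y))"
      unfolding bilinear_map_on_def linear_map_on_def
      by (auto simp: mid_b mid_X b_right b_left q_mid q_add q_scale)
    show "lin mid mid \<alpha>" by (rule lin_subset[OF twist_linear]) (auto simp: mid_X mid_\<alpha>)
    show "q (b x y) = - q (b y x)" if "x \<in> mid" "y \<in> mid" for x y
    proof -
      have "q (b x y) = q (- b y x)" using brk_skew[OF mid_X[OF that(1)] mid_X[OF that(2)]] by simp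
      also have "\<dots> = - q (b y x)" by (rule lin_neg[OF ID(1) q(1) mid_b(1)[OF that(2) mid_X[OF that(1)]]])
      finally show ?thesis .
    qed
    show "q (b (\<alpha> x) (q (b y z))) + q (b (\<alpha> y) (q (b z x))) + q (b (\<alpha> z) (q (b x y))) = 0"
      if "x \<in> mid" "y \<in> mid" "z \<in> mid" for x y z
    proof -
      have "q (b (\<alpha> x) (q (b y z))) + q (b (\<alpha> y) (q (b z x))) + q (b (\<alpha> z) (q (b x y)))
          = q (b (\<alpha> x) (b y z)) + q (b (\<alpha> y) (b z x)) + q (b (\<alpha> z) (b x y))"
        using that by (simp add: b_mid_q(1) mid_\<alpha> mid_b mid_X)
      also have "\<dots> = q (b (\<alpha> x) (b y z) + b (\<alpha> y) (b z x) + b (\<alpha> z) (b x y))"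
        using that by (simp add: q_add mid_\<alpha> mid_b mid_X b_right subspace_add[OF ID(1)])
      also have "\<dots> = 0" unfolding jac[OF that] by (rule q_0)
      finally show ?thesis .
    qed
    show "\<alpha> (\<alpha> x) = x" if "x \<in> mid" for x by (rule twist_twist[OF mid_X[OF that]])
    show "\<alpha> (q (b x y)) = q (b (\<alpha> x) (\<alpha> y))" if "x \<in> mid" "y \<in> mid" for x y
      using that q_\<alpha>[OF mid_b(1)[OF that(1) mid_X[OF that(2)]]] by (simp add: twist_brk mid_X)
    show "invariant_symmetric_form V B"
      unfolding invariant_symmetric_form_def bilinear_map_on_def linear_map_on_def
      by (auto simp: mid_X B_add_left B_add_right B_scale_left B_scale_right B_sym B_\<alpha> B_inv B_q mid_b mid_I)
    show "nondegenerate_on B mid"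
      unfolding nondegenerate_on_def
    proof (intro ballI impI)
      fix v assume v: "v \<in> mid" and z: "\<forall>y\<in>mid. B v y = 0"
      have vX: "v \<in> X" by (rule mid_X[OF v])
      show "v = 0"
      proof (rule B_nondeg[OF vX])
        fix x assume x: "x \<in> X"
        \<comment> \<open>The component in \<open>S\<close> is orthogonal to \<open>v\<close>, and
          the component in \<open>I\<close> pairs with \<open>v\<close> as its image under
          \<open>q\<close> does.\<close>
        let ?p = "part x" and ?i = "x - part x"
        have p: "?p \<in> S" "?p \<in> X" using linD(1)[OF part(1) x] SX by auto
        have i: "?i \<in> I" by (rule part(2)[OF x])
        have "B v (?p + ?i) = B v ?p + B v ?i" by (rule B_add_right[OF vX p(2) ID(2)[OF i]])
        also have "B v ?i = B v (q ?i)" by (rule B_q(2)[OF i mid_I[OF v], symmetric])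
        finally show "B v x = 0" using z q_mid[OF i] mid_S[OF v p(1)] by simp
      qed
    qed
  qed
qed

lemma A_involutive: "involutive_hom_lie_algebra A"
proof (unfold_locales, simp_all add: S_sub scale_right_distrib scale_left_distrib)
  show "bilinear_map_on s S s S s S b"
    unfolding bilinear_map_on_def linear_map_on_def by (auto simp: S_b SX b_right b_left)
  show "lin S S \<alpha>" by (rule lin_subset[OF twist_linear]) (auto simp: SX S_\<alpha>)
qed (auto simp: SX intro: brk_skew hom_jacobi twist_twist twist_brk)

text \<open>As \<open>S\<close> acts on \<open>mid\<close> by the ambient bracket,
  \<open>phi_brk\<close> and \<open>phi_deriv\<close> are the Hom-Jacobi identity with two
  arguments, respectively one, in \<open>S\<close>; skewness is invariance of the form. The form on
  \<open>S\<close> need not vanish and becomes \<open>\<gamma>\<close>.\<close>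

lemma extension_data: "double_extension_data V A b B"
proof -
  interpret V: iqh_lie_algebra V by (rule V_iqh)
  interpret A: involutive_hom_lie_algebra A by (rule A_involutive)
  have skew: "b x y = - b y x" if "x \<in> X" "y \<in> X" for x y by (rule brk_skew[OF that])
  show ?thesis
  proof (unfold_locales, simp_all)
    show "bilinear_map_on s S s mid s mid b"
      unfolding bilinear_map_on_def linear_map_on_def by (auto simp: mid_act mid_X SX b_right b_left)
    show "b (b a c) (\<alpha> x) = b (\<alpha> a) (b c x) - b (\<alpha> c) (b a x)" if "a \<in> S" "c \<in> S" "x \<in> mid" for a c x
    proof -
      have L: "a \<in> X" "c \<in> X" "x \<in> X" using that SX mid_X by auto
      have "b (\<alpha> x) (b a c) = - b (b a c) (\<alpha> x)" using L by (intro skew) (auto simp: b_right \<alpha>_closed)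
      moreover have "b (\<alpha> c) (b x a) = - b (\<alpha> c) (b a x)"
        using L skew[OF L(3,1)] by (simp add: b_right \<alpha>_closed)
      ultimately have "b (\<alpha> a) (b c x) - b (\<alpha> c) (b a x) - b (b a c) (\<alpha> x) = 0" using hom_jacobi[OF L] by simp
      then show ?thesis by simp
    qed
    show "\<alpha> (b a (q (b x y))) = q (b (b a (\<alpha> x)) y) + q (b x (b a (\<alpha> y)))"
      if "a \<in> S" "x \<in> mid" "y \<in> mid" for a x y
    proof -
      have L: "a \<in> X" "x \<in> X" "y \<in> X" "\<alpha> x \<in> X" "\<alpha> y \<in> X" using that SX mid_X \<alpha>_closed by auto
      have xy: "b x y \<in> I" by (rule mid_b(1)[OF that(2) L(3)])
      note m = mid_b(2)[OF that(3) b_right(1)[OF L(1,4)]] mid_b(1)[OF that(2) b_right(1)[OF L(1,5)]]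
      \<comment> \<open>The Hom-Jacobi identity is taken at \<open>\<alpha> x\<close> and
        \<open>\<alpha> y\<close> so that the twists on the outer arguments cancel.\<close>
      have j: "b (\<alpha> a) (b (\<alpha> x) (\<alpha> y)) + b x (b (\<alpha> y) a) + b y (b a (\<alpha> x)) = 0"
        using hom_jacobi[OF L(1,4,5)] twist_twist[OF L(2)] twist_twist[OF L(3)] by simp
      have "b x (b (\<alpha> y) a) = - b x (b a (\<alpha> y))" using L skew[OF L(5,1)] by (simp add: b_right)
      moreover have "b y (b a (\<alpha> x)) = - b (b a (\<alpha> x)) y" using L by (intro skew) (auto simp: b_right)
      ultimately have e: "b (\<alpha> a) (b (\<alpha> x) (\<alpha> y)) = b (b a (\<alpha> x)) y + b x (b a (\<alpha> y))"
        using j by (simp add: algebra_simps)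
      have "\<alpha> (b a (q (b x y))) = q (b (\<alpha> a) (b (\<alpha> x) (\<alpha> y)))"
        using q_act[OF that(1) xy] q_\<alpha>[OF ID(4)[OF xy L(1)]] L by (simp add: twist_brk b_right)
      then show ?thesis unfolding e q_add[OF m] .
    qed
    show "b (\<alpha> a) x = \<alpha> (b a (\<alpha> x))" if "a \<in> S" "x \<in> mid" for a x
      using that SX mid_X by (simp add: twist_brk twist_twist \<alpha>_closed)
    show "B (b a x) y = - B x (b a y)" if "a \<in> S" "x \<in> mid" "y \<in> mid" for a x y
    proof -
      have L: "a \<in> X" "x \<in> X" "y \<in> X" using that SX mid_X by auto
      show ?thesis using skew[OF L(1,2)] B_neg_left[OF b_right(1)[OF L(2,1)] L(3)] B_inv[OF L(2,1,3)] by simp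
    qed
    show "invariant_symmetric_form A B"
      unfolding invariant_symmetric_form_def bilinear_map_on_def linear_map_on_def
      by (auto simp: SX B_add_left B_add_right B_scale_left B_scale_right B_sym B_\<alpha> B_inv)
  qed
qed

section \<open>The isomorphism with the double extension\<close>

definition lift :: "('a \<Rightarrow> 'k) \<Rightarrow> 'a"
  where "lift h = (SOME u. u \<in> J \<and> (\<forall>a\<in>S. B u a = h a))"

lemma lift:
  assumes "h \<in> dual_carr A"
  shows "lift h \<in> J" "a \<in> S \<Longrightarrow> B (lift h) a = h a"
proof -
  have "\<exists>u. u \<in> J \<and> (\<forall>a\<in>S. B u a = h a)" using J_represents[of h] assms by (auto simp: dual_carr_def)
  then have "lift h \<in> J \<and> (\<forall>a\<in>S. B (lift h) a = h a)" unfolding lift_def by (rule someI_ex)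
  then show "lift h \<in> J" "a \<in> S \<Longrightarrow> B (lift h) a = h a" by auto
qed

lemma lift_eqI:
  assumes "u \<in> J" "\<And>a. a \<in> S \<Longrightarrow> B u a = h a"
  shows "lift h = u"
proof -
  have "lift h \<in> J \<and> (\<forall>a\<in>S. B (lift h) a = h a)"
    unfolding lift_def by (rule someI[of _ u]) (use assms in blast)
  then show ?thesis using assms by (intro J_eqI) auto
qed

definition iso :: "('a \<Rightarrow> 'k) \<times> 'a \<times> 'a \<Rightarrow> 'a"
  where "iso = (\<lambda>(h, v, a). lift h + v + a)"

abbreviation "ext \<equiv> double_extension V A b B"

lemma ext_carr: "carr ext = dual_carr A \<times> mid \<times> S"
  by (simp add: double_extension_def)

lemma ext_cases:
  assumes "x \<in> carr ext"
  obtains h v a where "x = (h, v, a)" "h \<in> dual_carr A" "v \<in> mid" "a \<in> S"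
  using assms unfolding ext_carr by auto

lemma lift_closed: "h \<in> dual_carr A \<Longrightarrow> lift h \<in> X"
  using lift(1) JD(2) by blast

lemma lift_sum_closed: "h \<in> dual_carr A \<Longrightarrow> v \<in> mid \<Longrightarrow> a \<in> S \<Longrightarrow> lift h + v + a \<in> X"
  using lift_closed mid_X SX by (intro subspace_add[OF sX]) auto

lemma lift_add:
  assumes "h \<in> dual_carr A" "h' \<in> dual_carr A"
  shows "lift (h + h') = lift h + lift h'"
proof (rule lift_eqI)
  show "lift h + lift h' \<in> J" by (intro subspace_add[OF JD(1)] lift(1) assms)
  show "B (lift h + lift h') a = (h + h') a" if "a \<in> S" for a
    using B_add_left[OF lift_closed[OF assms(1)] lift_closed[OF assms(2)] SX[OF that]] lift(2)[OF assms(1) that] lift(2)[OF assms(2) that] by simp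
qed

lemma lift_scale:
  assumes "h \<in> dual_carr A"
  shows "lift (\<lambda>x. c * h x) = s c (lift h)"
proof (rule lift_eqI)
  show "s c (lift h) \<in> J" by (intro subspace_scale[OF JD(1)] lift(1) assms)
  show "B (s c (lift h)) a = c * h a" if "a \<in> S" for a
    using B_scale_left[OF lift_closed[OF assms] SX[OF that]] lift(2)[OF assms that] by simp
qed

lemma iso_linear: "linear_map_on (scal ext) (carr ext) s X iso"
  unfolding linear_map_on_def ext_carr
  by (auto simp: iso_def double_extension_def lift_sum_closed lift_add lift_scale scale_right_distrib; simp add: add_ac)

lemma iso_bij: "bij_betw iso (carr ext) X"
  unfolding bij_betw_def ext_carr
proof
  show "inj_on iso (dual_carr A \<times> mid \<times> S)"
  proof (rule inj_onI)
    fix x y assume xy: "x \<in> dual_carr A \<times> mid \<times> S" "y \<in> dual_carr A \<times> mid \<times> S" and e: "iso x = iso y"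
    obtain h v a where x: "x = (h, v, a)" "h \<in> dual_carr A" "v \<in> mid" "a \<in> S" using xy(1) by auto
    obtain h' v' a' where y: "y = (h', v', a')" "h' \<in> dual_carr A" "v' \<in> mid" "a' \<in> S" using xy(2) by auto
    note m = x(2-4) y(2-4)
    have e': "lift h + v + a = lift h' + v' + a'" using e by (simp add: iso_def x(1) y(1))
    have li: "lift h \<in> I" "v \<in> I" "lift h' \<in> I" "v' \<in> I" using m lift(1) JI mid_I by auto
    have "a - a' = (lift h' - lift h) + (v' - v)" using e' by (simp add: algebra_simps)
    also have "\<dots> \<in> I" using li by (intro subspace_add[OF ID(1)] subspace_diff[OF ID(1)])
    finally have "a - a' \<in> S \<inter> I" using subspace_diff[OF S_sub m(3,6)] by blast
    then have a: "a = a'" unfolding SI by simp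
    then have "lift h - lift h' = v' - v" using e' by (simp add: algebra_simps)
    moreover have "lift h - lift h' \<in> J" using m lift(1) by (intro subspace_diff[OF JD(1)])
    moreover have "v' - v \<in> mid" by (rule subspace_diff[OF mid_subspace m(5,2)])
    ultimately have "v' - v \<in> mid \<inter> J" "lift h - lift h' \<in> mid \<inter> J" by auto
    then have v: "v = v'" and l: "lift h = lift h'" unfolding mid_J by auto
    have "h x = h' x" for x
    proof (cases "x \<in> S")
      case True
      then show ?thesis using lift(2)[OF m(1) True] lift(2)[OF m(4) True] l by simp
    next
      case False
      then show ?thesis using m(1,4) by (simp add: dual_carr_def)
    qed
    then show "x = y" using a v x(1) y(1) by auto
  qed
  show "iso ` (dual_carr A \<times> mid \<times> S) = X"
  proof
    show "iso ` (dual_carr A \<times> mid \<times> S) \<subseteq> X" using lift_sum_closed by (auto simp: iso_def)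
    show "X \<subseteq> iso ` (dual_carr A \<times> mid \<times> S)"
    proof
      fix x assume x: "x \<in> X"
      have p: "part x \<in> S" by (rule linD(1)[OF part(1) x])
      let ?i = "x - part x"
      have i: "?i \<in> I" by (rule part(2)[OF x])
      \<comment> \<open>The component of \<open>x\<close> in \<open>J\<close>; it is recovered by
        \<open>lift\<close> from the functional that it induces on \<open>S\<close>.\<close>
      let ?u = "?i - q ?i"
      have u: "?u \<in> J" by (rule q(2)[OF i])
      define h where "h = restrict0 S (B ?u)"
      have "h \<in> dual_carr A"
        using JD(2)[OF u] SX subspace_add[OF S_sub] subspace_scale[OF S_sub]
        by (auto simp: h_def dual_carr_def linear_map_on_def restrict0_def B_add_right B_scale_right)
      moreover have "lift h = ?u" by (rule lift_eqI[OF u]) (simp add: h_def restrict0_def)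
      then have "iso (h, q ?i, part x) = x" by (simp add: iso_def)
      ultimately show "x \<in> iso ` (dual_carr A \<times> mid \<times> S)" using q_mid[OF i] p by force
    qed
  qed
qed

lemma iso_brk:
  assumes xy: "x \<in> carr ext" "y \<in> carr ext"
  shows "iso (brk ext x y) = b (iso x) (iso y)"
proof -
  obtain h v a where x: "x = (h, v, a)" "h \<in> dual_carr A" "v \<in> mid" "a \<in> S" using xy(1) by (rule ext_cases)
  obtain h' v' a' where y: "y = (h', v', a')" "h' \<in> dual_carr A" "v' \<in> mid" "a' \<in> S" using xy(2) by (rule ext_cases)
  have L: "lift h \<in> X" "v \<in> X" "a \<in> X" "lift h' \<in> X" "v' \<in> X" "a' \<in> X"
    using x y lift_closed mid_X SX by auto
  \<comment> \<open>The expected component in \<open>J\<close>: brackets of \<open>S\<close> with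
    \<open>J\<close> give the coadjoint terms, and the part of \<open>b v v'\<close> removed by
    \<open>q\<close> gives \<open>psi\<close>.\<close>
  let ?u = "b a (lift h') - b a' (lift h) + (b v v' - q (b v v'))"
  have vv: "b v v' \<in> I" by (rule mid_b(1)[OF x(3) L(5)])
  have uJ: "b a (lift h') \<in> J" "b a' (lift h) \<in> J" "b v v' - q (b v v') \<in> J"
    using JD(4)[OF lift(1)[OF y(2)] L(3)] JD(4)[OF lift(1)[OF x(2)] L(6)] q(2)[OF vv] by auto
  have act: "B (b a (lift h)) c = - h (b a c)" if "a \<in> S" "h \<in> dual_carr A" "c \<in> S" for a h c
  proof -
    note L = SX[OF that(1)] lift_closed[OF that(2)] SX[OF that(3)]
    have "B (b a (lift h)) c = - B (b (lift h) a) c"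
      using brk_skew[OF L(1,2)] B_neg_left[OF b_right(1)[OF L(2,1)] L(3)] by simp
    then show ?thesis using B_inv[OF L(2,1,3)] lift(2)[OF that(2) S_b[OF that(1,3)]] by simp
  qed
  \<comment> \<open>The subtracted term is orthogonal to \<open>S\<close>; invariance and symmetry
    of the form then bring \<open>c\<close> next to \<open>v\<close>.\<close>
  have psi: "B (b v v' - q (b v v')) c = B (b c v) v'" if c: "c \<in> S" for c
  proof -
    note cX = SX[OF c]
    have "B (b v v' - q (b v v')) c = B (b v v') c"
      using B_diff_left[OF ID(2)[OF vv] q_X[OF vv] cX] mid_S[OF q_mid[OF vv] c] by simp
    also have "\<dots> = B v (b v' c)" by (rule B_inv[OF L(2,5) cX])
    also have "\<dots> = B (b v' c) v" by (rule B_sym[OF L(2) b_right(1)[OF L(5) cX]])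
    also have "\<dots> = B v' (b c v)" by (rule B_inv[OF L(5) cX L(2)])
    also have "\<dots> = B (b c v) v'" by (rule B_sym[OF L(5) b_right(1)[OF cX L(2)]])
    finally show ?thesis .
  qed
  have "lift (coad A a h' - coad A a' h + psi V A b v v') = ?u"
  proof (rule lift_eqI)
    show "?u \<in> J" by (intro subspace_add[OF JD(1)] subspace_diff[OF JD(1)] uJ)
    fix c assume c: "c \<in> S"
    note X = JD(2)[OF uJ(1)] JD(2)[OF uJ(2)] JD(2)[OF uJ(3)]
    have "B ?u c = - h' (b a c) + h (b a' c) + B (b c v) v'"
      using act[OF x(4) y(2) c] act[OF y(4) x(2) c] psi[OF c]
      by (simp add: B_add_left[OF subspace_diff[OF sX X(1,2)] X(3) SX[OF c]] B_diff_left[OF X(1,2) SX[OF c]])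
    then show "B ?u c = (coad A a h' - coad A a' h + psi V A b v v') c"
      using c by (simp add: coad_def psi_def restrict0_def)
  qed
  then have "iso (brk ext x y) = ?u + (q (b v v') + b a v' - b a' v) + b a a'"
    by (simp add: x(1) y(1) double_extension_def iso_def)
  also have "\<dots> = b (lift h + v + a) (lift h' + v' + a')"
  proof -
    have z: "b (lift h) (lift h') = 0" "b (lift h) v' = 0" "b v (lift h') = 0"
      using I_J_brk[OF JI[OF lift(1)[OF x(2)]] lift(1)[OF y(2)]] I_J_brk[OF mid_I[OF y(3)] lift(1)[OF x(2)]]
        I_J_brk[OF mid_I[OF x(3)] lift(1)[OF y(2)]] by auto
    have sk: "b a' (lift h) = - b (lift h) a'" "b a' v = - b v a'" by (rule brk_skew[OF L(6,1)], rule brk_skew[OF L(6,2)])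
    have "b (lift h + v + a) (lift h' + v' + a') = b (lift h) a' + (b v v' + b v a') + (b a (lift h') + b a v' + b a a')"
      using L by (simp add: b_left b_right subspace_add[OF sX] z)
    then show ?thesis unfolding sk by (simp add: algebra_simps)
  qed
  finally show ?thesis by (simp add: x(1) y(1) iso_def)
qed

lemma iso_twist:
  assumes xD: "x \<in> carr ext"
  shows "iso (twist ext x) = \<alpha> (iso x)"
proof -
  obtain h v a where x: "x = (h, v, a)" "h \<in> dual_carr A" "v \<in> mid" "a \<in> S" using xD by (rule ext_cases)
  have "lift (dual_twist A h) = \<alpha> (lift h)"
    using lift[OF x(2)] lift_closed[OF x(2)] SX S_\<alpha>
    by (intro lift_eqI JD(5)) (auto simp: dual_twist_def restrict0_def B_\<alpha>)
  then show ?thesis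
    using lift_closed[OF x(2)] mid_X[OF x(3)] SX[OF x(4)]
    by (simp add: x(1) double_extension_def iso_def \<alpha>_add subspace_add[OF sX])
qed

lemma iso_form:
  assumes xy: "x \<in> carr ext" "y \<in> carr ext"
  shows "B (iso x) (iso y) = form ext x y"
proof -
  obtain h v a where x: "x = (h, v, a)" "h \<in> dual_carr A" "v \<in> mid" "a \<in> S" using xy(1) by (rule ext_cases)
  obtain h' v' a' where y: "y = (h', v', a')" "h' \<in> dual_carr A" "v' \<in> mid" "a' \<in> S" using xy(2) by (rule ext_cases)
  have L: "lift h \<in> X" "v \<in> X" "a \<in> X" "lift h' \<in> X" "v' \<in> X" "a' \<in> X"
    using x y lift_closed mid_X SX by auto
  have z: "B (lift h) (lift h') = 0" "B (lift h) v' = 0" "B v (lift h') = 0" "B v a' = 0" "B a v' = 0"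
    using J_orth[OF lift(1)[OF x(2)]] J_orth'[OF lift(1)[OF y(2)]] JI[OF lift(1)[OF y(2)]] mid_I x y mid_S mid_S' by auto
  have "B a (lift h') = h' a" using B_sym[OF L(3,4)] lift(2)[OF y(2) x(4)] by simp
  then show ?thesis
    using L lift(2)[OF x(2) y(4)]
    by (simp add: x(1) y(1) double_extension_def iso_def B_add_left B_add_right subspace_add[OF sX] z)
qed

theorem iso_hom: "quad_hom_lie_iso ext G iso"
  unfolding quad_hom_lie_iso_def using iso_linear iso_bij iso_brk iso_twist iso_form by auto

end

section \<open>The dichotomy for irreducible algebras with trivial center\<close>

theorem theorem7p8:
  fixes G :: "('k::{alg_closed_field, field_char_0}, 'a::ab_group_add) quad_hom_lie"
  assumes "iqh_lie_algebra G"
    and "fin_dim G"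
    and "carr G \<noteq> {0}"
    and "irreducible_quad G"
    and "center G = {0}"
  shows "(involutive_hom_lie_algebra G \<and> simple_hom_lie G) \<or>
    (\<exists>(V :: ('k, 'a) quad_hom_lie) (A :: ('k, 'a) hom_lie) \<phi> \<gamma> f.
      double_extension_data V A \<phi> \<gamma> \<and> simple_hom_lie A \<and>
      quad_hom_lie_iso (double_extension V A \<phi> \<gamma>) G f)"
proof (cases "simple_hom_lie G")
  case True
  then show ?thesis using assms(1) by (simp add: iqh_lie_algebra_def)
next
  case False
  interpret Q: fd_quad G
    by (rule fd_quad.intro[OF assms(1)]) (simp add: fd_quad_axioms_def assms(2))
  let ?X = "carr G"
  have "\<exists>x\<in>?X. \<exists>y\<in>?X. brk G x y \<noteq> 0"
  proof -
    obtain x where "x \<in> ?X" "x \<noteq> 0" using assms(3) Q.subspace_0[OF Q.sX] by blast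
    then have "x \<notin> center G" using assms(5) by simp
    then show ?thesis using \<open>x \<in> ?X\<close> by (auto simp: center_def)
  qed
  then obtain K where K: "hom_ideal G K" "K \<noteq> {0}" "K \<noteq> ?X" using False by (auto simp: simple_hom_lie_def)
  define proper where "proper I \<longleftrightarrow> hom_ideal G I \<and> I \<noteq> ?X" for I
  have sub: "Q.subspace I \<and> I \<subseteq> ?X" if "hom_ideal G I" for I using that by (simp add: hom_ideal_def)
  have "\<exists>I. proper I \<and> (\<forall>I'. proper I' \<longrightarrow> Q.dim I' \<le> Q.dim I)"
  proof (rule ex_has_greatest_nat[of proper K Q.dim "Suc (Q.dim ?X)"])
    show "proper K" using K by (simp add: proper_def)
    show "\<forall>I. proper I \<longrightarrow> Q.dim I < Suc (Q.dim ?X)"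
      using sub Q.dim_le[OF Q.fdX] by (auto simp: proper_def less_Suc_eq_le)
  qed
  then obtain I where I: "hom_ideal G I" "I \<noteq> ?X" and greatest: "\<And>I'. proper I' \<Longrightarrow> Q.dim I' \<le> Q.dim I"
    by (auto simp: proper_def)
  note ID = Q.hom_idealD[OF I(1)]
  have IX: "I \<subseteq> ?X" using ID(2) by blast
  have max: "I' = I \<or> I' = ?X" if "hom_ideal G I'" "I \<subseteq> I'" for I'
  proof (rule ccontr)
    assume n: "\<not> (I' = I \<or> I' = ?X)"
    then have "Q.dim I' \<le> Q.dim I" using greatest[of I'] that(1) by (simp add: proper_def)
    moreover have "Q.dim I < Q.dim I'"
      using Q.dim_less[OF Q.fd_subset[OF Q.fdX] ID(1) that(2)] sub[OF that(1)] n by auto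
    ultimately show False by simp
  qed
  \<comment> \<open>Comparison with \<open>K\<close>, which has positive dimension. A nonzero
    \<open>I\<close> is what allows irreducibility to exclude that \<open>I\<close> is
    nondegenerate.\<close>
  have "I \<noteq> {0}"
  proof
    assume "I = {0}"
    then have "Q.dim K \<le> Q.dim {0}" using greatest[of K] K by (simp add: proper_def)
    moreover have "Q.dim {0} < Q.dim K"
      using Q.dim_less[OF Q.fd_subset[OF Q.fdX], of K "{0}"] sub[OF K(1)] K(2) Q.subspace_0[of K] by auto
    ultimately show False by simp
  qed
  have J: "hom_ideal G (Q.perp I)" by (rule Q.perp_ideal[OF I(1)])
  note JD = Q.hom_idealD[OF J]
  \<comment> \<open>By maximality \<open>I + perp I\<close> is \<open>I\<close> or the whole
    carrier. In the latter case \<open>I \<inter> perp I\<close> is orthogonal to everything, hence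
    zero, and \<open>I\<close> is nondegenerate, against irreducibility.\<close>
  have "Q.perp I \<subseteq> I"
  proof -
    let ?K = "{x + y | x y. x \<in> I \<and> y \<in> Q.perp I}"
    have sum_ideal: "hom_ideal G ?K"
      unfolding hom_ideal_def
    proof (intro conjI ballI)
      show "?K \<subseteq> ?X" using ID(2) JD(2) Q.subspace_add[OF Q.sX] by blast
      show "Q.subspace ?K" by (rule Q.subspace_sums[OF ID(1) JD(1)])
      show "brk G x y \<in> ?K" if x: "x \<in> ?K" and y: "y \<in> ?X" for x y
      proof -
        obtain i j where "x = i + j" "i \<in> I" "j \<in> Q.perp I" using x by blast
        moreover from this have "brk G x y = brk G i y + brk G j y"
          using Q.b_left(1)[OF y] ID(2) JD(2) by simp
        ultimately show ?thesis using ID(3)[OF _ y] JD(3)[OF _ y] by blast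
      qed
      show "twist G x \<in> ?K" if x: "x \<in> ?K" for x
      proof -
        obtain i j where "x = i + j" "i \<in> I" "j \<in> Q.perp I" using x by blast
        moreover from this have "twist G x = twist G i + twist G j"
          using Q.\<alpha>_add ID(2) JD(2) by simp
        ultimately show ?thesis using ID(5) JD(5) by blast
      qed
    qed
    have in1: "x \<in> ?K" if "x \<in> I" for x
    proof -
      have "x + 0 \<in> ?K" using that Q.subspace_0[OF JD(1)] by blast
      then show ?thesis by simp
    qed
    have in2: "x \<in> ?K" if "x \<in> Q.perp I" for x
    proof -
      have "0 + x \<in> ?K" using that Q.subspace_0[OF ID(1)] by blast
      then show ?thesis by simp
    qed
    have "?K \<noteq> ?X"
    proof
      assume e: "?K = ?X"
      have "x = 0" if x: "x \<in> I" "x \<in> Q.perp I" for x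
      proof (rule Q.B_nondeg[OF ID(2)[OF x(1)]])
        fix y assume "y \<in> ?X"
        then obtain i j where ij: "y = i + j" "i \<in> I" "j \<in> Q.perp I" using e by blast
        have "form G x i = 0" using x(2) ij(2) by (simp add: Q.perp_def)
        moreover have "form G x j = form G j x" by (rule Q.B_sym[OF ID(2)[OF x(1)] JD(2)[OF ij(3)]])
        moreover have "form G j x = 0" using x(1) ij(3) by (simp add: Q.perp_def)
        ultimately show "form G x y = 0"
          unfolding ij(1) using Q.B_add_right[OF ID(2)[OF x(1)] ID(2)[OF ij(2)] JD(2)[OF ij(3)]] by simp
      qed
      then have "nondegenerate_on (form G) I"
        using ID(2) by (auto simp: nondegenerate_on_def Q.perp_def)
      then show False using assms(4) I \<open>I \<noteq> {0}\<close> by (auto simp: irreducible_quad_def)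
    qed
    moreover have "I \<subseteq> ?K" using in1 by (rule subsetI)
    ultimately have "?K = I" using max[OF sum_ideal] by blast
    then show ?thesis using in2 by blast
  qed
  obtain u where u: "u \<in> Q.perp I" "u \<noteq> 0" using Q.perp_nontrivial[OF ID(1) IX I(2)] by blast
  \<comment> \<open>If all brackets lay in \<open>I\<close>, then
    \<open>B([u, x], y) = B(u, [x, y]) = 0\<close> for all \<open>x\<close> and \<open>y\<close>,
    and by nondegeneracy the nonzero vector \<open>u\<close> would be central.\<close>
  have "\<exists>x\<in>?X. \<exists>y\<in>?X. brk G x y \<notin> I"
  proof (rule ccontr)
    assume n: "\<not> ?thesis"
    have uX: "u \<in> ?X" by (rule JD(2)[OF u(1)])
    have "brk G u x = 0" if x: "x \<in> ?X" for x
    proof (rule Q.B_nondeg[OF Q.b_right(1)[OF uX x]])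
      fix y assume y: "y \<in> ?X"
      have "brk G x y \<in> I" using n x y by blast
      then show "form G (brk G u x) y = 0" using Q.B_inv[OF uX x y] u(1) by (simp add: Q.perp_def)
    qed
    then have "u \<in> center G" using uX by (simp add: center_def)
    then show False using assms(5) u(2) by simp
  qed
  then obtain x0 y0 where xy0: "x0 \<in> ?X" "y0 \<in> ?X" "Q.yau x0 y0 \<notin> I"
    using Q.twisted_mem[of I] ID(5) by blast
  have "\<exists>S. Q.Y.inv_subalgebra S \<and> S \<inter> I = {0} \<and> (\<forall>x\<in>?X. \<exists>i\<in>I. x - i \<in> S)
    \<and> (\<forall>K. inv_lie_algebra.inv_ideal (scal G) S Q.yau (twist G) K \<longrightarrow> K = {0} \<or> K = S)"
  proof (rule Q.Y.equivariant_levi[OF _ _ xy0])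
    show "Q.Y.inv_ideal I" using I(1) by (simp add: Q.hom_ideal_iff)
    show "K = I \<or> K = ?X" if "Q.Y.inv_ideal K" "I \<subseteq> K" for K
      using max[of K] that by (simp add: Q.hom_ideal_iff)
  qed
  then obtain S where S: "Q.Y.inv_subalgebra S" "S \<inter> I = {0}" "\<And>x. x \<in> ?X \<Longrightarrow> \<exists>i\<in>I. x - i \<in> S"
    and simpleS: "\<And>K. inv_lie_algebra.inv_ideal (scal G) S Q.yau (twist G) K \<Longrightarrow> K = {0} \<or> K = S" by blast
  interpret P: split_quad G I S
    by unfold_locales (use I(1) \<open>Q.perp I \<subseteq> I\<close> S in auto)
  interpret T: inv_lie_algebra "scal G" S Q.yau "twist G" by (rule Q.Y.inv_subalgebra_locale[OF S(1)])
  have "simple_hom_lie P.A"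
    unfolding simple_hom_lie_def
  proof (intro conjI allI impI)
    obtain i where i: "i \<in> I" "x0 - i \<in> S" using S(3)[OF xy0(1)] by blast
    obtain j where j: "j \<in> I" "y0 - j \<in> S" using S(3)[OF xy0(2)] by blast
    have X: "i \<in> ?X" "j \<in> ?X" "x0 - i \<in> ?X" "y0 - j \<in> ?X" using i j ID(2) P.SX by auto
    have "brk G (x0 - i) (y0 - j) \<noteq> 0"
    proof
      assume z: "brk G (x0 - i) (y0 - j) = 0"
      have "brk G x0 y0 = brk G (x0 - i) (y0 - j) + (brk G (x0 - i) j + brk G i y0)"
        using X xy0 by (simp add: Q.b_left Q.b_right)
      also have "\<dots> \<in> I"
        unfolding z using ID(3)[OF i(1) xy0(2)] ID(4)[OF j(1) X(3)] Q.subspace_add[OF ID(1)] by simp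
      finally show False using Q.twisted_mem[of I x0 y0] ID(5) xy0 by blast
    qed
    then show "\<exists>x\<in>carr P.A. \<exists>y\<in>carr P.A. brk P.A x y \<noteq> 0" using i(2) j(2) by auto
    fix K assume K: "hom_ideal P.A K"
    \<comment> \<open>Simplicity of \<open>S\<close> was obtained for the twisted bracket; stability
      of \<open>K\<close> under the twist carries it over to the original one.\<close>
    have "Q.yau x y \<in> K" if "x \<in> K" "y \<in> S" for x y
      using K that P.SX Q.twisted_mem[of K x y] by (auto simp: hom_ideal_def)
    then have "T.inv_ideal K" using K by (simp add: T.inv_ideal_def hom_ideal_def)
    then show "K = {0} \<or> K = carr P.A" using simpleS[of K] by simp
  qed
  then show ?thesis using P.extension_data P.iso_hom by blast
qed

end
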